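(* Let $H$ be a separable real Hilbert space, and let $\sigma$, $(A(t))_{t\ge0}$, $b$, $n(t,x;dy)$, $(e_n)_{n\ge1}$, the interval $I\subset[0,\infty)$, the Borel set $M\subset D(b)$, the class of test functions $\mathcal D$, and the parabolic integro-differential operator ${\sf L}=\frac{\partial}{\partial t}+{\sf L}_t$ on $\mathcal D$ be as described in the context. Let $F:=\{(t,x)\in[0,\infty)\times H:n(t,x;\cdot)=0\}$ and let $G$ be the interior of $F\cap(I\times M)$ relative to the trace topology on $I\times M$. Let $X$ be a càdlàg right Markov process on $I\times M$ with resolvent $\overline{\mathcal U}=(\overline U_\alpha)_{\alpha>0}$ which is a solution to the martingale problem associated to $({\sf L},\mathcal D)$. Suppose that the coefficients of ${\sf L}$ are such that, for some $\alpha_0>0$, $\overline U_{\alpha_0}(|{\sf L}f|)<\infty$ for all $f\in\mathcal D$; this is always fulfilled if the coefficients are uniformly bounded in $(t,x)$. Then $X$ is a diffusion in $G$.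
   Context: **Coefficients.** $(H,\langle\cdot,\cdot\rangle)$ carries the norm topology. - $\sigma:[0,\infty)\times H\to L_s(H)$ is measurable, $L_s(H)$ being the bounded symmetric linear operators on $H$. - $(A(t))_{t\ge0}$ is a family of densely defined linear operators on $H$ with adjoints $A^*(t)$ such that there is a countable set $(e_n)_{n\ge1}\subset\bigcap_{t\ge0}D(A^*(t))$ total in $H$, and $t\mapsto A^*(t)x\in H$ is measurable for every $x\in\bigcap_{t\ge0}D(A^*(t))$. - $b:[0,\infty)\times D(b)\to H$ is measurable, $D(b)\in\mathcal B(H)$. - $n(t,x;dy)$ is a Lévy measure on $H$ for each $(t,x)\in[0,\infty)\times H$, with $(t,x)\mapsto\int_B 1\wedge|y|^2\,n(t,x;dy)\in[0,\infty)$ measurable for all $B\in\mathcal B(H)$. **Operator.** For $t\ge0$, $x\in D(b)$ and $f(x)=\varphi(\langle x,e_1\rangle,\dots,\langle x,e_n\rangle)$ with $\varphi\in C_c^\infty(\mathbb R^n)$, $n\ge1$ (respectively $f\in C_c^\infty(\mathbb R^d)$ if $H=\mathbb R^d$), $${\sf L}_tf(x)=\tfrac12\mathrm{Tr}[\sigma(t,x)^2D^2f(x)]+\langle x,A^*(t)Df(x)\rangle+\langle b(t,x),Df(x)\rangle+\int_H\Big[f(x+y)-f(x)-\frac{\langle y,Df(x)\rangle}{1+|y|^2}\Big]n(t,x;dy).$$ $I\subset[0,\infty)$ is an interval, $M\subset D(b)$ is Borel in $H$, and $$\mathcal D:=\{f:I\times H\to\mathbb R:\ f(t,x)=\varphi(t,\langle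 x,e_1\rangle,\dots,\langle x,e_n\rangle),\ \varphi\in C_c^\infty(I\times\mathbb R^n),\ n\ge1\},\qquad {\sf L}f=\Big(\frac{\partial}{\partial t}+{\sf L}_t\Big)f .$$ **Right processes.** Let $S:=I\times M$ (a Lusin space with trace topology, Borel $\sigma$-algebra $\mathcal B(S)$). $\zeta$ is the lifetime, functions are extended by $0$ at the cemetery, $\overline U_\alpha f(x)=\mathbb E^x\int_0^\infty e^{-\alpha t}f(X_t)dt$, $T_A:=\inf\{t>0:X_t\in A\}$, and $\theta_t$ are the shift operators. For $q\ge 0$, a Borel $v:S\to[0,\infty]$ is $q$-excessive if $\alpha\overline U_{q+\alpha}v\le v$ for all $\alpha>0$ and $\sup_\alpha\alpha\overline U_{q+\alpha}v=v$. A right process is a normal Markov process with right-continuous, universally augmented filtration and a.s. right continuous paths such that for $q>0$ and each $q$-excessive $f$, $f(X)$ is a.s. right continuous under every $\mathbb P^x$. Càdlàg: a.s. right continuous with left limits in $S$ on $[0,\zeta)$. **Martingale problem.** $X$ solves the martingale problem associated to $({\sf L},\mathcal D)$ if for each $f\in\mathcal D$ (${\sf L}f$ being Borel measurable), $f(X_{t\wedge\zeta})-\int_0^{t\wedge\zeta}{\sf L}f(X_r)dr$, $t\ge0$, is an $(\mathcal F_t)$-martingale under $\mathbb P^x$ for every $x\in S$. **Diffusion.** For $G\subset S$ open choose open $G_n\subset G$ with $\overline G_n\subset G_{n+1}$, $\bigcup_nG_n=G$; $S_n^1:=T_{G_n}$, $T_n^k:=S_n^k+T_{S\setminus G}\circ\theta_{S_n^k}$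 ($k\ge1$), $S_n^k:=T_n^{k-1}+T_{G_n}\circ\theta_{T_n^{k-1}}$ ($k\ge2$); $I_G:=\bigcup_n\bigcup_k(S_n^k,T_n^k)$ (independent of the choice). $X$ is a diffusion in $G$ if for every $x\in S$, $\mathbb P^x$-a.s. $I_G\cap[0,\zeta)\ni t\mapsto X_t$ is continuous (no condition where this set is empty). *)

theory Defs
  imports "HOL-Probability.Probability"
begin

section \<open>Differential calculus and operators on a real Hilbert space\<close>

definition grad :: "('h::real_inner \<Rightarrow> real) \<Rightarrow> 'h \<Rightarrow> 'h" where
  "grad g x = (THE v. GDERIV g x :> v)"

definition hess :: "('h::real_inner \<Rightarrow> real) \<Rightarrow> 'h \<Rightarrow> 'h \<Rightarrow> 'h" where
  "hess g x = frechet_derivative (grad g) (at x)"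

definition orthonormal_basis :: "'h::real_inner set \<Rightarrow> bool" where
  "orthonormal_basis B \<longleftrightarrow>
     (\<forall>u\<in>B. \<forall>v\<in>B. u \<bullet> v = (if u = v then 1 else 0)) \<and> closure (span B) = UNIV"

text \<open>The trace is applied only to operators of finite rank, for which the sum below converges
  to the same value for all orthonormal bases.\<close>

definition trace_op :: "('h::real_inner \<Rightarrow> 'h) \<Rightarrow> real" where
  "trace_op T = (THE s. \<forall>B. orthonormal_basis B \<longrightarrow> ((\<lambda>u. T u \<bullet> u) has_sum s) B)"

text \<open>An unbounded operator is given by its domain \<open>D\<close> and a total function \<open>T\<close>, of which only
  the values on \<open>D\<close> matter.\<close>

definition densely_defined_operator :: "'h::real_inner set \<Rightarrow> ('h \<Rightarrow> 'h) \<Rightarrow> bool" where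
  "densely_defined_operator D T \<longleftrightarrow>
     subspace D \<and> closure D = UNIV \<and>
     (\<forall>x\<in>D. \<forall>y\<in>D. T (x + y) = T x + T y) \<and> (\<forall>c. \<forall>x\<in>D. T (c *\<^sub>R x) = c *\<^sub>R T x)"

definition adjoint_dom :: "'h::real_inner set \<Rightarrow> ('h \<Rightarrow> 'h) \<Rightarrow> 'h set" where
  "adjoint_dom D T = {y. \<exists>z. \<forall>x\<in>D. T x \<bullet> y = x \<bullet> z}"

definition adjoint_op :: "'h::real_inner set \<Rightarrow> ('h \<Rightarrow> 'h) \<Rightarrow> 'h \<Rightarrow> 'h" where
  "adjoint_op D T y = (THE z. \<forall>x\<in>D. T x \<bullet> y = x \<bullet> z)"

definition levy_measure :: "'h::{real_inner, polish_space} measure \<Rightarrow> bool" where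
  "levy_measure \<nu> \<longleftrightarrow> sets \<nu> = sets borel \<and> emeasure \<nu> {0} = 0 \<and>
     (\<integral>\<^sup>+y. ennreal (min 1 ((norm y)\<^sup>2)) \<partial>\<nu>) < \<infinity>"


section \<open>The coefficients\<close>

text \<open>\<open>\<sigma>\<close>, \<open>A(t)\<close> with its domain, \<open>b\<close> with its spatial domain \<open>D(b)\<close>, the kernel \<open>n(t,x;dy)\<close> and
  the total sequence, numbered from 0 instead of 1. The functions are total; their values
  at times \<open>t < 0\<close>, and those of \<open>b\<close> at \<open>x \<notin> D(b)\<close>, are irrelevant.\<close>

record 'h coefficients =
  sig :: "real \<Rightarrow> 'h \<Rightarrow> 'h \<Rightarrow> 'h"
  Adom :: "real \<Rightarrow> 'h set"
  Aop :: "real \<Rightarrow> 'h \<Rightarrow> 'h"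
  bdom :: "'h set"
  drift :: "real \<Rightarrow> 'h \<Rightarrow> 'h"
  jump :: "real \<Rightarrow> 'h \<Rightarrow> 'h measure"
  test :: "nat \<Rightarrow> 'h"

abbreviation Astar_dom :: "('h::{real_inner, polish_space}) coefficients \<Rightarrow> real \<Rightarrow> 'h set" where
  "Astar_dom K t \<equiv> adjoint_dom (Adom K t) (Aop K t)"

abbreviation Astar :: "('h::{real_inner, polish_space}) coefficients \<Rightarrow> real \<Rightarrow> 'h \<Rightarrow> 'h" where
  "Astar K t \<equiv> adjoint_op (Adom K t) (Aop K t)"

text \<open>Measurability of the operator-valued function \<open>\<sigma>\<close> is understood with respect to the
  sigma-algebra generated by the evaluations at the vectors of the space; this is implied by Borel
  measurability for the operator norm.\<close>

definition admissible :: "('h::{real_inner, polish_space}) coefficients \<Rightarrow> bool" where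
  "admissible K \<longleftrightarrow>
     (\<forall>t\<ge>0. \<forall>x. bounded_linear (sig K t x) \<and> (\<forall>u v. sig K t x u \<bullet> v = u \<bullet> sig K t x v)) \<and>
     (\<forall>u. (\<lambda>(t, x). sig K t x u) \<in> borel_measurable (restrict_space borel ({0..} \<times> UNIV))) \<and>
     (\<forall>t\<ge>0. densely_defined_operator (Adom K t) (Aop K t)) \<and>
     range (test K) \<subseteq> (\<Inter>t\<in>{0..}. Astar_dom K t) \<and>
     closure (span (range (test K))) = UNIV \<and>
     (\<forall>x\<in>(\<Inter>t\<in>{0..}. Astar_dom K t).
        (\<lambda>t. Astar K t x) \<in> borel_measurable (restrict_space borel {0..})) \<and>
     bdom K \<in> sets borel \<and>
     (\<lambda>(t, x). drift K t x) \<in> borel_measurable (restrict_space borel ({0..} \<times> bdom K)) \<and>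
     (\<forall>t\<ge>0. \<forall>x. levy_measure (jump K t x)) \<and>
     (\<forall>B\<in>sets borel. (\<lambda>(t, x). \<integral>\<^sup>+y\<in>B. ennreal (min 1 ((norm y)\<^sup>2)) \<partial>jump K t x)
        \<in> borel_measurable (restrict_space borel ({0..} \<times> UNIV)))"

definition no_jump_set :: "('h::{real_inner, polish_space}) coefficients \<Rightarrow> (real \<times> 'h) set" where
  "no_jump_set K = {(t, x). 0 \<le> t \<and> (\<forall>B\<in>sets borel. emeasure (jump K t x) B = 0)}"

text \<open>Uniform boundedness of the coefficients on \<open>S\<close>. The coefficient belonging to \<open>A(t)\<close> is
  \<open>(t,x) \<mapsto> \<langle>x, A\<^sup>*(t) e\<rangle>\<close>, one for each \<open>e\<close> in the total sequence.\<close>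

definition bounded_coefficients ::
    "('h::{real_inner, polish_space}) coefficients \<Rightarrow> (real \<times> 'h) set \<Rightarrow> bool" where
  "bounded_coefficients K S \<longleftrightarrow>
     (\<exists>C. \<forall>(t, x)\<in>S. onorm (sig K t x) \<le> C \<and> norm (drift K t x) \<le> C \<and>
        (\<integral>\<^sup>+y. ennreal (min 1 ((norm y)\<^sup>2)) \<partial>jump K t x) \<le> ennreal C) \<and>
     (\<forall>i. \<exists>C. \<forall>(t, x)\<in>S. \<bar>x \<bullet> Astar K t (test K i)\<bar> \<le> C)"


section \<open>Test functions and the parabolic operator\<close>

text \<open>\<open>\<real>\<^sup>n\<close> as the space of real sequences vanishing from index \<open>n\<close> on. The product topology of
  \<^typ>\<open>nat \<Rightarrow> real\<close> induces the usual one.\<close>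

definition Rn :: "nat \<Rightarrow> (nat \<Rightarrow> real) set" where
  "Rn n = {z. \<forall>i\<ge>n. z i = 0}"

text \<open>\<open>C\<^sup>k(I \<times> \<real>\<^sup>n)\<close>: the partial derivatives up to order \<open>k\<close>, one-sided in time at the end
  points of \<open>I\<close> that belong to \<open>I\<close>, exist and are continuous on \<open>I \<times> \<real>\<^sup>n\<close>.\<close>

primrec Ck :: "nat \<Rightarrow> real set \<Rightarrow> nat \<Rightarrow> (real \<times> (nat \<Rightarrow> real) \<Rightarrow> real) \<Rightarrow> bool" where
  "Ck 0 I n \<phi> \<longleftrightarrow> continuous_on (I \<times> Rn n) \<phi>"
| "Ck (Suc k) I n \<phi> \<longleftrightarrow> continuous_on (I \<times> Rn n) \<phi> \<and>
     (\<exists>\<psi>. Ck k I n \<psi> \<and>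
        (\<forall>t\<in>I. \<forall>z\<in>Rn n. ((\<lambda>s. \<phi> (s, z)) has_real_derivative \<psi> (t, z)) (at t within I))) \<and>
     (\<forall>i<n. \<exists>\<psi>. Ck k I n \<psi> \<and>
        (\<forall>t\<in>I. \<forall>z\<in>Rn n. ((\<lambda>s. \<phi> (t, z(i := s))) has_real_derivative \<psi> (t, z)) (at (z i))))"

definition Cc_infinity :: "real set \<Rightarrow> nat \<Rightarrow> (real \<times> (nat \<Rightarrow> real) \<Rightarrow> real) set" where
  "Cc_infinity I n = {\<phi>. (\<forall>k. Ck k I n \<phi>) \<and>
     (\<exists>C. compact C \<and> C \<subseteq> I \<times> Rn n \<and> (\<forall>p\<in>I \<times> Rn n - C. \<phi> p = 0))}"

definition coords :: "(nat \<Rightarrow> 'h::real_inner) \<Rightarrow> nat \<Rightarrow> 'h \<Rightarrow> nat \<Rightarrow> real" where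
  "coords e n x = (\<lambda>i. if i < n then x \<bullet> e i else 0)"

text \<open>Functions on \<open>I \<times> H\<close> are represented by total functions; their values outside \<open>I \<times> H\<close> are
  irrelevant.\<close>

definition test_functions ::
    "('h::{real_inner, polish_space}) coefficients \<Rightarrow> real set \<Rightarrow> (real \<times> 'h \<Rightarrow> real) set" where
  "test_functions K I = {f. \<exists>n\<ge>1. \<exists>\<phi>\<in>Cc_infinity I n.
     \<forall>t\<in>I. \<forall>x. f (t, x) = \<phi> (t, coords (test K) n x)}"

definition spatial_op ::
    "('h::{real_inner, polish_space}) coefficients \<Rightarrow> real \<Rightarrow> ('h \<Rightarrow> real) \<Rightarrow> 'h \<Rightarrow> real" where
  "spatial_op K t g x =
     1 / 2 * trace_op (\<lambda>u. sig K t x (sig K t x (hess g x u))) +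
     x \<bullet> Astar K t (grad g x) +
     drift K t x \<bullet> grad g x +
     (\<integral>y. g (x + y) - g x - (y \<bullet> grad g x) / (1 + (norm y)\<^sup>2) \<partial>jump K t x)"

definition parabolic_op ::
    "('h::{real_inner, polish_space}) coefficients \<Rightarrow> real set \<Rightarrow> (real \<times> 'h \<Rightarrow> real) \<Rightarrow> real \<times> 'h \<Rightarrow> real"
where
  "parabolic_op K I f = (\<lambda>(t, x).
     vector_derivative (\<lambda>s. f (s, x)) (at t within I) + spatial_op K t (\<lambda>y. f (t, y)) x)"


section \<open>Markov processes with lifetime\<close>

text \<open>The data \<open>(\<Omega>, X\<^sub>t, \<theta>\<^sub>t, P\<^sup>x)\<close> of a process with state space \<open>S\<close>; the cemetery is
  \<^const>\<open>None\<close>, and \<open>P\<^sup>x\<close> is indexed by the extended state space. Time is \<open>[0,\<infinity>)\<close>.\<close>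

record ('w, 's) process =
  paths :: "'w set"
  pos :: "real \<Rightarrow> 'w \<Rightarrow> 's option"
  shift :: "real \<Rightarrow> 'w \<Rightarrow> 'w"
  law :: "'s option \<Rightarrow> 'w measure"

definition state_space :: "'s::topological_space set \<Rightarrow> 's option measure" where
  "state_space S = sigma (insert None (Some ` S))
     (insert {None} ((\<lambda>B. Some ` B) ` sets (restrict_space borel S)))"

definition ext0 :: "('s \<Rightarrow> 'b::zero) \<Rightarrow> 's option \<Rightarrow> 'b" where
  "ext0 f y = (case y of None \<Rightarrow> 0 | Some x \<Rightarrow> f x)"

definition lifetime :: "('w, 's) process \<Rightarrow> 'w \<Rightarrow> ereal" where
  "lifetime Z \<omega> = Inf {ereal t | t. 0 \<le> t \<and> pos Z t \<omega> = None}"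

definition natural :: "'s::topological_space set \<Rightarrow> ('w, 's) process \<Rightarrow> real set \<Rightarrow> 'w measure" where
  "natural S Z T = sigma (paths Z)
     {pos Z s -` B \<inter> paths Z | s B. s \<in> T \<and> B \<in> sets (state_space S)}"

definition initial_laws :: "'s::topological_space set \<Rightarrow> 's option measure set" where
  "initial_laws S = {\<mu>. prob_space \<mu> \<and> sets \<mu> = sets (state_space S)}"

text \<open>\<open>P\<^sup>\<mu> = \<integral> P\<^sup>x \<mu>(dx)\<close>; the completion of \<open>\<mu>\<close> allows for \<open>x \<mapsto> P\<^sup>x\<close> that is universally
  measurable only.\<close>

definition law_from :: "('w, 's::topological_space) process \<Rightarrow> 's option measure \<Rightarrow> 'w measure" where
  "law_from Z \<mu> = completion \<mu> \<bind> law Z"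

text \<open>The universally augmented natural filtration: the intersection, over all initial laws \<open>\<mu>\<close>,
  of the sigma-algebras generated by the natural one at time \<open>t\<close> and the \<open>P\<^sup>\<mu>\<close>-null sets. It
  consists of sets that are measurable for the completion of each \<open>P\<^sup>x\<close>, which is why expectations
  below are taken with respect to completed laws.\<close>

definition augmented :: "'s::topological_space set \<Rightarrow> ('w, 's) process \<Rightarrow> real \<Rightarrow> 'w measure" where
  "augmented S Z t = sigma (paths Z)
     (\<Inter>\<mu>\<in>initial_laws S. sigma_sets (paths Z)
        (sets (natural S Z {0..t}) \<union> null_sets (completion (law_from Z \<mu>))))"

text \<open>The fourth condition says that each \<open>P\<^sup>x\<close> is a probability measure on the sigma-algebra
  generated by the process and that \<open>x \<mapsto> P\<^sup>x\<close> is universally measurable. The fifth one is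
  normality.\<close>

definition markov_process :: "'s::topological_space set \<Rightarrow> ('w, 's) process \<Rightarrow> bool" where
  "markov_process S Z \<longleftrightarrow>
     (\<forall>\<omega>\<in>paths Z. \<forall>t\<ge>0. pos Z t \<omega> \<in> insert None (Some ` S)) \<and>
     (\<forall>\<omega>\<in>paths Z. \<forall>t\<ge>0. lifetime Z \<omega> \<le> ereal t \<longrightarrow> pos Z t \<omega> = None) \<and>
     (\<forall>\<omega>\<in>paths Z. \<forall>t\<ge>0. shift Z t \<omega> \<in> paths Z \<and>
        (\<forall>s\<ge>0. pos Z s (shift Z t \<omega>) = pos Z (s + t) \<omega>)) \<and>
     (\<forall>\<mu>\<in>initial_laws S. law Z \<in> completion \<mu> \<rightarrow>\<^sub>M prob_algebra (natural S Z {0..})) \<and>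
     (\<forall>x\<in>insert None (Some ` S). AE \<omega> in law Z x. pos Z 0 \<omega> = x) \<and>
     (\<forall>x\<in>insert None (Some ` S). \<forall>s\<ge>0. \<forall>t\<ge>0. \<forall>B\<in>sets (state_space S).
        AE \<omega> in completion (law Z x).
          real_cond_exp (completion (law Z x)) (augmented S Z t)
            (indicat_real {\<omega>\<in>paths Z. pos Z (s + t) \<omega> \<in> B}) \<omega>
          = measure (law Z (pos Z t \<omega>)) {\<omega>'\<in>paths Z. pos Z s \<omega>' \<in> B})"

definition resolvent ::
    "('w, 's) process \<Rightarrow> real \<Rightarrow> ('s \<Rightarrow> ennreal) \<Rightarrow> 's \<Rightarrow> ennreal" where
  "resolvent Z \<alpha> f x =
     (\<integral>\<^sup>+\<omega>. (\<integral>\<^sup>+t\<in>{0..}. ennreal (exp (- \<alpha> * t)) * ext0 f (pos Z t \<omega>) \<partial>lborel)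
        \<partial>completion (law Z (Some x)))"

definition excessive ::
    "'s::topological_space set \<Rightarrow> ('w, 's) process \<Rightarrow> real \<Rightarrow> ('s \<Rightarrow> ennreal) \<Rightarrow> bool" where
  "excessive S Z q v \<longleftrightarrow> v \<in> borel_measurable (restrict_space borel S) \<and>
     (\<forall>x\<in>S. (\<forall>\<alpha>>0. ennreal \<alpha> * resolvent Z (q + \<alpha>) v x \<le> v x) \<and>
        (SUP \<alpha>\<in>{0<..}. ennreal \<alpha> * resolvent Z (q + \<alpha>) v x) = v x)"

text \<open>The lifetime condition in \<^const>\<open>markov_process\<close> makes paths constant from the lifetime on,
  so right continuity is only at issue before it.\<close>

definition right_continuous_path :: "('w, 's::topological_space) process \<Rightarrow> 'w \<Rightarrow> bool" where
  "right_continuous_path Z \<omega> \<longleftrightarrow>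
     (\<forall>t\<ge>0. ereal t < lifetime Z \<omega> \<longrightarrow> continuous (at_right t) (\<lambda>s. the (pos Z s \<omega>)))"

definition right_process :: "'s::topological_space set \<Rightarrow> ('w, 's) process \<Rightarrow> bool" where
  "right_process S Z \<longleftrightarrow> markov_process S Z \<and>
     (\<forall>t\<ge>0. sets (augmented S Z t) = (\<Inter>s\<in>{t<..}. sets (augmented S Z s))) \<and>
     (\<forall>x\<in>S. AE \<omega> in law Z (Some x). right_continuous_path Z \<omega>) \<and>
     (\<forall>q>0. \<forall>v. excessive S Z q v \<longrightarrow>
        (\<forall>x\<in>S. AE \<omega> in law Z (Some x).
           \<forall>t\<ge>0. continuous (at_right t) (\<lambda>s. ext0 v (pos Z s \<omega>))))"

definition cadlag_process :: "'s::topological_space set \<Rightarrow> ('w, 's) process \<Rightarrow> bool" where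
  "cadlag_process S Z \<longleftrightarrow>
     (\<forall>x\<in>S. AE \<omega> in law Z (Some x). right_continuous_path Z \<omega> \<and>
        (\<forall>t>0. ereal t < lifetime Z \<omega> \<longrightarrow>
           (\<exists>l\<in>S. ((\<lambda>s. the (pos Z s \<omega>)) \<longlongrightarrow> l) (at_left t))))"


section \<open>The martingale problem\<close>

definition martingale :: "'w measure \<Rightarrow> (real \<Rightarrow> 'w measure) \<Rightarrow> (real \<Rightarrow> 'w \<Rightarrow> real) \<Rightarrow> bool" where
  "martingale P F Y \<longleftrightarrow>
     (\<forall>t\<ge>0. Y t \<in> borel_measurable (F t) \<and> integrable P (Y t)) \<and>
     (\<forall>s t. 0 \<le> s \<and> s \<le> t \<longrightarrow> (AE \<omega> in P. real_cond_exp P (F s) (Y t) \<omega> = Y s \<omega>))"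

definition solves_martingale_problem ::
    "'s::topological_space set \<Rightarrow> ('w, 's) process \<Rightarrow>
     (('s \<Rightarrow> real) \<Rightarrow> 's \<Rightarrow> real) \<Rightarrow> ('s \<Rightarrow> real) set \<Rightarrow> bool" where
  "solves_martingale_problem S Z L \<D> \<longleftrightarrow>
     (\<forall>f\<in>\<D>. L f \<in> borel_measurable (restrict_space borel S) \<and>
        (\<forall>x\<in>S. martingale (completion (law Z (Some x))) (augmented S Z)
           (\<lambda>t \<omega>. let \<tau> = real_of_ereal (min (ereal t) (lifetime Z \<omega>)) in
              ext0 f (pos Z \<tau> \<omega>) - (LINT r:{0..\<tau>}|lborel. ext0 (L f) (pos Z r \<omega>)))))"


section \<open>Diffusion in an open set\<close>

definition hitting :: "('w, 's) process \<Rightarrow> 's set \<Rightarrow> 'w \<Rightarrow> ereal" where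
  "hitting Z A \<omega> = Inf {ereal t | t. 0 < t \<and> pos Z t \<omega> \<in> Some ` A}"

text \<open>\<open>\<tau> + T\<^sub>A \<circ> \<theta>\<^sub>\<tau>\<close>, which is \<open>\<infinity>\<close> where \<open>\<tau> = \<infinity>\<close>.\<close>

definition hitting_after :: "('w, 's) process \<Rightarrow> ('w \<Rightarrow> ereal) \<Rightarrow> 's set \<Rightarrow> 'w \<Rightarrow> ereal" where
  "hitting_after Z \<tau> A \<omega> = \<tau> \<omega> + hitting Z A (shift Z (real_of_ereal (\<tau> \<omega>)) \<omega>)"

text \<open>The times \<open>S\<^sub>n\<^sup>k\<close> and \<open>T\<^sub>n\<^sup>k\<close>, with \<open>k\<close> numbered from 0 and \<open>g\<close> for \<open>G\<^sub>n\<close>.\<close>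

primrec entry_time ::
    "'s set \<Rightarrow> ('w, 's) process \<Rightarrow> 's set \<Rightarrow> 's set \<Rightarrow> nat \<Rightarrow> 'w \<Rightarrow> ereal" where
  "entry_time S Z G g 0 = hitting Z g"
| "entry_time S Z G g (Suc k) = hitting_after Z (hitting_after Z (entry_time S Z G g k) (S - G)) g"

definition exit_time ::
    "'s set \<Rightarrow> ('w, 's) process \<Rightarrow> 's set \<Rightarrow> 's set \<Rightarrow> nat \<Rightarrow> 'w \<Rightarrow> ereal" where
  "exit_time S Z G g k = hitting_after Z (entry_time S Z G g k) (S - G)"

definition times_in ::
    "'s set \<Rightarrow> ('w, 's) process \<Rightarrow> 's set \<Rightarrow> (nat \<Rightarrow> 's set) \<Rightarrow> 'w \<Rightarrow> real set" where
  "times_in S Z G Gs \<omega> =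
     (\<Union>n k. {t. entry_time S Z G (Gs n) k \<omega> < ereal t \<and> ereal t < exit_time S Z G (Gs n) k \<omega>})"

definition exhausts :: "'s::topological_space set \<Rightarrow> 's set \<Rightarrow> (nat \<Rightarrow> 's set) \<Rightarrow> bool" where
  "exhausts S G Gs \<longleftrightarrow>
     (\<forall>n. openin (top_of_set S) (Gs n) \<and> Gs n \<subseteq> G \<and>
        (top_of_set S) closure_of (Gs n) \<subseteq> Gs (Suc n)) \<and>
     (\<Union>n. Gs n) = G"

text \<open>The set of times does not depend on the exhausting sequence, so the definition requires
  continuity for all of them; in a metric space there always is one.\<close>

definition diffusion_in :: "'s::topological_space set \<Rightarrow> ('w, 's) process \<Rightarrow> 's set \<Rightarrow> bool" where
  "diffusion_in S Z G \<longleftrightarrow>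
     (\<forall>Gs. exhausts S G Gs \<longrightarrow>
        (\<forall>x\<in>S. AE \<omega> in law Z (Some x).
           continuous_on (times_in S Z G Gs \<omega> \<inter> {t. 0 \<le> t \<and> ereal t < lifetime Z \<omega>})
             (\<lambda>t. the (pos Z t \<omega>))))"

lemma exhausts_exists:
  fixes S :: "'s::metric_space set"
  assumes G: "openin (top_of_set S) G"
  shows "\<exists>Gs. exhausts S G Gs"
proof (cases "S - G = {}")
  case True
  with G have "G = S"
    using openin_imp_subset by blast
  then have "exhausts S G (\<lambda>_. G)"
    by (auto simp: exhausts_def closure_of_subtopology)
  then show ?thesis by (rule exI[of "exhausts S G"])
next
  case False
  define d where "d x = infdist x (S - G)" for x
  define Gs where "Gs n = {x \<in> S. d x > 1 / real (Suc n)}" for n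
  have cont: "continuous_on S d"
    unfolding d_def by (intro continuous_intros)
  have GS: "G \<subseteq> S"
    using G openin_imp_subset by blast
  obtain U where U: "open U" "G = S \<inter> U"
    using G by (auto simp: openin_open)
  have sub: "Gs n \<subseteq> G" for n
  proof
    fix x assume "x \<in> Gs n"
    then have "x \<in> S" "d x > 0"
      by (auto simp: Gs_def intro: less_trans[rotated])
    then show "x \<in> G"
      unfolding d_def by (metis DiffI infdist_zero less_irrefl)
  qed
  have opn: "openin (top_of_set S) (Gs n)" for n
  proof -
    have "Gs n = S \<inter> d -` {1 / real (Suc n)<..}"
      by (auto simp: Gs_def)
    then show ?thesis
      using continuous_openin_preimage_gen[OF cont open_greaterThan] by simp
  qed
  have clo: "(top_of_set S) closure_of (Gs n) \<subseteq> Gs (Suc n)" for n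
  proof -
    let ?C = "S \<inter> d -` {1 / real (Suc n)..}"
    have "closedin (top_of_set S) ?C"
      by (rule continuous_closedin_preimage[OF cont closed_atLeast])
    moreover have "Gs n \<subseteq> ?C"
      by (auto simp: Gs_def)
    ultimately have "(top_of_set S) closure_of (Gs n) \<subseteq> ?C"
      by (rule closure_of_minimal[rotated])
    also have "?C \<subseteq> Gs (Suc n)"
    proof
      fix x assume "x \<in> ?C"
      moreover have "1 / real (Suc (Suc n)) < 1 / real (Suc n)"
        by (simp add: field_simps)
      ultimately show "x \<in> Gs (Suc n)"
        by (auto simp: Gs_def)
    qed
    finally show ?thesis .
  qed
  have "x \<in> (\<Union>n. Gs n)" if "x \<in> G" for x
  proof -
    have "x \<notin> closure (S - G)"
      using that U by (metis Diff_iff IntD2 IntI open_Int_closure_eq_empty disjoint_iff)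
    then have "d x > 0"
      using False in_closure_iff_infdist_zero[of "S - G" x] infdist_nonneg[of x "S - G"]
      by (simp add: d_def order_less_le)
    then obtain n where "inverse (real (Suc n)) < d x"
      using reals_Archimedean by blast
    then show ?thesis
      using that GS by (auto simp: Gs_def inverse_eq_divide)
  qed
  then have "(\<Union>n. Gs n) = G"
    using sub by blast
  then have "exhausts S G Gs"
    using sub opn clo by (simp add: exhausts_def)
  then show ?thesis by (rule exI[of "exhausts S G"])
qed

end

theory Submission
  imports Defs "HOL-Computational_Algebra.Polynomial"
begin

text \<open>For a test function \<open>f\<close>, the powers \<open>f ^ k\<close> are test functions too. At a point \<open>p\<close> without jumps
  the operator is a second order differential operator, so that with \<open>c = f p\<close> it annihilates
  \<open>(f - c) ^ 4 = f ^ 4 - 4 c f ^ 3 + 6 c\<^sup>2 f\<^sup>2 - 4 c\<^sup>3 f + c ^ 4\<close> at \<open>p\<close>. By the martingale property the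
  expected sum of \<open>(f X\<^sub>t' - f X\<^sub>t) ^ 4\<close> over the steps \<open>t \<rightarrow> t'\<close> of a grid equals the expectation of the
  time integral of \<open>L ((f - f X\<^sub>t) ^ 4)\<close> along the path, and the same holds if a step \<open>t \<rightarrow> t'\<close> is kept
  only on the event that \<open>X\<close> has spent no time of positive Lebesgue measure outside \<open>G\<close> since
  a fixed time \<open>q\<close>. As the mesh tends to \<open>0\<close>, dominated convergence with the resolvent bound makes the
  expectation vanish, so \<open>f X\<close> has no jump as long as \<open>X\<close> has stayed in \<open>G\<close> since \<open>q\<close>. Testing
  occupation times instead of exit times also excludes jumps from the boundary of \<open>G\<close> back into
  \<open>G\<close>, and needs neither stopping times nor the Markov property. Countably many test functions
  separate the points of the state space.\<close>

section \<open>Test functions\<close>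

text \<open>Where there are no jumps, L ((f - c)^m) = m (f - c)^(m-1) Q + m (m-1) (f - c)^(m-2)
  \<Gamma>, with Q = L f and \<Gamma> half the squared norm of \<sigma> Df. This vanishes at a zero
  of f - c as soon as m is at least 3; 4 is the least even choice, and evenness makes the sums
  nonnegative, so that Fatou's lemma turns vanishing expectations into a statement about paths.
  Constants are not test functions, since supports are compact, but c^4 drops out of increments in
  time, so the powers 1 to 4 suffice. On a grid step c is frozen at the left end point: it is then a
  bounded weight known at that time, and the martingale identity of each power may be multiplied by
  it. The event on the occupation time is a second weight, decreasing and left continuous in time,
  which therefore passes to the limit along grid points from the left.\<close>

abbreviation time_deriv where
  "time_deriv I n \<phi> \<psi> \<equiv>
     \<forall>t\<in>I. \<forall>z\<in>Rn n. ((\<lambda>s. \<phi> (s, z)) has_real_derivative \<psi> (t, z)) (at t within I)"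

abbreviation coord_deriv where
  "coord_deriv I n i \<phi> \<psi> \<equiv>
     \<forall>t\<in>I. \<forall>z\<in>Rn n. ((\<lambda>s. \<phi> (t, z(i := s))) has_real_derivative \<psi> (t, z)) (at (z i))"

section \<open>Algebra of the classes of k times differentiable functions\<close>

lemma Ck_imp_continuous: "Ck k I n \<phi> \<Longrightarrow> continuous_on (I \<times> Rn n) \<phi>"
  by (cases k) auto

lemma Ck_Suc_imp_Ck: "Ck (Suc k) I n \<phi> \<Longrightarrow> Ck k I n \<phi>"
proof (induction k arbitrary: \<phi>)
  case 0
  then show ?case by simp
next
  case (Suc k)
  show ?case
    unfolding Ck.simps(2)[of k]
  proof (intro conjI allI impI)
    show "continuous_on (I \<times> Rn n) \<phi>"
      using Suc.prems by simp
    obtain \<psi> where "Ck (Suc k) I n \<psi>"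
      "time_deriv I n \<phi> \<psi>"
      using Suc.prems unfolding Ck.simps(2)[of "Suc k"] by blast
    then show "\<exists>\<psi>. Ck k I n \<psi> \<and>
        (time_deriv I n \<phi> \<psi>)"
      using Suc.IH by blast
    fix i assume "i < n"
    then obtain \<psi> where "Ck (Suc k) I n \<psi>"
      "coord_deriv I n i \<phi> \<psi>"
      using Suc.prems unfolding Ck.simps(2)[of "Suc k"] by blast
    then show "\<exists>\<psi>. Ck k I n \<psi> \<and>
        (coord_deriv I n i \<phi> \<psi>)"
      using Suc.IH by blast
  qed
qed

lemma Ck_add: "Ck k I n \<phi> \<Longrightarrow> Ck k I n \<rho> \<Longrightarrow> Ck k I n (\<lambda>p. \<phi> p + \<rho> p)"
proof (induction k arbitrary: \<phi> \<rho>)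
  case 0
  then show ?case by (simp add: continuous_on_add)
next
  case (Suc k)
  show ?case
    unfolding Ck.simps(2)
  proof (intro conjI allI impI)
    show "continuous_on (I \<times> Rn n) (\<lambda>p. \<phi> p + \<rho> p)"
      using Suc.prems by (simp add: continuous_on_add)
    obtain \<psi> \<psi>' where "Ck k I n \<psi>" "Ck k I n \<psi>'"
      "time_deriv I n \<phi> \<psi>"
      "time_deriv I n \<rho> \<psi>'"
      using Suc.prems unfolding Ck.simps(2) by blast
    then show "\<exists>\<psi>. Ck k I n \<psi> \<and> (\<forall>t\<in>I. \<forall>z\<in>Rn n.
        ((\<lambda>s. \<phi> (s, z) + \<rho> (s, z)) has_real_derivative \<psi> (t, z)) (at t within I))"
      by (intro exI[of _ "\<lambda>p. \<psi> p + \<psi>' p"]) (auto intro!: Suc.IH DERIV_add)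
    fix i assume "i < n"
    then obtain \<psi> \<psi>' where "Ck k I n \<psi>" "Ck k I n \<psi>'"
      "coord_deriv I n i \<phi> \<psi>"
      "coord_deriv I n i \<rho> \<psi>'"
      using Suc.prems unfolding Ck.simps(2) by blast
    then show "\<exists>\<psi>. Ck k I n \<psi> \<and> (\<forall>t\<in>I. \<forall>z\<in>Rn n.
        ((\<lambda>s. \<phi> (t, z(i := s)) + \<rho> (t, z(i := s))) has_real_derivative \<psi> (t, z)) (at (z i)))"
      by (intro exI[of _ "\<lambda>p. \<psi> p + \<psi>' p"]) (auto intro!: Suc.IH DERIV_add)
  qed
qed

lemma Ck_mult: "Ck k I n \<phi> \<Longrightarrow> Ck k I n \<rho> \<Longrightarrow> Ck k I n (\<lambda>p. \<phi> p * \<rho> p)"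
proof (induction k arbitrary: \<phi> \<rho>)
  case 0
  then show ?case by (simp add: continuous_on_mult)
next
  case (Suc k)
  \<comment> \<open>The product rule pairs the derivative of one factor with the other factor
    itself, which the induction hypothesis wants at order \<open>k\<close>.\<close>
  note lower = Suc.prems[THEN Ck_Suc_imp_Ck]
  show ?case
    unfolding Ck.simps(2)
  proof (intro conjI allI impI)
    show "continuous_on (I \<times> Rn n) (\<lambda>p. \<phi> p * \<rho> p)"
      using Suc.prems by (simp add: continuous_on_mult)
    obtain \<psi> \<psi>' where d: "Ck k I n \<psi>" "Ck k I n \<psi>'"
      "time_deriv I n \<phi> \<psi>"
      "time_deriv I n \<rho> \<psi>'"
      using Suc.prems unfolding Ck.simps(2) by blast
    show "\<exists>\<psi>. Ck k I n \<psi> \<and> (\<forall>t\<in>I. \<forall>z\<in>Rn n.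
        ((\<lambda>s. \<phi> (s, z) * \<rho> (s, z)) has_real_derivative \<psi> (t, z)) (at t within I))"
    proof (intro exI[of _ "\<lambda>p. \<psi> p * \<rho> p + \<psi>' p * \<phi> p"] conjI ballI)
      fix t z assume "t \<in> I" "z \<in> Rn n"
      then show "((\<lambda>s. \<phi> (s, z) * \<rho> (s, z)) has_real_derivative
          \<psi> (t, z) * \<rho> (t, z) + \<psi>' (t, z) * \<phi> (t, z)) (at t within I)"
        using DERIV_mult[OF d(3)[rule_format, of t z] d(4)[rule_format, of t z]] by simp
    qed (intro Ck_add Suc.IH d lower)
    fix i assume "i < n"
    then obtain \<psi> \<psi>' where d: "Ck k I n \<psi>" "Ck k I n \<psi>'"
      "coord_deriv I n i \<phi> \<psi>"
      "coord_deriv I n i \<rho> \<psi>'"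
      using Suc.prems unfolding Ck.simps(2) by blast
    show "\<exists>\<psi>. Ck k I n \<psi> \<and> (\<forall>t\<in>I. \<forall>z\<in>Rn n.
        ((\<lambda>s. \<phi> (t, z(i := s)) * \<rho> (t, z(i := s))) has_real_derivative \<psi> (t, z)) (at (z i)))"
    proof (intro exI[of _ "\<lambda>p. \<psi> p * \<rho> p + \<psi>' p * \<phi> p"] conjI ballI)
      fix t z assume "t \<in> I" "z \<in> Rn n"
      then show "((\<lambda>s. \<phi> (t, z(i := s)) * \<rho> (t, z(i := s))) has_real_derivative
          \<psi> (t, z) * \<rho> (t, z) + \<psi>' (t, z) * \<phi> (t, z)) (at (z i))"
        using DERIV_mult[OF d(3)[rule_format, of t z] d(4)[rule_format, of t z]] by simp
    qed (intro Ck_add Suc.IH d lower)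
  qed
qed

lemma Ck_const: "Ck k I n (\<lambda>_. c)"
proof (induction k arbitrary: c)
  case (Suc k)
  then show ?case
    by (auto intro!: exI[of _ "\<lambda>_. 0"])
qed simp

lemma Ck_prod:
  "finite A \<Longrightarrow> (\<And>i. i \<in> A \<Longrightarrow> Ck k I n (\<phi> i)) \<Longrightarrow> Ck k I n (\<lambda>p. \<Prod>i\<in>A. \<phi> i p)"
  by (induction A rule: finite_induct) (auto intro: Ck_const Ck_mult)

lemma Ck_power: "Ck k I n \<phi> \<Longrightarrow> Ck k I n (\<lambda>p. \<phi> p ^ m)"
  by (induction m) (auto intro: Ck_const Ck_mult)

text \<open>\<open>g\<close> lists a function together with all its derivatives, which lets the
  induction over \<open>k\<close> move from \<open>g m\<close> to \<open>g (Suc m)\<close>.\<close>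

lemma Ck_time:
  assumes "\<And>m s. (g m has_real_derivative g (Suc m) s) (at s)"
  shows "Ck k I n (\<lambda>p. g m (fst p))"
proof (induction k arbitrary: m)
  case 0
  have "continuous_on UNIV (g m)"
    using assms DERIV_continuous_on by blast
  then have "continuous_on (I \<times> Rn n) (\<lambda>p. g m (fst p))"
    by (rule continuous_on_compose2) (auto intro: continuous_on_fst continuous_on_id)
  then show ?case by simp
next
  case (Suc k)
  have "continuous_on UNIV (g m)"
    using assms DERIV_continuous_on by blast
  then have cont: "continuous_on (I \<times> Rn n) (\<lambda>p. g m (fst p))"
    by (rule continuous_on_compose2) (auto intro: continuous_on_fst continuous_on_id)
  have "Ck k I n (\<lambda>_. 0) \<and> (\<forall>t\<in>I. \<forall>z\<in>Rn n.
      ((\<lambda>s. g m (fst (t, z(i := s)))) has_real_derivative 0) (at (z i)))" for i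
    by (simp add: Ck_const)
  moreover have "Ck k I n (\<lambda>p. g (Suc m) (fst p)) \<and> (\<forall>t\<in>I. \<forall>z\<in>Rn n.
      ((\<lambda>s. g m (fst (s, z))) has_real_derivative g (Suc m) (fst (t, z))) (at t within I))"
    by (simp add: Suc has_field_derivative_at_within assms)
  ultimately show ?case
    unfolding Ck.simps(2) using cont
    by (intro conjI allI impI exI[of _ "\<lambda>p. g (Suc m) (fst p)"] exI[of _ "\<lambda>_. 0"]) auto
qed

lemma Ck_coord:
  assumes g: "\<And>m s. (g m has_real_derivative g (Suc m) s) (at s)" and "i < n"
  shows "Ck k I n (\<lambda>p. g m (snd p i))"
proof (induction k arbitrary: m)
  case 0
  have "continuous_on UNIV (g m)"
    using assms DERIV_continuous_on by blast
  then have "continuous_on (I \<times> Rn n) (\<lambda>p. g m (snd p i))"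
    by (rule continuous_on_compose2)
      (auto intro!: continuous_on_product_then_coordinatewise[where f = snd] continuous_on_snd continuous_on_id)
  then show ?case by simp
next
  case (Suc k)
  have "continuous_on UNIV (g m)"
    using assms DERIV_continuous_on by blast
  then have cont: "continuous_on (I \<times> Rn n) (\<lambda>p. g m (snd p i))"
    by (rule continuous_on_compose2)
      (auto intro!: continuous_on_product_then_coordinatewise[where f = snd] continuous_on_snd continuous_on_id)
  have "\<exists>\<psi>. Ck k I n \<psi> \<and> (\<forall>t\<in>I. \<forall>z\<in>Rn n.
      ((\<lambda>s. g m ((z(j := s)) i)) has_real_derivative \<psi> (t, z)) (at (z j)))" if "j < n" for j
  proof (cases "j = i")
    case True
    then show ?thesis
      by (intro exI[of _ "\<lambda>p. g (Suc m) (snd p i)"]) (auto simp: Suc g)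
  next
    case False
    then show ?thesis
      by (intro exI[of _ "\<lambda>_. 0"]) (auto simp: Ck_const)
  qed
  moreover have "Ck k I n (\<lambda>_. 0) \<and> (\<forall>t\<in>I. \<forall>z\<in>Rn n.
      ((\<lambda>s. g m (snd (s, z) i)) has_real_derivative 0) (at t within I))"
    by (simp add: Ck_const)
  ultimately show ?case
    unfolding Ck.simps(2) using cont
    by (intro conjI exI[of _ "\<lambda>_. 0"]) auto
qed

text \<open>The exponent is positive because \<open>0 ^ 0 = 1\<close> would destroy the compact
  support.\<close>

lemma test_functions_power:
  assumes "f \<in> test_functions K I" "m \<ge> 1"
  shows "(\<lambda>p. f p ^ m) \<in> test_functions K I"
proof -
  obtain n \<phi> where n: "n \<ge> 1" and \<phi>: "\<phi> \<in> Cc_infinity I n"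
    and f: "\<forall>t\<in>I. \<forall>x. f (t, x) = \<phi> (t, coords (test K) n x)"
    using assms by (auto simp: test_functions_def)
  have "(\<lambda>p. \<phi> p ^ m) \<in> Cc_infinity I n"
    using \<phi> \<open>m \<ge> 1\<close> unfolding Cc_infinity_def
    by (auto intro!: Ck_power simp: zero_power)
  then show ?thesis
    unfolding test_functions_def using n f
    by (auto intro!: exI[of _ n] bexI[of _ "\<lambda>p. \<phi> p ^ m"])
qed

section \<open>Smooth bump functions\<close>

text \<open>The classical smooth function exp (- 1 / x), continued by 0, with a polynomial in 1 / x
  as a factor. This family is closed under differentiation, so that all derivatives come from
  iterating one map on polynomials.\<close>

definition flat :: "real poly \<Rightarrow> real \<Rightarrow> real" where
  "flat p x = (if x > 0 then poly p (inverse x) * exp (- inverse x) else 0)"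

lemma flat_tendsto_0: "(flat p \<longlongrightarrow> 0) (at_right 0)"
proof -
  have "((\<lambda>y. \<Sum>i\<le>degree p. coeff p i * (y ^ i / exp y)) \<longlongrightarrow> (\<Sum>i\<le>degree p. coeff p i * 0)) at_top"
    by (intro tendsto_sum tendsto_mult tendsto_const tendsto_power_div_exp_0)
  then have "((\<lambda>y. poly p y * exp (- y)) \<longlongrightarrow> 0) at_top"
    by (simp add: poly_altdef sum_distrib_right exp_minus divide_inverse mult.assoc)
  then have "((\<lambda>x. poly p (inverse x) * exp (- inverse x)) \<longlongrightarrow> 0) (at_right 0)"
    by (rule filterlim_compose[OF _ filterlim_inverse_at_top_right])
  moreover have "eventually (\<lambda>x. poly p (inverse x) * exp (- inverse x) = flat p x) (at_right 0)"
    by (auto simp: flat_def eventually_at_filter)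
  ultimately show ?thesis
    using tendsto_cong by fastforce
qed

text \<open>The chain rule with y = 1 / x: since dy/dx = - y^2, the polynomial factor p(y) of exp (-
  y) turns into y^2 (p - p')(y).\<close>

definition flat_deriv :: "real poly \<Rightarrow> real poly" where
  "flat_deriv p = [:0, 0, 1:] * (p - pderiv p)"

lemma DERIV_flat: "(flat p has_real_derivative flat (flat_deriv p) x) (at x)"
proof (cases x "0 :: real" rule: linorder_cases)
  case less
  have "((\<lambda>_. 0) has_real_derivative 0) (at x)"
    by simp
  then have "(flat p has_real_derivative 0) (at x)"
    by (rule has_field_derivative_transform_within_open[where S = "{..<0}"])
      (use less in \<open>auto simp: flat_def\<close>)
  then show ?thesis
    using less by (simp add: flat_def)
next
  case equal
  \<comment> \<open>Dividing by \<open>h\<close> multiplies the polynomial by its variable, so the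
    difference quotient at 0 is itself a \<open>flat\<close> function.\<close>
  have 1: "((\<lambda>h. (flat p h - flat p 0) / (h - 0)) \<longlongrightarrow> 0) (at_right 0)"
  proof (rule Lim_transform_eventually[OF flat_tendsto_0[of "[:0, 1:] * p"]])
    show "eventually (\<lambda>h. flat ([:0, 1:] * p) h = (flat p h - flat p 0) / (h - 0)) (at_right 0)"
      by (auto simp: flat_def eventually_at_filter divide_inverse mult_ac)
  qed
  have 2: "((\<lambda>h. (flat p h - flat p 0) / (h - 0)) \<longlongrightarrow> 0) (at_left 0)"
  proof (rule Lim_transform_eventually[OF tendsto_const])
    show "eventually (\<lambda>h. 0 = (flat p h - flat p 0) / (h - 0)) (at_left 0)"
      by (auto simp: flat_def eventually_at_filter)
  qed
  have "((\<lambda>h. (flat p h - flat p 0) / (h - 0)) \<longlongrightarrow> 0) (at 0)"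
    using 1 2 by (simp add: filterlim_at_split)
  then show ?thesis
    using equal by (simp add: has_field_derivative_iff flat_def)
next
  case greater
  have "((\<lambda>x. poly p (inverse x) * exp (- inverse x)) has_real_derivative
      poly (flat_deriv p) (inverse x) * exp (- inverse x)) (at x)"
    using greater
    by (auto intro!: derivative_eq_intros simp: flat_deriv_def algebra_simps power2_eq_square)
  then have "(flat p has_real_derivative poly (flat_deriv p) (inverse x) * exp (- inverse x)) (at x)"
    by (rule has_field_derivative_transform_within_open[where S = "{0<..}"])
      (use greater in \<open>auto simp: flat_def\<close>)
  then show ?thesis
    using greater by (simp add: flat_def)
qed

definition bump :: "real \<Rightarrow> real \<Rightarrow> real \<Rightarrow> real" where
  "bump l r s = flat 1 (s - l) * flat 1 (r - s)"

lemma bump_nonzero_iff: "bump l r s \<noteq> 0 \<longleftrightarrow> l < s \<and> s < r"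
  by (auto simp: bump_def flat_def)

text \<open>These are the derivative sequences of the two factors of \<open>bump\<close>, in the
  form that \<open>Ck_time\<close> and \<open>Ck_coord\<close> take. The sign comes from the
  reflection in the second factor.\<close>

lemma flat_shift_derivs:
  fixes l r :: real
  defines "P \<equiv> \<lambda>m. (flat_deriv ^^ m) 1"
  shows "((\<lambda>s. flat (P m) (s - l)) has_real_derivative flat (P (Suc m)) (s - l)) (at s)"
    and "((\<lambda>s. (- 1) ^ m * flat (P m) (r - s)) has_real_derivative
           (- 1) ^ Suc m * flat (P (Suc m)) (r - s)) (at s)"
proof -
  have P: "P (Suc m) = flat_deriv (P m)"
    by (simp add: P_def)
  show "((\<lambda>s. flat (P m) (s - l)) has_real_derivative flat (P (Suc m)) (s - l)) (at s)"
    unfolding P by (rule DERIV_chain'[OF _ DERIV_flat, THEN DERIV_cong]) (auto intro!: derivative_eq_intros)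
  have "((\<lambda>s. flat (P m) (r - s)) has_real_derivative - flat (P (Suc m)) (r - s)) (at s)"
    unfolding P by (rule DERIV_chain'[OF _ DERIV_flat, THEN DERIV_cong]) (auto intro!: derivative_eq_intros)
  from DERIV_cmult[OF this, of "(- 1) ^ m"]
  show "((\<lambda>s. (- 1) ^ m * flat (P m) (r - s)) has_real_derivative
           (- 1) ^ Suc m * flat (P (Suc m)) (r - s)) (at s)"
    by simp
qed

lemma Ck_bump_time: "Ck k I n (\<lambda>p. bump l r (fst p))"
  using Ck_mult[OF Ck_time[where g = "\<lambda>m s. flat ((flat_deriv ^^ m) 1) (s - l)" and m = 0]
      Ck_time[where g = "\<lambda>m s. (- 1) ^ m * flat ((flat_deriv ^^ m) 1) (r - s)" and m = 0],
      OF flat_shift_derivs]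
  by (simp add: bump_def)

lemma Ck_bump_coord: "i < n \<Longrightarrow> Ck k I n (\<lambda>p. bump l r (snd p i))"
  using Ck_mult[OF Ck_coord[where g = "\<lambda>m s. flat ((flat_deriv ^^ m) 1) (s - l)" and m = 0]
      Ck_coord[where g = "\<lambda>m s. (- 1) ^ m * flat ((flat_deriv ^^ m) 1) (r - s)" and m = 0],
      OF flat_shift_derivs(1) _ flat_shift_derivs(2)]
  by (simp add: bump_def)

section \<open>Countably many test functions that separate points\<close>

text \<open>Inside the space of all sequences a box of \<open>Rn n\<close> is a product of compact
  intervals, reduced to the point 0 from index \<open>n\<close> on, so Tychonoff's theorem
  applies.\<close>

lemma compact_box: "compact {z \<in> Rn n. \<forall>i<n. l i \<le> z i \<and> z i \<le> r i}"
proof -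
  have "compactin (product_topology (\<lambda>i. euclidean) UNIV)
      (PiE UNIV (\<lambda>i. if i < n then {l i..r i} else {0 :: real}))"
    by (subst compactin_PiE) (auto simp: compact_Icc)
  moreover have "(PiE UNIV (\<lambda>i. if i < n then {l i..r i} else {0 :: real})) =
      {z \<in> Rn n. \<forall>i<n. l i \<le> z i \<and> z i \<le> r i}"
  proof (intro set_eqI iffI)
    fix z assume "z \<in> PiE UNIV (\<lambda>i. if i < n then {l i..r i} else {0 :: real})"
    then have "z i \<in> (if i < n then {l i..r i} else {0})" for i
      by blast
    then have "i < n \<Longrightarrow> l i \<le> z i \<and> z i \<le> r i" "i \<ge> n \<Longrightarrow> z i = 0" for i
      by (metis atLeastAtMost_iff, metis empty_iff insert_iff not_less)
    then show "z \<in> {z \<in> Rn n. \<forall>i<n. l i \<le> z i \<and> z i \<le> r i}"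
      by (simp add: Rn_def)
  qed (simp add: Rn_def PiE_UNIV_domain)
  ultimately show ?thesis
    by (simp add: euclidean_product_topology)
qed

definition box_bump :: "real \<Rightarrow> real \<Rightarrow> (real \<times> real) list \<Rightarrow> real \<times> (nat \<Rightarrow> real) \<Rightarrow> real" where
  "box_bump l r ls p = bump l r (fst p) *
     (\<Prod>i\<in>{..<length ls}. bump (fst (ls ! i)) (snd (ls ! i)) (snd p i))"

lemma box_bump_nonzero_iff:
  "box_bump l r ls (t, z) \<noteq> 0 \<longleftrightarrow>
     l < t \<and> t < r \<and> (\<forall>i<length ls. fst (ls ! i) < z i \<and> z i < snd (ls ! i))"
  using bump_nonzero_iff by (auto simp: box_bump_def)

text \<open>\<open>I\<close> need not be closed, hence the assumption: the support has to be compact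
  within \<open>I\<close>.\<close>

lemma box_bump_Cc_infinity:
  assumes "compact (I \<inter> {l..r})"
  shows "box_bump l r ls \<in> Cc_infinity I (length ls)"
proof -
  let ?n = "length ls"
  let ?C = "(I \<inter> {l..r}) \<times> {z \<in> Rn ?n. \<forall>i<?n. fst (ls ! i) \<le> z i \<and> z i \<le> snd (ls ! i)}"
  have "Ck k I ?n (box_bump l r ls)" for k
    unfolding box_bump_def[abs_def] by (intro Ck_mult Ck_bump_time Ck_prod Ck_bump_coord) auto
  moreover have "compact ?C"
    by (intro compact_Times assms compact_box)
  moreover have "\<forall>p\<in>I \<times> Rn ?n - ?C. box_bump l r ls p = 0"
  proof
    fix p assume p: "p \<in> I \<times> Rn ?n - ?C"
    obtain t z where "p = (t, z)" by force
    then show "box_bump l r ls p = 0"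
      using p box_bump_nonzero_iff[of l r ls t z] by fastforce
  qed
  ultimately show ?thesis
    unfolding Cc_infinity_def by (auto intro!: exI[of _ ?C])
qed

text \<open>If \<open>I\<close> continues to the left of \<open>t\<close>, a window that stays to
  the right of some point of \<open>I\<close> misses no point of its own. If \<open>t\<close> is the
  left end of \<open>I\<close>, every window to the left meets \<open>I\<close> in \<open>t\<close>
  alone, and the bump may reach beyond \<open>I\<close>.\<close>

lemma compact_interval_left:
  fixes I :: "real set"
  assumes I: "is_interval I" "t \<in> I"
  shows "\<exists>a<t. \<forall>l. a < l \<and> l < t \<longrightarrow> compact (I \<inter> {l..t})"
proof (cases "\<exists>a\<in>I. a < t")
  case True
  then obtain a where a: "a \<in> I" "a < t" by blast
  have "I \<inter> {l..t} = {l..t}" if "a < l" for l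
    using mem_is_interval_1_I[OF I(1) a(1) I(2)] that by auto
  then show ?thesis
    using a by (metis compact_Icc)
next
  case False
  then have "I \<inter> {l..t} = {t}" if "l < t" for l
    using I that by (auto simp: not_less intro: antisym)
  then show ?thesis
    by (intro exI[of _ "t - 1"]) auto
qed

lemma compact_interval_right:
  fixes I :: "real set"
  assumes I: "is_interval I" "t \<in> I"
  shows "\<exists>b>t. \<forall>r. t < r \<and> r < b \<longrightarrow> compact (I \<inter> {t..r})"
proof (cases "\<exists>b\<in>I. t < b")
  case True
  then obtain b where b: "b \<in> I" "t < b" by blast
  have "I \<inter> {t..r} = {t..r}" if "r < b" for r
    using mem_is_interval_1_I[OF I(1) I(2) b(1)] that by auto
  then show ?thesis
    using b by (metis compact_Icc)
next
  case False
  then have "I \<inter> {t..r} = {t}" if "t < r" for r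
    using I that by (auto simp: not_less intro: antisym)
  then show ?thesis
    by (intro exI[of _ "t + 1"]) auto
qed

lemma rational_bracket:
  fixes s a b :: real
  assumes "a < s" "s < b"
  shows "\<exists>l r. a < of_rat l \<and> of_rat l < s \<and> s < of_rat r \<and> of_rat r < b"
  using of_rat_dense[OF assms(1)] of_rat_dense[OF assms(2)] by blast

lemma rational_bracket_avoiding:
  fixes s s' a b :: real
  assumes "a < s" "s < b"
  shows "\<exists>l r. a < of_rat l \<and> of_rat l < s \<and> s < of_rat r \<and> of_rat r < b \<and>
     (s \<noteq> s' \<longrightarrow> \<not> (of_rat l < s' \<and> s' < of_rat r))"
proof -
  \<comment> \<open>On the side of \<open>s\<close> where \<open>s'\<close> lies, the bracket is cut
    off at \<open>s'\<close>.\<close>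
  define a' where "a' = (if s' < s then max a s' else a)"
  define b' where "b' = (if s < s' then min b s' else b)"
  have "a' < s" "s < b'" using assms by (auto simp: a'_def b'_def)
  from rational_bracket[OF this] obtain l r
    where "a' < of_rat l" "of_rat l < s" "s < of_rat r" "of_rat r < b'" by blast
  then show ?thesis
    by (intro exI[of _ l] exI[of _ r]) (auto simp: a'_def b'_def split: if_splits)
qed

lemma total_eqI:
  fixes x y :: "'h::real_inner"
  assumes "closure (span (range e)) = UNIV" "\<And>i :: nat. x \<bullet> e i = y \<bullet> e i"
  shows "x = y"
proof -
  have "closed {v. (x - y) \<bullet> v = 0}"
    by (rule closed_hyperplane)
  moreover have "span (range e) \<subseteq> {v. (x - y) \<bullet> v = 0}"
    using assms(2) by (intro span_minimal subspace_hyperplane) (auto simp: inner_diff_left)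
  ultimately have "(x - y) \<bullet> (x - y) = 0"
    using closure_minimal assms(1) by blast
  then show ?thesis by simp
qed

text \<open>The index consists of a pair and a list of pairs of rationals, the length of the list
  being the dimension. Its type is countable, so one exceptional null set will serve all these
  functions.\<close>

definition rational_bump ::
    "('h::{real_inner, polish_space}) coefficients \<Rightarrow> (rat \<times> rat) \<times> (rat \<times> rat) list \<Rightarrow> real \<times> 'h \<Rightarrow> real"
where
  "rational_bump K c p = box_bump (of_rat (fst (fst c))) (of_rat (snd (fst c)))
     (map (map_prod of_rat of_rat) (snd c)) (fst p, coords (test K) (length (snd c)) (snd p))"

text \<open>The points differ in time or, the test vectors being total, in some coordinate of index
  \<open>m\<close>. A box of dimension \<open>m + 1\<close> around the first point whose sides avoid
  every differing entry of the second one then excludes the second.\<close>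

lemma rational_bumps_separate:
  fixes K :: "('h::{real_inner, polish_space}) coefficients"
  assumes I: "is_interval I" and total: "closure (span (range (test K))) = UNIV"
    and t: "t \<in> I" "(t, x) \<noteq> (t', x')"
  shows "\<exists>c. rational_bump K c \<in> test_functions K I \<and>
     rational_bump K c (t, x) \<noteq> rational_bump K c (t', x')"
proof -
  obtain m where m: "t = t' \<Longrightarrow> x \<bullet> test K m \<noteq> x' \<bullet> test K m"
    using total_eqI[OF total] t(2) by blast
  define n where "n = Suc m"
  obtain a b where ab: "a < t" "\<forall>l. a < l \<and> l < t \<longrightarrow> compact (I \<inter> {l..t})"
    "t < b" "\<forall>r. t < r \<and> r < b \<longrightarrow> compact (I \<inter> {t..r})"
    using compact_interval_left[OF I t(1)] compact_interval_right[OF I t(1)] by blast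
  obtain l r where lr: "a < of_rat l" "of_rat l < t" "t < of_rat r" "of_rat r < b"
      "t \<noteq> t' \<Longrightarrow> \<not> (of_rat l < t' \<and> t' < of_rat r)"
    using rational_bracket_avoiding[OF ab(1,3)] by blast
  have "\<exists>c. of_rat (fst c) < x \<bullet> test K i \<and> x \<bullet> test K i < of_rat (snd c) \<and>
      (x \<bullet> test K i \<noteq> x' \<bullet> test K i \<longrightarrow>
        \<not> (of_rat (fst c) < x' \<bullet> test K i \<and> x' \<bullet> test K i < of_rat (snd c)))" for i
    using rational_bracket_avoiding[of "x \<bullet> test K i - 1" "x \<bullet> test K i" "x \<bullet> test K i + 1" "x' \<bullet> test K i"]
    by auto
  then obtain c where c: "\<And>i. of_rat (fst (c i)) < x \<bullet> test K i" "\<And>i. x \<bullet> test K i < of_rat (snd (c i))"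
    "\<And>i. x \<bullet> test K i \<noteq> x' \<bullet> test K i \<Longrightarrow>
        \<not> (of_rat (fst (c i)) < x' \<bullet> test K i \<and> x' \<bullet> test K i < of_rat (snd (c i)))"
    by metis
  define d where "d = ((l, r), map c [0..<n])"
  define L :: "(real \<times> real) list" where "L = map (map_prod of_rat of_rat) (snd d)"
  have L: "length L = n" "\<And>i. i < n \<Longrightarrow> L ! i = (of_rat (fst (c i)), of_rat (snd (c i)))"
    by (simp_all add: L_def d_def map_prod_def split_beta)
  have bump: "rational_bump K d (s, y) = box_bump (of_rat l) (of_rat r) L (s, coords (test K) n y)" for s y
    by (simp add: rational_bump_def L_def d_def)
  have nonzero: "rational_bump K d (s, y) \<noteq> 0 \<longleftrightarrow> of_rat l < s \<and> s < of_rat r \<and>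
      (\<forall>i<n. of_rat (fst (c i)) < y \<bullet> test K i \<and> y \<bullet> test K i < of_rat (snd (c i)))" for s y
    unfolding bump box_bump_nonzero_iff by (simp add: L coords_def)
  have "I \<inter> {of_rat l..of_rat r} = (I \<inter> {of_rat l..t}) \<union> (I \<inter> {t..of_rat r})"
    using lr by auto
  then have "compact (I \<inter> {of_rat l..of_rat r})"
    using ab lr by auto
  from box_bump_Cc_infinity[OF this, of L]
  have "box_bump (of_rat l) (of_rat r) L \<in> Cc_infinity I n"
    by (simp add: L)
  then have "rational_bump K d \<in> test_functions K I"
    unfolding test_functions_def mem_Collect_eq bump
    by (intro exI[of _ n] conjI bexI[of _ "box_bump (of_rat l) (of_rat r) L"]) (simp_all add: n_def)
  moreover have "rational_bump K d (t, x) \<noteq> 0"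
    using lr c by (simp add: nonzero)
  moreover have "rational_bump K d (t', x') = 0"
  proof (rule ccontr)
    assume "rational_bump K d (t', x') \<noteq> 0"
    then have "of_rat l < t' \<and> t' < of_rat r"
      "\<forall>i<n. of_rat (fst (c i)) < x' \<bullet> test K i \<and> x' \<bullet> test K i < of_rat (snd (c i))"
      by (auto simp: nonzero)
    then show False
      using lr(5) c(3)[of m] m by (auto simp: n_def)
  qed
  ultimately have "rational_bump K d \<in> test_functions K I \<and>
      rational_bump K d (t, x) \<noteq> rational_bump K d (t', x')" by simp
  then show ?thesis ..
qed

section \<open>Continuity and boundedness of test functions\<close>

lemma coords_in_Rn: "coords e n x \<in> Rn n"
  by (simp add: coords_def Rn_def)

lemma continuous_on_coords: "continuous_on A (coords e n)"
  unfolding coords_def[abs_def]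
proof (rule continuous_on_coordinatewise_then_product)
  show "continuous_on A (\<lambda>x. if i < n then x \<bullet> e i else 0)" for i
    by (cases "i < n") (simp_all add: continuous_on_inner continuous_on_id)
qed

lemma test_functions_continuous:
  assumes "f \<in> test_functions K I"
  shows "continuous_on (I \<times> UNIV) f"
proof -
  obtain n \<phi> where \<phi>: "\<phi> \<in> Cc_infinity I n"
    and f: "\<forall>t\<in>I. \<forall>x. f (t, x) = \<phi> (t, coords (test K) n x)"
    using assms by (auto simp: test_functions_def)
  have "continuous_on (I \<times> Rn n) \<phi>"
    using \<phi> Ck_imp_continuous by (auto simp: Cc_infinity_def)
  then have "continuous_on (I \<times> UNIV) (\<lambda>p. \<phi> (fst p, coords (test K) n (snd p)))"
    by (rule continuous_on_compose2)
      (auto intro!: continuous_on_Pair continuous_on_compose2[OF continuous_on_coords] continuous_on_fst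
        continuous_on_snd continuous_on_id simp: coords_in_Rn)
  then show ?thesis
    by (rule continuous_on_eq) (auto simp: f)
qed

lemma bounded_on_if_compact_support:
  fixes g :: "'a::topological_space \<Rightarrow> real"
  assumes "continuous_on A g" "compact C" "C \<subseteq> A" "\<forall>p\<in>A - C. g p = 0"
  shows "\<exists>B\<ge>0. \<forall>p\<in>A. \<bar>g p\<bar> \<le> B"
proof -
  have "compact (g ` C)"
    using assms by (meson compact_continuous_image continuous_on_subset)
  then obtain B where B: "\<forall>y\<in>g ` C. norm y \<le> B"
    using compact_imp_bounded[THEN bounded_iff[THEN iffD1]] by blast
  then show ?thesis
  proof (intro exI[of _ "max 0 B"] conjI ballI)
    fix p assume "p \<in> A"
    then have "g p = 0 \<or> norm (g p) \<le> B"
      using B assms(4) by blast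
    then show "\<bar>g p\<bar> \<le> max 0 B"
      by auto
  qed simp
qed

lemma test_functions_bounded:
  assumes "f \<in> test_functions K I"
  shows "\<exists>B\<ge>0. \<forall>t\<in>I. \<forall>x. \<bar>f (t, x)\<bar> \<le> B"
proof -
  obtain n \<phi> where \<phi>: "\<phi> \<in> Cc_infinity I n"
    and f: "\<forall>t\<in>I. \<forall>x. f (t, x) = \<phi> (t, coords (test K) n x)"
    using assms by (auto simp: test_functions_def)
  have "continuous_on (I \<times> Rn n) \<phi>"
    using \<phi> Ck_imp_continuous by (auto simp: Cc_infinity_def)
  then have "\<exists>B\<ge>0. \<forall>p\<in>I \<times> Rn n. \<bar>\<phi> p\<bar> \<le> B"
    using \<phi> bounded_on_if_compact_support[of "I \<times> Rn n" \<phi>] unfolding Cc_infinity_def by blast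
  then show ?thesis
    using f coords_in_Rn by (metis mem_Sigma_iff)
qed

section \<open>Traces and adjoints\<close>

definition orthonormal :: "'h::real_inner set \<Rightarrow> bool" where
  "orthonormal B \<longleftrightarrow> (\<forall>u\<in>B. \<forall>v\<in>B. u \<bullet> v = (if u = v then 1 else 0))"

lemma inner_orthonormal_sum:
  assumes "orthonormal F" "finite F" "v \<in> F"
  shows "(\<Sum>u\<in>F. c u *\<^sub>R u) \<bullet> v = c v"
proof -
  have "(\<Sum>u\<in>F. c u *\<^sub>R u) \<bullet> v = (\<Sum>u\<in>F. c u * (if u = v then 1 else 0))"
    unfolding inner_sum_left using assms(1,3) by (intro sum.cong) (auto simp: orthonormal_def)
  also have "\<dots> = c v"
    using assms(2,3) by (simp add: if_distrib cong: if_cong)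
  finally show ?thesis .
qed

lemma projection_residual_orthogonal:
  assumes "orthonormal F" "finite F" "v \<in> span F"
  shows "(a - (\<Sum>u\<in>F. (a \<bullet> u) *\<^sub>R u)) \<bullet> v = 0"
  using assms(3)
proof (induction rule: span_induct_alt)
  case (step c x y)
  then show ?case
    using inner_orthonormal_sum[OF assms(1,2) step(1), of "\<lambda>u. a \<bullet> u"]
    by (simp add: inner_add_right inner_diff_left)
qed simp

text \<open>One step of the Gram-Schmidt procedure, in which \<open>d\<close> may already lie in the
  span.\<close>

lemma orthonormal_extend:
  assumes "orthonormal F" "finite F"
  shows "\<exists>F'. finite F' \<and> orthonormal F' \<and> F \<subseteq> F' \<and> d \<in> span F'"
proof -
  define w where "w = d - (\<Sum>u\<in>F. (d \<bullet> u) *\<^sub>R u)"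
  have w: "w \<bullet> v = 0" if "v \<in> F" for v
    unfolding w_def using projection_residual_orthogonal[OF assms] that span_base by blast
  have s: "(\<Sum>u\<in>F. (d \<bullet> u) *\<^sub>R u) \<in> span F"
    by (intro span_sum span_scale span_base)
  show ?thesis
  proof (cases "w = 0")
    case True
    then have "d \<in> span F"
      using s by (simp add: w_def)
    then show ?thesis using assms by auto
  next
    case False
    define F' where "F' = insert (sgn w) F"
    have "w = norm w *\<^sub>R sgn w"
      using False by (simp add: sgn_div_norm)
    then have "w \<in> span F'"
      by (metis F'_def insertI1 span_base span_scale)
    moreover have "(\<Sum>u\<in>F. (d \<bullet> u) *\<^sub>R u) \<in> span F'"
      using s span_mono[of F F'] by (auto simp: F'_def)
    ultimately have "w + (\<Sum>u\<in>F. (d \<bullet> u) *\<^sub>R u) \<in> span F'"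
      by (rule span_add)
    then have "d \<in> span F'"
      by (simp add: w_def)
    moreover have unit: "sgn w \<bullet> sgn w = 1"
      using False by (simp add: dot_square_norm norm_sgn)
    have "sgn w \<bullet> v = 0" if "v \<in> F" for v
      using w[OF that] by (simp add: sgn_div_norm)
    then have "orthonormal F'"
      using assms(1) unit by (fastforce simp: orthonormal_def F'_def inner_commute)
    ultimately show ?thesis
      using assms by (intro exI[of _ F']) (auto simp: F'_def)
  qed
qed

text \<open>\<open>trace_op\<close> is a definite description that quantifies over all orthonormal
  bases, and without any basis every number would satisfy it. Gram-Schmidt is applied to a dense
  sequence, which the Polish topology provides.\<close>

lemma orthonormal_basis_exists:
  "\<exists>B :: 'h::{real_inner, polish_space} set. orthonormal_basis B"
proof -
  obtain D :: "'h set" where D: "countable D" "\<And>X. open X \<Longrightarrow> X \<noteq> {} \<Longrightarrow> \<exists>d\<in>D. d \<in> X"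
    by (rule countable_dense_setE) blast
  have "D \<noteq> {}" using D(2)[of UNIV] by auto
  define d where "d = from_nat_into D"
  have d: "range d = D"
    using D(1) \<open>D \<noteq> {}\<close> by (simp add: d_def)
  have "\<exists>F. \<forall>n. (finite (F n) \<and> orthonormal (F n)) \<and> (F n \<subseteq> F (Suc n) \<and> d n \<in> span (F (Suc n)))"
  proof (rule dependent_nat_choice)
    show "\<exists>F::'h set. finite F \<and> orthonormal F"
      by (intro exI[of _ "{}"]) (simp add: orthonormal_def)
    show "\<exists>F'. (finite F' \<and> orthonormal F') \<and> F \<subseteq> F' \<and> d n \<in> span F'"
      if "finite F \<and> orthonormal F" for F n
      using orthonormal_extend[of F "d n"] that by blast
  qed
  then obtain F where F: "\<And>n. orthonormal (F n)" "\<And>n. F n \<subseteq> F (Suc n)" "\<And>n. d n \<in> span (F (Suc n))"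
    by blast
  have mono: "F m \<subseteq> F n" if "m \<le> n" for m n
    using F(2) that by (rule lift_Suc_mono_le)
  define B where "B = (\<Union>n. F n)"
  have "u \<bullet> v = (if u = v then 1 else 0)" if uv: "u \<in> B" "v \<in> B" for u v
  proof -
    obtain m n where "u \<in> F m" "v \<in> F n" using uv unfolding B_def by blast
    then have "u \<in> F (max m n)" "v \<in> F (max m n)"
      using mono[of m "max m n"] mono[of n "max m n"] by auto
    then show ?thesis using F(1) unfolding orthonormal_def by blast
  qed
  moreover have "x \<in> closure (span B)" for x
  proof -
    have "d n \<in> span B" for n
      using F(3)[of n] span_mono[of "F (Suc n)" B] unfolding B_def by blast
    then have "D \<subseteq> span B"
      unfolding d[symmetric] by blast
    have "\<exists>y\<in>span B. dist y x < e" if "e > 0" for e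
    proof -
      obtain y where "y \<in> D" "y \<in> ball x e"
        using D(2)[of "ball x e"] \<open>e > 0\<close> by auto
      then show ?thesis
        using \<open>D \<subseteq> span B\<close> by (intro bexI[of _ y]) (auto simp: dist_commute)
    qed
    then show ?thesis by (simp add: closure_approachable)
  qed
  ultimately have "orthonormal_basis B"
    by (auto simp: orthonormal_basis_def)
  then show ?thesis ..
qed

lemma projection_best_approx:
  assumes "orthonormal F" "finite F" "v \<in> span F"
  shows "norm (a - (\<Sum>u\<in>F. (a \<bullet> u) *\<^sub>R u)) \<le> norm (a - v)"
proof -
  define p where "p = (\<Sum>u\<in>F. (a \<bullet> u) *\<^sub>R u)"
  have "p - v \<in> span F"
    unfolding p_def by (intro span_diff assms span_sum span_scale span_base)
  then have "(a - p) \<bullet> (p - v) = 0"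
    unfolding p_def by (rule projection_residual_orthogonal[OF assms(1,2)])
  then have "(norm (a - v))\<^sup>2 = (norm (a - p))\<^sup>2 + (norm (p - v))\<^sup>2"
    using norm_add_Pythagorean[of "a - p" "p - v"] by (simp add: orthogonal_def)
  then have "(norm (a - p))\<^sup>2 \<le> (norm (a - v))\<^sup>2" by simp
  then show ?thesis
    unfolding p_def[symmetric] by (rule power2_le_imp_le) simp
qed

text \<open>The partial sum over \<open>F\<close> is the inner product of \<open>b\<close> with the
  projection of \<open>a\<close> to the span of \<open>F\<close>. Once \<open>F\<close> contains the
  finitely many basis vectors that make up an approximation \<open>v\<close> of \<open>a\<close>,
  the projection is at least as close to \<open>a\<close> as \<open>v\<close> is.\<close>

lemma parseval:
  assumes B: "orthonormal_basis B"
  shows "((\<lambda>u. (a \<bullet> u) * (u \<bullet> b)) has_sum (a \<bullet> b)) B"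
  unfolding has_sum_def tendsto_iff
proof (intro allI impI)
  fix e :: real assume "e > 0"
  define \<delta> where "\<delta> = e / (norm b + 1)"
  have "\<delta> > 0" using \<open>e > 0\<close> by (simp add: \<delta>_def add_nonneg_pos)
  have on: "orthonormal F" if "F \<subseteq> B" for F
    using B that unfolding orthonormal_basis_def orthonormal_def by blast
  have "a \<in> closure (span B)"
    using B by (simp add: orthonormal_basis_def)
  then obtain v where v: "v \<in> span B" "dist v a < \<delta>"
    using \<open>\<delta> > 0\<close> unfolding closure_approachable by blast
  obtain F0 where F0: "finite F0" "F0 \<subseteq> B" "v \<in> span F0"
  proof -
    obtain t r where "finite t" "t \<subseteq> B" "v = (\<Sum>a\<in>t. r a *\<^sub>R a)"
      using v(1) unfolding span_explicit by blast
    then show ?thesis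
      by (intro that[of t]) (simp_all add: span_sum span_scale span_base)
  qed
  show "\<forall>\<^sub>F F in finite_subsets_at_top B. dist (\<Sum>u\<in>F. (a \<bullet> u) * (u \<bullet> b)) (a \<bullet> b) < e"
    unfolding eventually_finite_subsets_at_top
  proof (intro exI[of _ F0] conjI F0 allI impI)
    fix F assume F: "finite F \<and> F0 \<subseteq> F \<and> F \<subseteq> B"
    let ?p = "\<Sum>u\<in>F. (a \<bullet> u) *\<^sub>R u"
    have "v \<in> span F" using F F0 span_mono by blast
    then have "norm (a - ?p) \<le> norm (a - v)"
      using projection_best_approx on F by blast
    then have *: "norm (a - ?p) < \<delta>"
      using v by (simp add: dist_norm norm_minus_commute)
    have "dist (\<Sum>u\<in>F. (a \<bullet> u) * (u \<bullet> b)) (a \<bullet> b) = \<bar>(a - ?p) \<bullet> b\<bar>"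
      by (simp add: dist_real_def inner_diff_left inner_sum_left abs_minus_commute)
    also have "\<dots> \<le> norm (a - ?p) * norm b"
      by (rule Cauchy_Schwarz_ineq2)
    also have "\<dots> \<le> \<delta> * norm b"
      using * by (intro mult_right_mono) auto
    also have "\<dots> < \<delta> * (norm b + 1)"
      using \<open>\<delta> > 0\<close> by simp
    also have "\<dots> = e"
      using norm_ge_zero[of b] by (simp add: \<delta>_def add_nonneg_eq_0_iff)
    finally show "dist (\<Sum>u\<in>F. (a \<bullet> u) * (u \<bullet> b)) (a \<bullet> b) < e" .
  qed
qed

lemma has_sum_sum_index:
  fixes f :: "'i \<Rightarrow> 'a \<Rightarrow> real"
  shows "(\<And>i. i \<in> A \<Longrightarrow> (f i has_sum s i) B) \<Longrightarrow> ((\<lambda>u. \<Sum>i\<in>A. f i u) has_sum (\<Sum>i\<in>A. s i)) B"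
  by (induction A rule: infinite_finite_induct) (simp_all add: has_sum_add)

text \<open>By Parseval's identity the rank one operator that sends \<open>u\<close> to
  \<open>(u \<bullet> e j) *\<^sub>R w i\<close> has the trace \<open>w i \<bullet> e j\<close> in
  every orthonormal basis; the rest is linearity.\<close>

lemma trace_op_finite_rank:
  fixes w e :: "nat \<Rightarrow> 'h::{real_inner, polish_space}"
  assumes T: "\<And>u. T u = (\<Sum>i<n. \<Sum>j<n. (c i j * (u \<bullet> e j)) *\<^sub>R w i)"
  shows "trace_op T = (\<Sum>i<n. \<Sum>j<n. c i j * (w i \<bullet> e j))"
proof -
  let ?s = "\<Sum>i<n. \<Sum>j<n. c i j * (w i \<bullet> e j)"
  have has: "((\<lambda>u. T u \<bullet> u) has_sum ?s) B" if "orthonormal_basis B" for B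
  proof -
    have "((\<lambda>u. \<Sum>i<n. \<Sum>j<n. c i j * ((w i \<bullet> u) * (u \<bullet> e j))) has_sum ?s) B"
      by (intro has_sum_sum_index has_sum_cmult_right parseval that)
    then show ?thesis
      by (simp add: T inner_sum_left mult_ac)
  qed
  obtain B :: "'h set" where B: "orthonormal_basis B"
    using orthonormal_basis_exists by blast
  show ?thesis
    unfolding trace_op_def
  proof (rule the_equality)
    show "\<forall>B. orthonormal_basis B \<longrightarrow> ((\<lambda>u. T u \<bullet> u) has_sum ?s) B"
      using has by blast
    show "s = ?s" if "\<forall>B. orthonormal_basis B \<longrightarrow> ((\<lambda>u. T u \<bullet> u) has_sum s) B" for s
      using has[OF B] that B has_sum_unique by blast
  qed
qed

section \<open>Linearity of the adjoint\<close>

text \<open>Density of the domain makes the vector in the definite description unique: the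
  difference of two candidates is orthogonal to a dense set.\<close>

lemma adjoint_op_eq:
  assumes "closure D = UNIV" "\<forall>x\<in>D. T x \<bullet> y = x \<bullet> z"
  shows "adjoint_op D T y = z"
  unfolding adjoint_op_def
proof (rule the_equality)
  fix z' assume z': "\<forall>x\<in>D. T x \<bullet> y = x \<bullet> z'"
  have "D \<subseteq> {x. (z' - z) \<bullet> x = 0}"
    using assms(2) z' by (auto simp: inner_commute inner_diff_right)
  then have "(z' - z) \<bullet> (z' - z) = 0"
    using closure_minimal[OF _ closed_hyperplane] assms(1) by blast
  then show "z' = z" by simp
qed (use assms in blast)

lemma adjoint_op_sum:
  assumes "closure D = UNIV" "\<And>i. i < n \<Longrightarrow> y i \<in> adjoint_dom D T"
  shows "adjoint_op D T (\<Sum>i<n. c i *\<^sub>R y i) = (\<Sum>i<(n::nat). c i *\<^sub>R adjoint_op D T (y i))"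
proof (rule adjoint_op_eq[OF assms(1)], rule ballI)
  fix x assume "x \<in> D"
  have "T x \<bullet> y i = x \<bullet> adjoint_op D T (y i)" if "i < n" for i
    using assms(2)[OF that] adjoint_op_eq[OF assms(1)] \<open>x \<in> D\<close> unfolding adjoint_dom_def by fastforce
  then show "T x \<bullet> (\<Sum>i<n. c i *\<^sub>R y i) = x \<bullet> (\<Sum>i<n. c i *\<^sub>R adjoint_op D T (y i))"
    by (simp add: inner_sum_right)
qed

section \<open>The parabolic operator on cylindrical functions\<close>

lemma tendsto_coordinatewise:
  fixes f :: "'a \<Rightarrow> nat \<Rightarrow> real"
  assumes "\<And>i. ((\<lambda>x. f x i) \<longlongrightarrow> l i) F"
  shows "(f \<longlongrightarrow> l) F"
proof -
  have "limitin (product_topology (\<lambda>_. euclidean) UNIV) f l F"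
    unfolding limitin_componentwise using assms by (simp add: limitin_canonical_iff)
  then show ?thesis
    by (simp add: euclidean_product_topology limitin_canonical_iff)
qed

text \<open>The increment in one coordinate has this form by the mean value theorem:
  \<open>c\<close> is the direction and \<open>q h\<close> a partial derivative at an intermediate
  point. That point depends on \<open>h\<close> in an uncontrolled way, but \<open>q\<close> still
  converges as \<open>h\<close> tends to 0.\<close>

lemma has_derivative_inner_mult:
  fixes q :: "'h::real_inner \<Rightarrow> real"
  assumes "(q \<longlongrightarrow> l) (at 0)"
  shows "((\<lambda>h. (h \<bullet> c) * q h) has_derivative (\<lambda>h. l * (h \<bullet> c))) (at 0)"
  unfolding has_derivative_iff_norm
proof
  show "bounded_linear (\<lambda>h. l * (h \<bullet> c))"
    by (intro bounded_linear_const_mult bounded_linear_inner_left)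
  show "((\<lambda>y. norm ((y \<bullet> c) * q y - (0 \<bullet> c) * q 0 - l * ((y - 0) \<bullet> c)) / norm (y - 0)) \<longlongrightarrow> 0) (at 0)"
  proof (rule tendsto_sandwich[where f = "\<lambda>_. 0" and h = "\<lambda>y. norm c * \<bar>q y - l\<bar>"])
    have "((\<lambda>y. norm c * \<bar>q y - l\<bar>) \<longlongrightarrow> norm c * \<bar>l - l\<bar>) (at 0)"
      by (intro tendsto_intros assms)
    then show "((\<lambda>y. norm c * \<bar>q y - l\<bar>) \<longlongrightarrow> 0) (at 0)" by simp
    have "norm ((y \<bullet> c) * q y - (0 \<bullet> c) * q 0 - l * ((y - 0) \<bullet> c)) / norm (y - 0) \<le> norm c * \<bar>q y - l\<bar>"
      if "y \<noteq> 0" for y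
    proof -
      have "norm ((y \<bullet> c) * q y - (0 \<bullet> c) * q 0 - l * ((y - 0) \<bullet> c)) = \<bar>y \<bullet> c\<bar> * \<bar>q y - l\<bar>"
        by (simp add: abs_mult[symmetric] algebra_simps)
      also have "\<dots> \<le> (norm y * norm c) * \<bar>q y - l\<bar>"
        by (intro mult_right_mono Cauchy_Schwarz_ineq2) simp
      finally show ?thesis
        using that by (simp add: divide_simps mult_ac)
    qed
    then show "\<forall>\<^sub>F y in at 0. norm ((y \<bullet> c) * q y - (0 \<bullet> c) * q 0 - l * ((y - 0) \<bullet> c)) / norm (y - 0)
        \<le> norm c * \<bar>q y - l\<bar>"
      by (auto simp: eventually_at_filter)
  qed (auto simp: eventually_at_filter)
qed

lemma MVT_unordered:
  fixes f :: "real \<Rightarrow> real"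
  assumes "\<And>s. (f has_real_derivative f' s) (at s)"
  shows "\<exists>\<xi>. \<bar>\<xi> - a\<bar> \<le> \<bar>b - a\<bar> \<and> f b - f a = (b - a) * f' \<xi>"
proof (cases a b rule: linorder_cases)
  case less
  then obtain z where "a < z" "z < b" "f b - f a = (b - a) * f' z"
    using MVT2[of a b f f'] assms by blast
  then show ?thesis by (intro exI[of _ z]) auto
next
  case greater
  then obtain z where "b < z" "z < a" "f a - f b = (a - b) * f' z"
    using MVT2[of b a f f'] assms by blast
  then show ?thesis by (intro exI[of _ z]) (auto simp: algebra_simps)
qed auto

text \<open>The coordinates are moved from \<open>x\<close> to \<open>x + h\<close> one at a time.\<close>

lemma has_derivative_cylindrical:
  fixes e :: "nat \<Rightarrow> 'h::real_inner"
  assumes d: "\<And>i z. i < n \<Longrightarrow> z \<in> Rn n \<Longrightarrow> ((\<lambda>s. g (z(i := s))) has_real_derivative g1 i z) (at (z i))"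
    and c: "\<And>i. i < n \<Longrightarrow> continuous_on (Rn n) (g1 i)"
  shows "((\<lambda>y. g (coords e n y)) has_derivative (\<lambda>h. \<Sum>i<n. g1 i (coords e n x) * (h \<bullet> e i))) (at x)"
proof -
  define y where "y k h i = (if i < k then (x + h) \<bullet> e i else if i < n then x \<bullet> e i else 0)" for k h i
  have y0: "y k 0 = coords e n x" if "k \<le> n" for k
    using that by (auto simp: y_def coords_def fun_eq_iff)
  have Rn: "(y k h)(i := s) \<in> Rn n" if "k \<le> n" "i < n" for k h i s
    using that by (auto simp: y_def Rn_def)
  have partial: "((\<lambda>h. g (y k h)) has_derivative (\<lambda>h. \<Sum>i<k. g1 i (coords e n x) * (h \<bullet> e i))) (at 0)"
    if "k \<le> n" for k
    using that
  proof (induction k)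
    case 0
    have "y 0 h = coords e n x" for h
      by (auto simp: y_def coords_def fun_eq_iff)
    then show ?case by simp
  next
    case (Suc k)
    let ?p = "\<lambda>h s. (y k h)(k := s)"
    have "\<exists>\<xi>. \<bar>\<xi> - x \<bullet> e k\<bar> \<le> \<bar>h \<bullet> e k\<bar> \<and> g (y (Suc k) h) - g (y k h) = (h \<bullet> e k) * g1 k (?p h \<xi>)" for h
    proof -
      have "((\<lambda>s. g (?p h s)) has_real_derivative g1 k (?p h s)) (at s)" for s
        using d[of k "?p h s"] Rn[of k k h s] Suc.prems by simp
      from MVT_unordered[of "\<lambda>s. g (?p h s)" "\<lambda>s. g1 k (?p h s)" "x \<bullet> e k" "(x + h) \<bullet> e k", OF this]
      have "\<exists>\<xi>. \<bar>\<xi> - x \<bullet> e k\<bar> \<le> \<bar>h \<bullet> e k\<bar> \<and>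
          g (?p h ((x + h) \<bullet> e k)) - g (?p h (x \<bullet> e k)) = (h \<bullet> e k) * g1 k (?p h \<xi>)"
        by (simp add: inner_add_left)
      moreover have "?p h ((x + h) \<bullet> e k) = y (Suc k) h" "?p h (x \<bullet> e k) = y k h"
        using Suc.prems by (auto simp: y_def fun_eq_iff)
      ultimately show ?thesis by simp
    qed
    then obtain \<xi> where \<xi>: "\<And>h. \<bar>\<xi> h - x \<bullet> e k\<bar> \<le> \<bar>h \<bullet> e k\<bar>"
      "\<And>h. g (y (Suc k) h) - g (y k h) = (h \<bullet> e k) * g1 k (?p h (\<xi> h))"
      by metis
    have "((\<lambda>h. h \<bullet> e k) \<longlongrightarrow> 0 \<bullet> e k) (at 0)"
      by (intro tendsto_intros)
    then have "((\<lambda>h. \<bar>h \<bullet> e k\<bar>) \<longlongrightarrow> 0) (at 0)"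
      by (intro tendsto_rabs_zero) simp
    then have "((\<lambda>h. \<xi> h - x \<bullet> e k) \<longlongrightarrow> 0) (at 0)"
      by (rule Lim_null_comparison[rotated]) (simp add: \<xi>(1))
    then have \<xi>lim: "(\<xi> \<longlongrightarrow> x \<bullet> e k) (at 0)"
      by (rule Lim_null[THEN iffD2])
    have lim: "((\<lambda>h. ?p h (\<xi> h)) \<longlongrightarrow> coords e n x) (at 0)"
    proof (rule tendsto_coordinatewise)
      fix i
      have "((\<lambda>h. (x + h) \<bullet> e i) \<longlongrightarrow> (x + 0) \<bullet> e i) (at 0)"
        by (intro tendsto_intros)
      then show "((\<lambda>h. (?p h (\<xi> h)) i) \<longlongrightarrow> coords e n x i) (at 0)"
        using \<xi>lim Suc.prems by (cases "i = k"; cases "i < k") (auto simp: y_def coords_def)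
    qed
    have "((\<lambda>h. g1 k (?p h (\<xi> h))) \<longlongrightarrow> g1 k (coords e n x)) (at 0)"
      using Suc.prems
      by (intro continuous_on_tendsto_compose[OF c lim] always_eventually allI Rn) (auto simp: coords_in_Rn)
    from has_derivative_add[OF Suc.IH has_derivative_inner_mult[OF this]]
    have "((\<lambda>h. g (y k h) + (h \<bullet> e k) * g1 k (?p h (\<xi> h))) has_derivative
        (\<lambda>h. \<Sum>i<Suc k. g1 i (coords e n x) * (h \<bullet> e i))) (at 0)"
      using Suc.prems by simp
    moreover have "g (y k h) + (h \<bullet> e k) * g1 k (?p h (\<xi> h)) = g (y (Suc k) h)" for h
      using \<xi>(2)[of h] by simp
    ultimately show ?case by simp
  qed
  have "((\<lambda>h. g (coords e n (x + h))) has_derivative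
      (\<lambda>h. \<Sum>i<n. g1 i (coords e n x) * (h \<bullet> e i))) (at 0)"
  proof -
    have "y n h = coords e n (x + h)" for h
      by (auto simp: y_def coords_def fun_eq_iff)
    then show ?thesis using partial[of n] by simp
  qed
  moreover have "((\<lambda>y. y - x) has_derivative (\<lambda>h. h)) (at x)"
    by (auto intro!: derivative_eq_intros)
  ultimately have "((\<lambda>h. g (coords e n (x + h))) \<circ> (\<lambda>y. y - x) has_derivative
      (\<lambda>h. \<Sum>i<n. g1 i (coords e n x) * (h \<bullet> e i)) \<circ> (\<lambda>h. h)) (at x)"
    by (intro diff_chain_at) simp_all
  then show ?thesis by (simp add: o_def)
qed

section \<open>The operator in terms of partial derivatives\<close>

text \<open>Named functions replace the nested existential quantifiers of \<open>Ck\<close>, up to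
  the order that the operator sees: one in time and two in space.\<close>

definition jets where
  "jets I n \<phi> \<phi>t \<phi>1 \<phi>2 \<longleftrightarrow>
     (time_deriv I n \<phi> \<phi>t) \<and>
     (\<forall>i<n. continuous_on (I \<times> Rn n) (\<phi>1 i) \<and>
       (coord_deriv I n i \<phi> (\<phi>1 i))) \<and>
     (\<forall>i<n. \<forall>j<n. continuous_on (I \<times> Rn n) (\<phi>2 i j) \<and>
       (coord_deriv I n j (\<phi>1 i) (\<phi>2 i j)))"

lemma Ck_jets:
  assumes "Ck (Suc (Suc 0)) I n \<phi>"
  shows "\<exists>\<phi>t \<phi>1 \<phi>2. jets I n \<phi> \<phi>t \<phi>1 \<phi>2 \<and> continuous_on (I \<times> Rn n) \<phi>t"
proof -
  obtain \<phi>t where \<phi>t: "Ck (Suc 0) I n \<phi>t"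
    "time_deriv I n \<phi> \<phi>t"
    using assms unfolding Ck.simps(2)[of "Suc 0"] by blast
  have "\<forall>i. \<exists>\<psi>. i < n \<longrightarrow> Ck (Suc 0) I n \<psi> \<and>
      (coord_deriv I n i \<phi> \<psi>)"
    using assms unfolding Ck.simps(2)[of "Suc 0"] by blast
  from choice[OF this] obtain \<phi>1 where \<phi>1: "\<And>i. i < n \<Longrightarrow> Ck (Suc 0) I n (\<phi>1 i) \<and>
      (coord_deriv I n i \<phi> (\<phi>1 i))"
    by blast
  have "\<forall>i. \<forall>j. \<exists>\<psi>. i < n \<longrightarrow> j < n \<longrightarrow> Ck 0 I n \<psi> \<and>
      (coord_deriv I n j (\<phi>1 i) \<psi>)"
    using \<phi>1 unfolding Ck.simps(2)[of 0] by blast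
  then obtain \<phi>2 where "\<And>i j. i < n \<Longrightarrow> j < n \<Longrightarrow> Ck 0 I n (\<phi>2 i j) \<and>
      (coord_deriv I n j (\<phi>1 i) (\<phi>2 i j))"
    by metis
  then have "jets I n \<phi> \<phi>t \<phi>1 \<phi>2"
    unfolding jets_def using \<phi>t \<phi>1 Ck_imp_continuous by blast
  then show ?thesis
    using Ck_imp_continuous[OF \<phi>t(1)] by blast
qed

text \<open>Truncated subtraction in the exponents is harmless, since the factors \<open>m\<close>
  and \<open>m - 1\<close> vanish in the cases where it takes effect.\<close>

lemma jets_power:
  assumes J: "jets I n \<phi> \<phi>t \<phi>1 \<phi>2" and cont: "continuous_on (I \<times> Rn n) \<phi>"
  shows "jets I n (\<lambda>p. \<phi> p ^ m) (\<lambda>p. m * \<phi> p ^ (m - 1) * \<phi>t p) (\<lambda>i p. m * \<phi> p ^ (m - 1) * \<phi>1 i p)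
    (\<lambda>i j p. m * \<phi> p ^ (m - 1) * \<phi>2 i j p + real m * real (m - 1) * \<phi> p ^ (m - 2) * \<phi>1 i p * \<phi>1 j p)"
  unfolding jets_def
proof (intro conjI ballI allI impI)
  fix t z assume tz: "t \<in> I" "z \<in> Rn n"
  have "((\<lambda>s. \<phi> (s, z)) has_real_derivative \<phi>t (t, z)) (at t within I)"
    using J tz by (auto simp: jets_def)
  from DERIV_power[OF this, of m]
  show "((\<lambda>s. \<phi> (s, z) ^ m) has_real_derivative m * \<phi> (t, z) ^ (m - 1) * \<phi>t (t, z)) (at t within I)"
    by (simp add: mult_ac)
next
  fix i t z assume i: "i < n" and tz: "t \<in> I" "z \<in> Rn n"
  have di: "((\<lambda>s. \<phi> (t, z(i := s))) has_real_derivative \<phi>1 i (t, z)) (at (z i))"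
    using J i tz by (auto simp: jets_def)
  from DERIV_power[OF this, of m]
  show "((\<lambda>s. \<phi> (t, z(i := s)) ^ m) has_real_derivative m * \<phi> (t, z) ^ (m - 1) * \<phi>1 i (t, z)) (at (z i))"
    by (simp add: mult_ac)
next
  fix i j t z assume i: "i < n" and j: "j < n" and tz: "t \<in> I" "z \<in> Rn n"
  have dj: "((\<lambda>s. \<phi> (t, z(j := s))) has_real_derivative \<phi>1 j (t, z)) (at (z j))"
    and dij: "((\<lambda>s. \<phi>1 i (t, z(j := s))) has_real_derivative \<phi>2 i j (t, z)) (at (z j))"
    using J i j tz by (auto simp: jets_def)
  from DERIV_cmult[OF DERIV_mult[OF DERIV_power[OF dj, of "m - 1"] dij], of "real m"]
  show "((\<lambda>s. m * \<phi> (t, z(j := s)) ^ (m - 1) * \<phi>1 i (t, z(j := s))) has_real_derivative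
      m * \<phi> (t, z) ^ (m - 1) * \<phi>2 i j (t, z) +
      real m * real (m - 1) * \<phi> (t, z) ^ (m - 2) * \<phi>1 i (t, z) * \<phi>1 j (t, z)) (at (z j))"
    by (simp add: algebra_simps numeral_2_eq_2)
qed (use J cont in \<open>auto simp: jets_def intro!: continuous_intros\<close>)

text \<open>The local part of the operator at one point, as a linear form in the time derivative
  \<open>a0\<close>, the first derivatives \<open>a1\<close> and the second derivatives
  \<open>a2\<close>. The first sum is the trace of the squared diffusion operator times the
  Hessian.\<close>

definition jet_sum where
  "jet_sum K n a0 a1 a2 t x =
     a0 + 1 / 2 * (\<Sum>i<n. \<Sum>j<n. a2 i j * (sig K t x (sig K t x (test K i)) \<bullet> test K j)) +
     (\<Sum>i<n. a1 i * (x \<bullet> Astar K t (test K i))) +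
     (\<Sum>i<n. a1 i * (drift K t x \<bullet> test K i))"

lemma grad_eqI:
  assumes "(g has_derivative (\<lambda>h. h \<bullet> v)) (at x)"
  shows "grad g x = v"
  unfolding grad_def gderiv_def
proof (rule the_equality[where a = v])
  fix w assume "(g has_derivative (\<lambda>h. h \<bullet> w)) (at x)"
  from has_derivative_unique[OF this assms] have "w \<bullet> w = w \<bullet> v" "v \<bullet> w = v \<bullet> v"
    by (auto dest: fun_cong)
  then have "(w - v) \<bullet> (w - v) = 0"
    by (simp add: inner_diff_left inner_diff_right inner_commute)
  then show "w = v" by simp
qed (fact assms)

lemma cylindrical_derivatives:
  fixes K :: "('h::{real_inner, polish_space}) coefficients"
  assumes J: "jets I n \<phi> \<phi>t \<phi>1 \<phi>2" and t: "t \<in> I"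
    and f: "\<And>y. f (t, y) = \<phi> (t, coords (test K) n y)"
  shows "((\<lambda>y. f (t, y)) has_derivative (\<lambda>h. h \<bullet> (\<Sum>i<n. \<phi>1 i (t, coords (test K) n y) *\<^sub>R test K i))) (at y)"
    and "grad (\<lambda>y. f (t, y)) y = (\<Sum>i<n. \<phi>1 i (t, coords (test K) n y) *\<^sub>R test K i)"
    and "(grad (\<lambda>y. f (t, y)) has_derivative
        (\<lambda>h. \<Sum>i<n. (\<Sum>j<n. \<phi>2 i j (t, coords (test K) n y) * (h \<bullet> test K j)) *\<^sub>R test K i)) (at y)"
    and "hess (\<lambda>y. f (t, y)) y h =
        (\<Sum>i<n. (\<Sum>j<n. \<phi>2 i j (t, coords (test K) n y) * (h \<bullet> test K j)) *\<^sub>R test K i)"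
proof -
  have slice: "continuous_on (Rn n) (\<lambda>z. \<psi> (t, z))" if "continuous_on (I \<times> Rn n) \<psi>"
    for \<psi> :: "real \<times> (nat \<Rightarrow> real) \<Rightarrow> real"
    by (rule continuous_on_compose2[OF that]) (use t in \<open>auto intro!: continuous_intros\<close>)
  have d1: "((\<lambda>y. \<phi> (t, coords (test K) n y)) has_derivative
      (\<lambda>h. \<Sum>i<n. \<phi>1 i (t, coords (test K) n y) * (h \<bullet> test K i))) (at y)" for y
    by (rule has_derivative_cylindrical[where g = "\<lambda>z. \<phi> (t, z)" and ?g1.0 = "\<lambda>i z. \<phi>1 i (t, z)"])
      (use J t in \<open>auto simp: jets_def intro!: slice\<close>)
  then show d1': "((\<lambda>y. f (t, y)) has_derivative
      (\<lambda>h. h \<bullet> (\<Sum>i<n. \<phi>1 i (t, coords (test K) n y) *\<^sub>R test K i))) (at y)" for y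
    by (simp add: f inner_sum_right)
  show grad: "grad (\<lambda>y. f (t, y)) y = (\<Sum>i<n. \<phi>1 i (t, coords (test K) n y) *\<^sub>R test K i)" for y
    by (rule grad_eqI[OF d1'])
  have d2: "((\<lambda>y. \<phi>1 i (t, coords (test K) n y)) has_derivative
      (\<lambda>h. \<Sum>j<n. \<phi>2 i j (t, coords (test K) n y) * (h \<bullet> test K j))) (at y)" if "i < n" for i y
    by (rule has_derivative_cylindrical[where g = "\<lambda>z. \<phi>1 i (t, z)" and ?g1.0 = "\<lambda>j z. \<phi>2 i j (t, z)"])
      (use J t that in \<open>auto simp: jets_def intro!: slice\<close>)
  have "((\<lambda>y. \<Sum>i<n. \<phi>1 i (t, coords (test K) n y) *\<^sub>R test K i) has_derivative
      (\<lambda>h. \<Sum>i<n. (\<Sum>j<n. \<phi>2 i j (t, coords (test K) n y) * (h \<bullet> test K j)) *\<^sub>R test K i)) (at y)"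
    by (intro has_derivative_sum has_derivative_scaleR_left d2) auto
  then show d2': "(grad (\<lambda>y. f (t, y)) has_derivative
      (\<lambda>h. \<Sum>i<n. (\<Sum>j<n. \<phi>2 i j (t, coords (test K) n y) * (h \<bullet> test K j)) *\<^sub>R test K i)) (at y)"
    using grad by presburger
  show "hess (\<lambda>y. f (t, y)) y h =
      (\<Sum>i<n. (\<Sum>j<n. \<phi>2 i j (t, coords (test K) n y) * (h \<bullet> test K j)) *\<^sub>R test K i)"
    unfolding hess_def frechet_derivative_at[OF d2', symmetric] ..
qed

text \<open>Derivatives within \<open>I\<close> are unique because an interval with interior has no
  isolated point, not even at its ends.\<close>

lemma interval_at_within_nontrivial:
  fixes I :: "real set"
  assumes "is_interval I" "interior I \<noteq> {}" "t \<in> I"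
  shows "at t within I \<noteq> bot"
proof -
  have "\<not> (\<exists>a. I = {a})"
    using assms(2) by auto
  then show ?thesis
    using connected_imp_perfect[of I t] assms by (auto simp: is_interval_connected trivial_limit_within)
qed

text \<open>Gradient, Hessian, trace, adjoint and time derivative are defined by choice or
  description. They are all evaluated here, so that later arguments see finite sums and the jump
  integral only.\<close>

lemma parabolic_op_eq:
  fixes K :: "('h::{real_inner, polish_space}) coefficients" and x :: 'h
  assumes adm: "admissible K" and I: "is_interval I" "interior I \<noteq> {}" "I \<subseteq> {0..}"
    and J: "jets I n \<phi> \<phi>t \<phi>1 \<phi>2" and t: "t \<in> I"
    and f: "\<And>t y. t \<in> I \<Longrightarrow> f (t, y) = \<phi> (t, coords (test K) n y)"
  defines "p \<equiv> (t, coords (test K) n x)"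
  shows "parabolic_op K I f (t, x) = jet_sum K n (\<phi>t p) (\<lambda>i. \<phi>1 i p) (\<lambda>i j. \<phi>2 i j p) t x +
    (\<integral>y. f (t, x + y) - f (t, x) - (y \<bullet> grad (\<lambda>y. f (t, y)) x) / (1 + (norm y)\<^sup>2) \<partial>jump K t x)"
proof -
  note D = cylindrical_derivatives[OF J t f[OF t]]
  have t0: "t \<ge> 0" using t I by auto
  have "((\<lambda>s. \<phi> (s, coords (test K) n x)) has_real_derivative \<phi>t p) (at t within I)"
    unfolding p_def using J[unfolded jets_def] t coords_in_Rn by blast
  then have "((\<lambda>s. f (s, x)) has_real_derivative \<phi>t p) (at t within I)"
    by (rule has_field_derivative_transform_within[where d = 1]) (simp_all add: f t)
  with interval_at_within_nontrivial[OF I(1,2) t] have time: "vector_derivative (\<lambda>s. f (s, x)) (at t within I) = \<phi>t p"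
    by (intro vector_derivative_within) (auto simp: has_real_derivative_iff_has_vector_derivative)
  have lin: "bounded_linear (sig K t x)"
    using adm t0 unfolding admissible_def by blast
  have dense: "closure (Adom K t) = UNIV"
  proof -
    have "\<forall>t\<ge>0. densely_defined_operator (Adom K t) (Aop K t)"
      using adm unfolding admissible_def by (elim conjE)
    then show ?thesis
      using t0 by (simp add: densely_defined_operator_def)
  qed
  have "range (test K) \<subseteq> (\<Inter>t\<in>{0..}. Astar_dom K t)"
    using adm unfolding admissible_def by (elim conjE)
  then have dom: "test K i \<in> Astar_dom K t" for i
    using t0 by blast
  interpret bounded_linear "sig K t x" by (fact lin)
  have "trace_op (\<lambda>u. sig K t x (sig K t x (hess (\<lambda>y. f (t, y)) x u))) =
      (\<Sum>i<n. \<Sum>j<n. \<phi>2 i j p * (sig K t x (sig K t x (test K i)) \<bullet> test K j))"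
    by (rule trace_op_finite_rank) (simp add: D(4) sum scaleR scaleR_left.sum p_def)
  moreover have "x \<bullet> Astar K t (grad (\<lambda>y. f (t, y)) x) = (\<Sum>i<n. \<phi>1 i p * (x \<bullet> Astar K t (test K i)))"
    unfolding D(2) p_def
    by (subst adjoint_op_sum[OF dense dom]) (simp add: inner_sum_right)
  moreover have "drift K t x \<bullet> grad (\<lambda>y. f (t, y)) x = (\<Sum>i<n. \<phi>1 i p * (drift K t x \<bullet> test K i))"
    unfolding D(2) p_def by (simp add: inner_sum_right)
  ultimately show ?thesis
    by (simp add: parabolic_op_def spatial_op_def time jet_sum_def)
qed

section \<open>Cancellation at points without jumps\<close>

text \<open>The jet of a power \<phi>^m has this shape, with k = m \<phi>^(m-1) and l = m (m-1)
  \<phi>^(m-2). So all powers share two quantities: the operator applied to \<phi>, and a quadratic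
  form in the first derivatives.\<close>

lemma jet_sum_combination:
  fixes K :: "('h::{real_inner, polish_space}) coefficients"
  shows "jet_sum K n (k * a0) (\<lambda>i. k * a1 i) (\<lambda>i j. k * a2 i j + l * a1 i * a1 j) t x =
    k * jet_sum K n a0 a1 a2 t x +
    l * (1 / 2 * (\<Sum>i<n. \<Sum>j<n. a1 i * a1 j * (sig K t x (sig K t x (test K i)) \<bullet> test K j)))"
proof -
  have e2: "(\<Sum>i<n. \<Sum>j<n. (k * a2 i j + l * a1 i * a1 j) * (sig K t x (sig K t x (test K i)) \<bullet> test K j)) =
      k * (\<Sum>i<n. \<Sum>j<n. a2 i j * (sig K t x (sig K t x (test K i)) \<bullet> test K j)) +
      l * (\<Sum>i<n. \<Sum>j<n. a1 i * a1 j * (sig K t x (sig K t x (test K i)) \<bullet> test K j))"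
    by (simp add: distrib_right sum.distrib sum_distrib_left mult.assoc)
  have e1: "(\<Sum>i<n. k * a1 i * c i) = k * (\<Sum>i<n. a1 i * c i)" for c
    by (simp add: sum_distrib_left mult.assoc)
  show ?thesis
    unfolding jet_sum_def e1 e2 by (simp add: distrib_left)
qed

lemma no_jump_integral:
  assumes "(t, x) \<in> no_jump_set K" "admissible K"
  shows "(\<integral>y. g y \<partial>jump K t x) = (0 :: real)"
proof -
  have "t \<ge> 0" "\<And>B. B \<in> sets borel \<Longrightarrow> emeasure (jump K t x) B = 0"
    using assms(1) by (auto simp: no_jump_set_def)
  moreover have "\<forall>t\<ge>0. \<forall>x. levy_measure (jump K t x)"
    using assms(2) unfolding admissible_def by (elim conjE)
  ultimately have s: "sets (jump K t x) = sets borel" "emeasure (jump K t x) UNIV = 0"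
    by (auto simp: levy_measure_def)
  then have "space (jump K t x) = UNIV"
    using sets_eq_imp_space_eq by fastforce
  then have "AE y in jump K t x. g y = 0"
    using s by (intro AE_I[where N = UNIV]) auto
  then show ?thesis
    by (rule integral_eq_zero_AE)
qed

text \<open>At the given point the operator maps \<open>f ^ m\<close> to \<open>Q\<close> times the
  first plus \<open>\<Gamma>\<close> times the second derivative of s^m at s = \<open>c\<close>,
  with \<open>Q\<close> and \<open>\<Gamma>\<close> the same for all \<open>m\<close>. The
  combination belongs to the polynomial (s - c)^4, up to its constant term, and its first two
  derivatives vanish at \<open>c\<close>.\<close>

lemma parabolic_op_powers_cancel:
  fixes K :: "('h::{real_inner, polish_space}) coefficients"
  assumes adm: "admissible K" and I: "is_interval I" "interior I \<noteq> {}" "I \<subseteq> {0..}"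
    and f: "f \<in> test_functions K I" and t: "t \<in> I" "(t, x) \<in> no_jump_set K"
  defines "c \<equiv> f (t, x)"
  shows "parabolic_op K I (\<lambda>p. f p ^ 4) (t, x) - 4 * c * parabolic_op K I (\<lambda>p. f p ^ 3) (t, x)
    + 6 * c\<^sup>2 * parabolic_op K I (\<lambda>p. f p ^ 2) (t, x) - 4 * c ^ 3 * parabolic_op K I (\<lambda>p. f p ^ 1) (t, x) = 0"
proof -
  obtain n \<phi> where \<phi>: "\<forall>k. Ck k I n \<phi>"
    and f: "\<And>t x. t \<in> I \<Longrightarrow> f (t, x) = \<phi> (t, coords (test K) n x)"
    using f by (auto simp: test_functions_def Cc_infinity_def)
  obtain \<phi>t \<phi>1 \<phi>2 where J: "jets I n \<phi> \<phi>t \<phi>1 \<phi>2"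
    using Ck_jets \<phi> by blast
  define p where "p = (t, coords (test K) n x)"
  have c: "c = \<phi> p" using f t by (simp add: c_def p_def)
  define Q where "Q = jet_sum K n (\<phi>t p) (\<lambda>i. \<phi>1 i p) (\<lambda>i j. \<phi>2 i j p) t x"
  define \<Gamma> where "\<Gamma> = 1 / 2 * (\<Sum>i<n. \<Sum>j<n. \<phi>1 i p * \<phi>1 j p * (sig K t x (sig K t x (test K i)) \<bullet> test K j))"
  have "parabolic_op K I (\<lambda>p. f p ^ m) (t, x) = m * c ^ (m - 1) * Q + real m * real (m - 1) * c ^ (m - 2) * \<Gamma>" for m
    unfolding Q_def \<Gamma>_def jet_sum_combination[symmetric] c
    by (subst parabolic_op_eq[OF adm I jets_power[OF J Ck_imp_continuous[OF \<phi>[rule_format, of 0]]] t(1)])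
      (simp_all add: f p_def no_jump_integral[OF t(2) adm])
  note this[of 1] this[of 2] this[of 3] this[of 4]
  then show ?thesis
    by (simp add: power2_eq_square power3_eq_cube power4_eq_xxxx algebra_simps)
qed

section \<open>Boundedness of the operator for bounded coefficients\<close>

text \<open>The complement of the compact set is open, so at a point outside, the function vanishes
  nearby along every coordinate line and, within \<open>I\<close>, along the time axis.\<close>

lemma jets_vanish:
  assumes I: "is_interval I" "interior I \<noteq> {}"
    and J: "jets I n \<phi> \<phi>t \<phi>1 \<phi>2"
    and C: "compact C" "\<forall>p\<in>I \<times> Rn n - C. \<phi> p = 0"
    and p: "p \<in> I \<times> Rn n - C"
  shows "\<phi>t p = 0" and "\<And>i. i < n \<Longrightarrow> \<phi>1 i p = 0" and "\<And>i j. i < n \<Longrightarrow> j < n \<Longrightarrow> \<phi>2 i j p = 0"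
proof -
  have op: "open (- C)"
    using compact_imp_closed[OF C(1)] by auto
  have J1: "((\<lambda>s. \<phi> (t, z(i := s))) has_real_derivative \<phi>1 i (t, z)) (at (z i))"
    and J2: "j < n \<Longrightarrow> ((\<lambda>s. \<phi>1 i (t, z(j := s))) has_real_derivative \<phi>2 i j (t, z)) (at (z j))"
    if "i < n" "t \<in> I" "z \<in> Rn n" for i j t z
    using J that unfolding jets_def by blast+
  \<comment> \<open>Stated for a general \<open>\<psi>\<close>, because it is applied to
    \<open>\<phi>\<close> and then, for the second derivatives, to \<open>\<phi>1 i\<close>.\<close>
  have coord0: "\<psi>1 (t, z) = 0"
    if tz: "t \<in> I" "z \<in> Rn n" "(t, z) \<notin> C" and "i < n"
      and \<psi>: "\<forall>q\<in>I \<times> Rn n - C. \<psi> q = 0"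
      and d: "((\<lambda>s. \<psi> (t, z(i := s))) has_real_derivative \<psi>1 (t, z)) (at (z i))"
    for \<psi> \<psi>1 :: "real \<times> (nat \<Rightarrow> real) \<Rightarrow> real" and i t z
  proof -
    have "continuous_on UNIV (\<lambda>s. (t, z(i := s)))"
    proof (intro continuous_on_Pair continuous_on_const continuous_on_coordinatewise_then_product)
      show "continuous_on UNIV (\<lambda>s. (z(i := s)) j)" for j
        by (cases "j = i") (simp_all add: continuous_on_id)
    qed
    then have "open ((\<lambda>s. (t, z(i := s))) -` (- C))"
      using op by (simp add: continuous_on_open_vimage)
    moreover have "\<psi> (t, z(i := s)) = 0" if "s \<in> (\<lambda>s. (t, z(i := s))) -` (- C)" for s
      using that tz \<open>i < n\<close> \<psi> by (auto simp: Rn_def)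
    ultimately have "((\<lambda>_. 0) has_real_derivative \<psi>1 (t, z)) (at (z i))"
      using tz(3) by (intro has_field_derivative_transform_within_open[OF d]) auto
    then show ?thesis
      using DERIV_const DERIV_unique by blast
  qed
  have \<phi>1: "\<phi>1 i p = 0" if "i < n" "p \<in> I \<times> Rn n - C" for i p
    using coord0[of "fst p" "snd p" i \<phi> "\<phi>1 i"] J1[of i "fst p" "snd p"] C(2) that by auto
  show "\<phi>1 i p = 0" if "i < n" for i
    using \<phi>1 that p by blast
  show "\<phi>2 i j p = 0" if "i < n" "j < n" for i j
    using coord0[of "fst p" "snd p" j "\<phi>1 i" "\<phi>2 i j"] J2[of i "fst p" "snd p" j] \<phi>1 that p by auto
  obtain t z where tz: "p = (t, z)" "t \<in> I" "z \<in> Rn n" "(t, z) \<notin> C" using p by auto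
  have "continuous_on UNIV (\<lambda>s. (s, z))"
    by (intro continuous_intros)
  then have "open ((\<lambda>s. (s, z)) -` (- C))"
    by (rule open_vimage[OF op])
  then obtain \<delta> where \<delta>: "\<delta> > 0" "\<And>s. dist s t < \<delta> \<Longrightarrow> (s, z) \<notin> C"
    using tz(4) unfolding open_dist by force
  have "((\<lambda>s. \<phi> (s, z)) has_real_derivative \<phi>t (t, z)) (at t within I)"
    using J[unfolded jets_def] tz by blast
  then have "((\<lambda>_. 0) has_real_derivative \<phi>t (t, z)) (at t within I)"
    by (rule has_field_derivative_transform_within[OF _ \<delta>(1) tz(2)]) (use \<delta> tz C(2) in auto)
  moreover have "((\<lambda>_. 0) has_real_derivative 0) (at t within I)"
    by simp
  ultimately show "\<phi>t p = 0"
    using vector_derivative_unique_within[OF interval_at_within_nontrivial[OF I tz(2)]] tz(1)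
    unfolding has_real_derivative_iff_has_vector_derivative by blast
qed

lemma jets_bounded:
  assumes I: "is_interval I" "interior I \<noteq> {}"
    and J: "jets I n \<phi> \<phi>t \<phi>1 \<phi>2" and cont: "continuous_on (I \<times> Rn n) \<phi>t"
    and C: "compact C" "C \<subseteq> I \<times> Rn n" "\<forall>p\<in>I \<times> Rn n - C. \<phi> p = 0"
  shows "\<exists>B\<ge>0. \<forall>p\<in>I \<times> Rn n. \<bar>\<phi>t p\<bar> \<le> B \<and> (\<forall>i<n. \<bar>\<phi>1 i p\<bar> \<le> B) \<and> (\<forall>i<n. \<forall>j<n. \<bar>\<phi>2 i j p\<bar> \<le> B)"
proof -
  note v = jets_vanish[OF I J C(1,3)]
  have c: "\<And>i. i < n \<Longrightarrow> continuous_on (I \<times> Rn n) (\<phi>1 i)"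
    "\<And>i j. i < n \<Longrightarrow> j < n \<Longrightarrow> continuous_on (I \<times> Rn n) (\<phi>2 i j)"
    using J by (auto simp: jets_def)
  obtain Bt where Bt: "Bt \<ge> 0" "\<forall>p\<in>I \<times> Rn n. \<bar>\<phi>t p\<bar> \<le> Bt"
    using bounded_on_if_compact_support[OF cont C(1,2)] v(1) by blast
  have "\<forall>i. \<exists>B\<ge>0. i < n \<longrightarrow> (\<forall>p\<in>I \<times> Rn n. \<bar>\<phi>1 i p\<bar> \<le> B)"
    using bounded_on_if_compact_support[OF c(1) C(1,2)] v(2) by (metis order_refl)
  then obtain B1 where B1: "\<And>i. B1 i \<ge> 0" "\<And>i p. i < n \<Longrightarrow> p \<in> I \<times> Rn n \<Longrightarrow> \<bar>\<phi>1 i p\<bar> \<le> B1 i"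
    by metis
  have "\<forall>i j. \<exists>B\<ge>0. i < n \<longrightarrow> j < n \<longrightarrow> (\<forall>p\<in>I \<times> Rn n. \<bar>\<phi>2 i j p\<bar> \<le> B)"
    using bounded_on_if_compact_support[OF c(2) C(1,2)] v(3) by (metis order_refl)
  then obtain B2 where B2: "\<And>i j. B2 i j \<ge> 0"
    "\<And>i j p. i < n \<Longrightarrow> j < n \<Longrightarrow> p \<in> I \<times> Rn n \<Longrightarrow> \<bar>\<phi>2 i j p\<bar> \<le> B2 i j"
    by metis
  define S1 where "S1 = (\<Sum>i<n. B1 i)"
  define S2 where "S2 = (\<Sum>i<n. \<Sum>j<n. B2 i j)"
  have S: "S1 \<ge> 0" "S2 \<ge> 0" by (simp_all add: S1_def S2_def B1 B2 sum_nonneg)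
  have "B1 i \<le> S1" if "i < n" for i
    unfolding S1_def using that B1 by (intro member_le_sum) auto
  moreover have "B2 i j \<le> S2" if "i < n" "j < n" for i j
  proof -
    have "B2 i j \<le> (\<Sum>j<n. B2 i j)" using that B2 by (intro member_le_sum) auto
    also have "\<dots> \<le> S2" unfolding S2_def
      using that B2 by (intro member_le_sum[of i _ "\<lambda>i. \<Sum>j<n. B2 i j"]) (auto intro: sum_nonneg)
    finally show ?thesis .
  qed
  ultimately show ?thesis
  proof (intro exI[of _ "Bt + S1 + S2"] conjI ballI allI impI)
    fix p assume p: "p \<in> I \<times> Rn n"
    show "\<bar>\<phi>t p\<bar> \<le> Bt + S1 + S2" using Bt p S by force
  next
    fix p i assume "p \<in> I \<times> Rn n" "i < n" and *: "\<And>i. i < n \<Longrightarrow> B1 i \<le> S1"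
    then show "\<bar>\<phi>1 i p\<bar> \<le> Bt + S1 + S2" using B1(2)[of i p] *[of i] Bt(1) S by linarith
  next
    fix p i j assume "p \<in> I \<times> Rn n" "i < n" "j < n" and *: "\<And>i j. i < n \<Longrightarrow> j < n \<Longrightarrow> B2 i j \<le> S2"
    then show "\<bar>\<phi>2 i j p\<bar> \<le> Bt + S1 + S2" using B2(2)[of i j p] *[of i j] Bt(1) S by linarith
  qed (use Bt S in auto)
qed

text \<open>Two bounds hold for every \<open>y\<close>, with r = |y|. One is the constant 2 B0 + B1,
  from r <= 1 + r^2. The other is (B1 + B2) r^2: the Lipschitz bound of the gradient gives B2 r^2
  for the Taylor remainder, and the denominator in the compensator costs B1 r^2. The claim combines
  them into one multiple of min 1 r^2, the function that Levy measures integrate.\<close>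

lemma second_order_remainder_bound:
  fixes g :: "'h::real_inner \<Rightarrow> real"
  assumes g: "\<And>x. \<bar>g x\<bar> \<le> B0"
    and D: "\<And>x. (g has_derivative (\<lambda>h. h \<bullet> D x)) (at x)" "\<And>x. norm (D x) \<le> B1"
    and H: "\<And>x. (D has_derivative H x) (at x)" "\<And>x h. norm (H x h) \<le> B2 * norm h" and B2: "B2 \<ge> 0"
  shows "\<bar>g (x + y) - g x - (y \<bullet> D x) / (1 + (norm y)\<^sup>2)\<bar> \<le> (2 * B0 + B1 + B2) * min 1 ((norm y)\<^sup>2)"
proof -
  have B: "B0 \<ge> 0" "B1 \<ge> 0"
    using g[of 0] D(2)[of 0] norm_ge_zero[of "D 0"] by linarith+
  define r where "r = norm y"
  have r: "r \<ge> 0" "r / (1 + r\<^sup>2) \<le> 1"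
  proof -
    have "0 \<le> (r - 1 / 2)\<^sup>2" by simp
    then have "r \<le> 1 + r\<^sup>2" by (simp add: power2_eq_square algebra_simps)
    then show "r / (1 + r\<^sup>2) \<le> 1" by (simp add: divide_le_eq add_pos_nonneg)
  qed (simp add: r_def)
  have yD: "\<bar>y \<bullet> D z\<bar> \<le> r * B1" for z
    unfolding r_def using Cauchy_Schwarz_ineq2[of y "D z"] D(2)[of z]
    by (meson mult_left_mono norm_ge_zero order_trans)
  have pos: "0 < 1 + r\<^sup>2" by (simp add: add_pos_nonneg)
  have "\<bar>(y \<bullet> D x) / (1 + r\<^sup>2)\<bar> \<le> r * B1 / (1 + r\<^sup>2)"
    using yD[of x] pos by (simp add: abs_divide divide_right_mono)
  also have "\<dots> \<le> B1"
    using mult_right_mono[OF r(2) B(2)] by simp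
  finally have large: "\<bar>g (x + y) - g x - (y \<bullet> D x) / (1 + r\<^sup>2)\<bar> \<le> 2 * B0 + B1"
    using g[of "x + y"] g[of x] by linarith
  have lip: "norm (D z - D w) \<le> B2 * norm (z - w)" for z w
  proof (rule differentiable_bound[of UNIV D H])
    show "onorm (H v) \<le> B2" if "v \<in> UNIV" for v
      using B2 H(2) by (rule onorm_bound)
  qed (use H in auto)
  have "((\<lambda>s. g (x + s *\<^sub>R y)) has_real_derivative (y \<bullet> D (x + s *\<^sub>R y))) (at s)" for s
  proof -
    have "((\<lambda>s. x + s *\<^sub>R y) has_derivative (\<lambda>s. s *\<^sub>R y)) (at s)"
      by (auto intro!: derivative_eq_intros)
    from diff_chain_at[OF this D(1)] show ?thesis
      by (simp add: o_def has_field_derivative_def mult_commute_abs)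
  qed
  from MVT_unordered[of "\<lambda>s. g (x + s *\<^sub>R y)" "\<lambda>s. y \<bullet> D (x + s *\<^sub>R y)" 0 1, OF this]
  obtain \<xi> where \<xi>: "\<bar>\<xi>\<bar> \<le> 1" "g (x + y) - g x = y \<bullet> D (x + \<xi> *\<^sub>R y)"
    by auto
  have "\<bar>y \<bullet> D (x + \<xi> *\<^sub>R y) - y \<bullet> D x\<bar> \<le> r * norm (D (x + \<xi> *\<^sub>R y) - D x)"
    unfolding inner_diff_right[symmetric] r_def by (rule Cauchy_Schwarz_ineq2)
  also have "\<dots> \<le> r * (B2 * (\<bar>\<xi>\<bar> * r))"
    using lip[of "x + \<xi> *\<^sub>R y" x] r by (intro mult_left_mono) (auto simp: r_def)
  also have "\<dots> = B2 * r\<^sup>2 * \<bar>\<xi>\<bar>"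
    by (simp add: power2_eq_square)
  also have "\<dots> \<le> B2 * r\<^sup>2 * 1"
    using B2 \<xi>(1) by (intro mult_left_mono) (auto simp: r_def)
  finally have 1: "\<bar>y \<bullet> D (x + \<xi> *\<^sub>R y) - y \<bullet> D x\<bar> \<le> B2 * r\<^sup>2" by simp
  \<comment> \<open>The compensator differs from the gradient term by r^2 times the compensator
    itself, which has just been bounded by \<open>B1\<close>.\<close>
  have "y \<bullet> D x - (y \<bullet> D x) / (1 + r\<^sup>2) = (y \<bullet> D x) / (1 + r\<^sup>2) * r\<^sup>2"
    using pos by (simp add: field_simps)
  then have "\<bar>y \<bullet> D x - (y \<bullet> D x) / (1 + r\<^sup>2)\<bar> = \<bar>(y \<bullet> D x) / (1 + r\<^sup>2)\<bar> * r\<^sup>2"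
    by (simp add: abs_mult)
  also have "\<dots> \<le> B1 * r\<^sup>2"
    using \<open>\<bar>(y \<bullet> D x) / (1 + r\<^sup>2)\<bar> \<le> r * B1 / (1 + r\<^sup>2)\<close> \<open>r * B1 / (1 + r\<^sup>2) \<le> B1\<close>
    by (intro mult_right_mono) auto
  finally have small: "\<bar>g (x + y) - g x - (y \<bullet> D x) / (1 + r\<^sup>2)\<bar> \<le> (B1 + B2) * r\<^sup>2"
    unfolding \<xi>(2) using 1 by (simp add: distrib_right)
  have "(2 * B0 + B1 + B2) * min 1 (r\<^sup>2) \<ge> min (2 * B0 + B1) ((B1 + B2) * r\<^sup>2)"
  proof (cases "1 \<le> r\<^sup>2")
    case True
    then show ?thesis using B2 by (simp add: min_def)
  next
    case False
    moreover have "(B1 + B2) * r\<^sup>2 \<le> (2 * B0 + B1 + B2) * r\<^sup>2"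
      using B by (intro mult_right_mono) auto
    ultimately show ?thesis by (simp add: min_def)
  qed
  then show ?thesis
    using large small unfolding r_def[symmetric] by linarith
qed

lemma parabolic_op_bounded:
  fixes K :: "('h::{real_inner, polish_space}) coefficients"
  assumes adm: "admissible K" and I: "is_interval I" "interior I \<noteq> {}" "I \<subseteq> {0..}"
    and f: "f \<in> test_functions K I" and bdd: "bounded_coefficients K (I \<times> M)"
  shows "\<exists>C\<ge>0. \<forall>p\<in>I \<times> M. \<bar>parabolic_op K I f p\<bar> \<le> C"
proof -
  obtain B0 where B0: "B0 \<ge> 0" "\<And>t x. t \<in> I \<Longrightarrow> \<bar>f (t, x)\<bar> \<le> B0"
    using test_functions_bounded[OF f] by blast
  obtain n \<phi> where Cc: "\<phi> \<in> Cc_infinity I n"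
    and f: "\<And>t x. t \<in> I \<Longrightarrow> f (t, x) = \<phi> (t, coords (test K) n x)"
    using f by (auto simp: test_functions_def)
  obtain Cs where \<phi>: "\<forall>k. Ck k I n \<phi>" "compact Cs" "Cs \<subseteq> I \<times> Rn n" "\<forall>p\<in>I \<times> Rn n - Cs. \<phi> p = 0"
    using Cc unfolding Cc_infinity_def by blast
  obtain \<phi>t \<phi>1 \<phi>2 where J: "jets I n \<phi> \<phi>t \<phi>1 \<phi>2" and ct: "continuous_on (I \<times> Rn n) \<phi>t"
    using Ck_jets \<phi> by blast
  obtain B where B: "B \<ge> 0" "\<forall>p\<in>I \<times> Rn n. \<bar>\<phi>t p\<bar> \<le> B \<and> (\<forall>i<n. \<bar>\<phi>1 i p\<bar> \<le> B) \<and> (\<forall>i<n. \<forall>j<n. \<bar>\<phi>2 i j p\<bar> \<le> B)"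
    using jets_bounded[OF I(1,2) J ct \<phi>(2-)] by blast
  then have Bt: "\<And>t x. t \<in> I \<Longrightarrow> \<bar>\<phi>t (t, coords (test K) n x)\<bar> \<le> B"
    and B1: "\<And>i t x. i < n \<Longrightarrow> t \<in> I \<Longrightarrow> \<bar>\<phi>1 i (t, coords (test K) n x)\<bar> \<le> B"
    and B2: "\<And>i j t x. i < n \<Longrightarrow> j < n \<Longrightarrow> t \<in> I \<Longrightarrow> \<bar>\<phi>2 i j (t, coords (test K) n x)\<bar> \<le> B"
    using coords_in_Rn by (metis mem_Sigma_iff)+
  obtain C0 where C0: "\<And>t x. t \<in> I \<Longrightarrow> x \<in> M \<Longrightarrow> onorm (sig K t x) \<le> C0 \<and> norm (drift K t x) \<le> C0 \<and>
      (\<integral>\<^sup>+y. ennreal (min 1 ((norm y)\<^sup>2)) \<partial>jump K t x) \<le> ennreal C0"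
    using bdd unfolding bounded_coefficients_def by blast
  \<comment> \<open>\<open>C0\<close> may be negative if \<open>M\<close> is empty.\<close>
  define C where "C = max 0 C0"
  have "C \<ge> 0" by (simp add: C_def)
  have C: "\<And>t x. t \<in> I \<Longrightarrow> x \<in> M \<Longrightarrow> onorm (sig K t x) \<le> C" "\<And>t x. t \<in> I \<Longrightarrow> x \<in> M \<Longrightarrow> norm (drift K t x) \<le> C"
    using C0 by (fastforce simp: C_def le_max_iff_disj)+
  have Cj: "(\<integral>\<^sup>+y. ennreal (min 1 ((norm y)\<^sup>2)) \<partial>jump K t x) \<le> ennreal C" if "t \<in> I" "x \<in> M" for t x
    using C0[OF that] by (auto simp: C_def intro: order_trans ennreal_leI)
  obtain CA where CA: "\<And>i t x. t \<in> I \<Longrightarrow> x \<in> M \<Longrightarrow> \<bar>x \<bullet> Astar K t (test K i)\<bar> \<le> CA i"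
    using bdd unfolding bounded_coefficients_def by (metis (no_types, lifting) case_prodD mem_Sigma_iff)
  \<comment> \<open>\<open>B * E\<close> bounds the gradient and \<open>B * E * E\<close> the
    Hessian. The summands of \<open>R\<close> belong in turn to the time derivative, the trace, the
    adjoint term, the drift and the jump integral.\<close>
  define E where "E = (\<Sum>i<n. norm (test K i))"
  define R where "R = B + 1 / 2 * (\<Sum>i<n. \<Sum>j<n. B * ((C * norm (test K i)) * (C * norm (test K j)))) +
      (\<Sum>i<n. B * CA i) + (\<Sum>i<n. B * (C * norm (test K i))) + (2 * B0 + B * E + B * E * E) * C"
  have "\<bar>parabolic_op K I f (t, x)\<bar> \<le> R" if t: "t \<in> I" and x: "x \<in> M" for t x
  proof -
    have t0: "t \<ge> 0" using t I by auto
    let ?p = "(t, coords (test K) n x)"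
    note D = cylindrical_derivatives[OF J t f[OF t]]
    have sigK: "\<forall>t\<ge>0. \<forall>x. bounded_linear (sig K t x) \<and> (\<forall>u v. sig K t x u \<bullet> v = u \<bullet> sig K t x v)"
      using adm unfolding admissible_def by (elim conjE)
    have sn: "norm (sig K t x u) \<le> C * norm u" for u
      using onorm[of "sig K t x" u] sigK t0 C(1)[OF t x] mult_right_mono[OF C(1)[OF t x] norm_ge_zero[of u]]
      by (meson order_trans)
    have a1: "\<bar>\<Sum>i<n. \<Sum>j<n. \<phi>2 i j ?p * (sig K t x (sig K t x (test K i)) \<bullet> test K j)\<bar>
        \<le> (\<Sum>i<n. \<Sum>j<n. B * ((C * norm (test K i)) * (C * norm (test K j))))"
    proof (intro order_trans[OF sum_abs] sum_mono)
      fix i j assume ij: "i \<in> {..<n}" "j \<in> {..<n}"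
      have "\<bar>sig K t x (sig K t x (test K i)) \<bullet> test K j\<bar> = \<bar>sig K t x (test K i) \<bullet> sig K t x (test K j)\<bar>"
        using sigK t0 by simp
      also have "\<dots> \<le> norm (sig K t x (test K i)) * norm (sig K t x (test K j))"
        by (rule Cauchy_Schwarz_ineq2)
      also have "\<dots> \<le> (C * norm (test K i)) * (C * norm (test K j))"
        by (intro mult_mono sn mult_nonneg_nonneg \<open>C \<ge> 0\<close>) auto
      finally show "\<bar>\<phi>2 i j ?p * (sig K t x (sig K t x (test K i)) \<bullet> test K j)\<bar>
          \<le> B * ((C * norm (test K i)) * (C * norm (test K j)))"
        unfolding abs_mult using B2[of i j t x] ij t B(1) by (intro mult_mono) auto
    qed
    have a2: "\<bar>\<Sum>i<n. \<phi>1 i ?p * (x \<bullet> Astar K t (test K i))\<bar> \<le> (\<Sum>i<n. B * CA i)"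
      using B1 CA t x B(1)
      by (intro order_trans[OF sum_abs] sum_mono) (simp add: abs_mult mult_mono)
    have a3: "\<bar>\<Sum>i<n. \<phi>1 i ?p * (drift K t x \<bullet> test K i)\<bar> \<le> (\<Sum>i<n. B * (C * norm (test K i)))"
    proof (intro order_trans[OF sum_abs] sum_mono)
      fix i assume "i \<in> {..<n}"
      moreover have "\<bar>drift K t x \<bullet> test K i\<bar> \<le> C * norm (test K i)"
        using Cauchy_Schwarz_ineq2[of "drift K t x" "test K i"]
          mult_right_mono[OF C(2)[OF t x] norm_ge_zero[of "test K i"]] by linarith
      ultimately show "\<bar>\<phi>1 i ?p * (drift K t x \<bullet> test K i)\<bar> \<le> B * (C * norm (test K i))"
        unfolding abs_mult using B1[of i t x] t B(1) by (intro mult_mono) auto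
    qed
    define g where "g y = f (t, x + y) - f (t, x) - (y \<bullet> grad (\<lambda>y. f (t, y)) x) / (1 + (norm y)\<^sup>2)" for y
    have "\<bar>g y\<bar> \<le> (2 * B0 + B * E + B * E * E) * min 1 ((norm y)\<^sup>2)" for y
      unfolding g_def D(2)
    proof (rule second_order_remainder_bound[where g = "\<lambda>y. f (t, y)", OF B0(2)[OF t] D(1) _ D(3)[unfolded D(2)[abs_def]]])
      show "0 \<le> B * E * E"
        using B(1) by (simp add: E_def sum_nonneg)
      show "norm (\<Sum>i<n. \<phi>1 i (t, coords (test K) n v) *\<^sub>R test K i) \<le> B * E" for v
        unfolding E_def sum_distrib_left using B1[OF _ t]
        by (intro order_trans[OF norm_sum] sum_mono) (simp add: mult_right_mono)
      show "norm (\<Sum>i<n. (\<Sum>j<n. \<phi>2 i j (t, coords (test K) n v) * (h \<bullet> test K j)) *\<^sub>R test K i)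
          \<le> B * E * E * norm h" for v h
      proof -
        have "\<bar>\<Sum>j<n. \<phi>2 i j (t, coords (test K) n v) * (h \<bullet> test K j)\<bar> \<le> B * E * norm h" if "i < n" for i
        proof -
          have "\<bar>\<phi>2 i j (t, coords (test K) n v) * (h \<bullet> test K j)\<bar> \<le> B * (norm h * norm (test K j))" if "j < n" for j
            unfolding abs_mult using B2[OF \<open>i < n\<close> that t] B(1) by (intro mult_mono Cauchy_Schwarz_ineq2) auto
          then have "\<bar>\<Sum>j<n. \<phi>2 i j (t, coords (test K) n v) * (h \<bullet> test K j)\<bar>
              \<le> (\<Sum>j<n. B * (norm h * norm (test K j)))"
            by (intro order_trans[OF sum_abs] sum_mono) simp
          also have "\<dots> = B * E * norm h"
            by (simp add: E_def sum_distrib_left sum_distrib_right mult_ac)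
          finally show ?thesis .
        qed
        then have "norm (\<Sum>i<n. (\<Sum>j<n. \<phi>2 i j (t, coords (test K) n v) * (h \<bullet> test K j)) *\<^sub>R test K i)
            \<le> (\<Sum>i<n. (B * E * norm h) * norm (test K i))"
          by (intro order_trans[OF norm_sum] sum_mono) (simp add: mult_right_mono)
        also have "\<dots> = B * E * E * norm h"
          by (simp add: E_def sum_distrib_left sum_distrib_right mult_ac)
        finally show ?thesis .
      qed
    qed
    moreover have coef: "0 \<le> 2 * B0 + B * E + B * E * E"
      using B0 B by (auto simp: E_def sum_nonneg intro!: add_nonneg_nonneg mult_nonneg_nonneg)
    ultimately have gle: "ennreal \<bar>g y\<bar> \<le> ennreal (2 * B0 + B * E + B * E * E) * ennreal (min 1 ((norm y)\<^sup>2))" for y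
      by (subst ennreal_mult[symmetric]) (auto intro: ennreal_leI)
    have "\<forall>t\<ge>0. \<forall>x. levy_measure (jump K t x)"
      using adm unfolding admissible_def by (elim conjE)
    then have sets: "sets (jump K t x) = sets borel"
      using t0 by (simp add: levy_measure_def)
    have meas: "(\<lambda>y. ennreal (min 1 ((norm y)\<^sup>2))) \<in> borel_measurable (jump K t x)"
      unfolding measurable_cong_sets[OF sets refl] by measurable
    have "(\<integral>\<^sup>+y. ennreal \<bar>g y\<bar> \<partial>jump K t x) \<le>
        (\<integral>\<^sup>+y. ennreal (2 * B0 + B * E + B * E * E) * ennreal (min 1 ((norm y)\<^sup>2)) \<partial>jump K t x)"
      by (intro nn_integral_mono gle)
    also have "\<dots> = ennreal (2 * B0 + B * E + B * E * E) * (\<integral>\<^sup>+y. ennreal (min 1 ((norm y)\<^sup>2)) \<partial>jump K t x)"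
      by (rule nn_integral_cmult[OF meas])
    also have "\<dots> \<le> ennreal (2 * B0 + B * E + B * E * E) * ennreal C"
      by (intro mult_left_mono Cj t x) simp
    also have "\<dots> = ennreal ((2 * B0 + B * E + B * E * E) * C)"
      using coef \<open>C \<ge> 0\<close> by (simp add: ennreal_mult)
    finally have nn: "(\<integral>\<^sup>+y. ennreal \<bar>g y\<bar> \<partial>jump K t x) \<le> ennreal ((2 * B0 + B * E + B * E * E) * C)" .
    \<comment> \<open>Where \<open>g\<close> is not integrable, its Bochner integral is 0 by
      convention and obeys the same bound.\<close>
    have a4: "\<bar>\<integral>y. g y \<partial>jump K t x\<bar> \<le> (2 * B0 + B * E + B * E * E) * C"
    proof (cases "integrable (jump K t x) g")
      case True
      from integral_norm_bound_ennreal[OF this] nn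
      have "ennreal \<bar>\<integral>y. g y \<partial>jump K t x\<bar> \<le> ennreal ((2 * B0 + B * E + B * E * E) * C)"
        by simp
      then show ?thesis
        using coef \<open>C \<ge> 0\<close> by (subst (asm) ennreal_le_iff) auto
    next
      case False
      then show ?thesis using coef \<open>C \<ge> 0\<close> by (simp add: not_integrable_integral_eq)
    qed
    have "parabolic_op K I f (t, x) = \<phi>t ?p +
        1 / 2 * (\<Sum>i<n. \<Sum>j<n. \<phi>2 i j ?p * (sig K t x (sig K t x (test K i)) \<bullet> test K j)) +
        (\<Sum>i<n. \<phi>1 i ?p * (x \<bullet> Astar K t (test K i))) +
        (\<Sum>i<n. \<phi>1 i ?p * (drift K t x \<bullet> test K i)) + (\<integral>y. g y \<partial>jump K t x)"
      using parabolic_op_eq[OF adm I J t f, of x] by (simp add: jet_sum_def g_def)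
    then show ?thesis
      unfolding R_def using Bt[OF t, of x] a1 a2 a3 a4 by linarith
  qed
  then show ?thesis
    by (intro exI[of _ "max 0 R"]) (auto simp: le_max_iff_disj)
qed

section \<open>Laws and filtrations of a Markov process\<close>

lemma state_space_generator:
  "insert {None} ((\<lambda>B. Some ` B) ` sets (restrict_space borel S)) \<subseteq> Pow (insert None (Some ` S))"
  using sets.sets_into_space[of _ "restrict_space borel S"] by (force simp: space_restrict_space)

lemma space_state_space: "space (state_space S) = insert None (Some ` S)"
  unfolding state_space_def by (rule space_measure_of[OF state_space_generator])

lemma sets_state_space_Some: "B \<in> sets (restrict_space borel S) \<Longrightarrow> Some ` B \<in> sets (state_space S)"
  unfolding state_space_def sets_measure_of[OF state_space_generator] by auto

lemma sets_state_space_None: "{None} \<in> sets (state_space S)"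
  unfolding state_space_def sets_measure_of[OF state_space_generator] by auto

lemma sets_state_space_singleton:
  fixes S :: "'s::t1_space set"
  assumes "x \<in> insert None (Some ` S)"
  shows "{x} \<in> sets (state_space S)"
proof (cases x)
  case None
  then show ?thesis by (simp add: sets_state_space_None)
next
  case (Some y)
  then have "{y} = S \<inter> {y}" using assms by auto
  then have "{y} \<in> sets (restrict_space borel S)"
    unfolding sets_restrict_space by auto
  from sets_state_space_Some[OF this] Some show ?thesis by simp
qed

lemma measurable_ext0:
  assumes g: "g \<in> borel_measurable (restrict_space borel S)"
  shows "ext0 g \<in> borel_measurable (state_space S)"
proof (rule measurableI)
  fix B :: "'b set" assume B: "B \<in> sets borel"
  have "g -` B \<inter> space (restrict_space borel S) \<in> sets (restrict_space borel S)"
    by (rule measurable_sets[OF g B])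
  then have "Some ` (g -` B \<inter> S) \<in> sets (state_space S)"
    using sets_state_space_Some by (auto simp: space_restrict_space)
  moreover have "ext0 g -` B \<inter> space (state_space S) =
      Some ` (g -` B \<inter> S) \<union> (if 0 \<in> B then {None} else {})"
    by (auto simp: space_state_space ext0_def)
  moreover have "(if 0 \<in> B then {None} else {}) \<in> sets (state_space S)"
    by (simp add: sets_state_space_None)
  ultimately show "ext0 g -` B \<inter> space (state_space S) \<in> sets (state_space S)"
    by (simp only: sets.Un)
qed simp

lemma natural_generator:
  "{pos Z s -` B \<inter> paths Z | s B. s \<in> T \<and> B \<in> sets (state_space S)} \<subseteq> Pow (paths Z)"
  by auto

lemma space_natural: "space (natural S Z T) = paths Z"
  unfolding natural_def by (rule space_measure_of[OF natural_generator])

lemma sets_natural_mono: "T \<subseteq> T' \<Longrightarrow> sets (natural S Z T) \<subseteq> sets (natural S Z T')"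
  unfolding natural_def sets_measure_of[OF natural_generator]
  by (rule sigma_sets_mono') auto

locale markov =
  fixes S :: "'s::metric_space set" and Z :: "('w, 's) process"
  assumes mk: "markov_process S Z"
begin

lemma pos_state: "\<omega> \<in> paths Z \<Longrightarrow> t \<ge> 0 \<Longrightarrow> pos Z t \<omega> \<in> insert None (Some ` S)"
  using mk unfolding markov_process_def by (elim conjE) blast

lemma pos_dead: "\<omega> \<in> paths Z \<Longrightarrow> t \<ge> 0 \<Longrightarrow> lifetime Z \<omega> \<le> ereal t \<Longrightarrow> pos Z t \<omega> = None"
  using mk unfolding markov_process_def by (elim conjE) blast

lemma pos_shift: "\<omega> \<in> paths Z \<Longrightarrow> t \<ge> 0 \<Longrightarrow> s \<ge> 0 \<Longrightarrow> pos Z s (shift Z t \<omega>) = pos Z (s + t) \<omega>"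
  using mk unfolding markov_process_def by (elim conjE) blast

lemma lifetime_le: "t \<ge> 0 \<Longrightarrow> pos Z t \<omega> = None \<Longrightarrow> lifetime Z \<omega> \<le> ereal t"
  unfolding lifetime_def by (rule Inf_lower) auto

lemma lifetime_nonneg: "lifetime Z \<omega> \<ge> 0"
  unfolding lifetime_def by (rule Inf_greatest) auto

lemma pos_alive:
  assumes "\<omega> \<in> paths Z" "t \<ge> 0" "ereal t < lifetime Z \<omega>"
  shows "\<exists>y\<in>S. pos Z t \<omega> = Some y"
  using pos_state[OF assms(1,2)] lifetime_le[OF assms(2)] assms(3) by (metis imageE insertE not_le)

lemma measurable_pos:
  assumes "t \<in> T" "t \<ge> 0"
  shows "pos Z t \<in> measurable (natural S Z T) (state_space S)"
proof (rule measurableI)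
  show "pos Z t \<omega> \<in> space (state_space S)" if "\<omega> \<in> space (natural S Z T)" for \<omega>
    using that assms pos_state by (simp add: space_natural space_state_space)
  show "pos Z t -` B \<inter> space (natural S Z T) \<in> sets (natural S Z T)" if "B \<in> sets (state_space S)" for B
    using that assms unfolding space_natural
    unfolding natural_def sets_measure_of[OF natural_generator] by (intro sigma_sets.Basic) blast
qed

section \<open>Point masses as initial laws, and the augmented filtration\<close>

lemma return_initial:
  assumes "x \<in> insert None (Some ` S)"
  shows "return (state_space S) x \<in> initial_laws S"
  using assms prob_space_return[of x "state_space S"] by (simp add: initial_laws_def space_state_space)

lemma law_measurable:
  assumes "\<mu> \<in> initial_laws S"
  shows "law Z \<in> measurable (completion \<mu>) (prob_algebra (natural S Z {0..}))"
  using mk assms unfolding markov_process_def by (elim conjE) blast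

lemma law_props:
  assumes x: "x \<in> insert None (Some ` S)"
  shows "prob_space (law Z x)" "sets (law Z x) = sets (natural S Z {0..})" "space (law Z x) = paths Z"
proof -
  have "x \<in> space (completion (return (state_space S) x))"
    using x by (simp add: space_state_space)
  from measurable_space[OF law_measurable[OF return_initial[OF x]] this]
  show "prob_space (law Z x)" and s: "sets (law Z x) = sets (natural S Z {0..})"
    by (auto simp: space_prob_algebra)
  show "space (law Z x) = paths Z"
    using sets_eq_imp_space_eq[OF s] by (simp add: space_natural)
qed

text \<open>Singletons of the extended state space are measurable, so a point mass sees the kernel
  at \<open>x\<close> only. This identifies the member of the family of initial laws whose null sets
  are those of a single \<open>law Z x\<close>.\<close>

lemma law_from_return:
  assumes x: "x \<in> insert None (Some ` S)"
  shows "law_from Z (return (state_space S) x) = law Z x"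
proof -
  let ?\<mu> = "return (state_space S) x"
  have k: "law Z \<in> measurable (completion ?\<mu>) (subprob_algebra (natural S Z {0..}))"
    using law_measurable[OF return_initial[OF x]] by (rule measurable_prob_algebraD)
  have ne: "space (completion ?\<mu>) \<noteq> {}"
    by (simp add: space_state_space)
  interpret prob_space ?\<mu>
    using x by (intro prob_space_return) (simp add: space_state_space)
  interpret c: prob_space "completion ?\<mu>"
    by (rule prob_space_completion)
  have "{y \<in> space (state_space S). y = x} = {x}"
    using x unfolding space_state_space by blast
  then have "Measurable.pred (state_space S) (\<lambda>y. y = x)"
    unfolding pred_def using sets_state_space_singleton[OF x] by simp
  then have "AE y in ?\<mu>. y = x"
    using AE_return[of x "state_space S" "\<lambda>y. y = x"] x unfolding space_state_space by blast
  then have ae: "AE y in completion ?\<mu>. y = x"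
    by (rule AE_completion)
  show ?thesis
    unfolding law_from_def
  proof (rule measure_eqI)
    show s: "sets (completion ?\<mu> \<bind> law Z) = sets (law Z x)"
      using sets_bind[OF sets_kernel[OF k] ne] law_props(2)[OF x] by simp
    fix A assume "A \<in> sets (completion ?\<mu> \<bind> law Z)"
    then have A: "A \<in> sets (natural S Z {0..})"
      using s law_props(2)[OF x] by simp
    have "emeasure (completion ?\<mu> \<bind> law Z) A = (\<integral>\<^sup>+y. emeasure (law Z y) A \<partial>completion ?\<mu>)"
      by (rule emeasure_bind[OF ne k A])
    also have "\<dots> = (\<integral>\<^sup>+y. emeasure (law Z x) A \<partial>completion ?\<mu>)"
      using ae by (intro nn_integral_cong_AE) auto
    also have "\<dots> = emeasure (law Z x) A"
      using c.emeasure_space_1 by simp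
    finally show "emeasure (completion ?\<mu> \<bind> law Z) A = emeasure (law Z x) A" .
  qed
qed

text \<open>The point mass at \<open>x\<close> is one of the laws over which the augmentation
  intersects, so every augmented set is measurable for the completion of
  \<open>law Z x\<close>.\<close>

lemma augmented_subalgebra:
  assumes x: "x \<in> insert None (Some ` S)"
  shows "subalgebra (completion (law Z x)) (augmented S Z t)"
    and "sets (natural S Z {0..t}) \<subseteq> sets (augmented S Z t)"
    and "space (augmented S Z t) = paths Z"
proof -
  let ?H = "\<lambda>\<mu>. sigma_sets (paths Z)
      (sets (natural S Z {0..t}) \<union> null_sets (completion (law_from Z \<mu>)))"
  note \<mu> = return_initial[OF x]
  note P = law_props[OF x]
  have sub: "sets (natural S Z {0..t}) \<subseteq> sets (law Z x)"
    unfolding P(2) by (rule sets_natural_mono) auto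
  have "sigma_sets (space (completion (law Z x)))
      (sets (natural S Z {0..t}) \<union> null_sets (completion (law Z x))) \<subseteq> sets (completion (law Z x))"
    using sub by (intro sets.sigma_sets_subset) auto
  then have "?H (return (state_space S) x) \<subseteq> sets (completion (law Z x))"
    using law_from_return[OF x] P(3) by simp
  then have *: "(\<Inter>\<mu>\<in>initial_laws S. ?H \<mu>) \<subseteq> sets (completion (law Z x))"
    using \<mu> by blast
  have pow: "(\<Inter>\<mu>\<in>initial_laws S. ?H \<mu>) \<subseteq> Pow (paths Z)"
    using * sets.space_closed[of "completion (law Z x)"] P(3) by auto
  show sp: "space (augmented S Z t) = paths Z"
    unfolding augmented_def by (rule space_measure_of[OF pow])
  have "sigma_sets (space (completion (law Z x))) (\<Inter>\<mu>\<in>initial_laws S. ?H \<mu>) \<subseteq> sets (completion (law Z x))"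
    using * by (intro sets.sigma_sets_subset) auto
  then have "sets (augmented S Z t) \<subseteq> sets (completion (law Z x))"
    unfolding augmented_def sets_measure_of[OF pow] using P(3) by simp
  then show "subalgebra (completion (law Z x)) (augmented S Z t)"
    using sp P(3) by (simp add: subalgebra_def)
  show "sets (natural S Z {0..t}) \<subseteq> sets (augmented S Z t)"
    unfolding augmented_def sets_measure_of[OF pow] by auto
qed

text \<open>The integrand without discount is at most \<open>C\<close>, also at the cemetery where
  it is 0, so the resolvent is at most C / \<alpha>.\<close>

lemma finite_resolvent_of_bounded:
  assumes x: "x \<in> S" and C: "\<And>y. y \<in> S \<Longrightarrow> g y \<le> ennreal C" and "C \<ge> 0" "\<alpha> > 0"
  shows "resolvent Z \<alpha> g x < \<infinity>"
proof -
  interpret prob_space "law Z (Some x)"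
    using law_props(1) x by auto
  interpret c: prob_space "completion (law Z (Some x))"
    by (rule prob_space_completion)
  have sp: "space (law Z (Some x)) = paths Z"
    using law_props(3)[of "Some x"] x by simp
  have "ennreal (exp (- \<alpha> * t)) * ext0 g (pos Z t \<omega>) * indicator {0..} t \<le>
      ennreal (C * exp (- \<alpha> * t)) * indicator {0..} t" if "\<omega> \<in> paths Z" for \<omega> t
  proof (cases "t \<ge> 0")
    case True
    then have "ext0 g (pos Z t \<omega>) \<le> ennreal C"
      using pos_state[OF that True] C by (auto simp: ext0_def)
    then have "ennreal (exp (- \<alpha> * t)) * ext0 g (pos Z t \<omega>) \<le> ennreal (exp (- \<alpha> * t)) * ennreal C"
      by (rule mult_left_mono) simp
    then show ?thesis using True \<open>C \<ge> 0\<close> by (simp add: ennreal_mult[symmetric] mult.commute)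
  qed simp
  then have "resolvent Z \<alpha> g x \<le>
      (\<integral>\<^sup>+\<omega>. (\<integral>\<^sup>+t\<in>{0..}. ennreal (C * exp (- \<alpha> * t)) \<partial>lborel) \<partial>completion (law Z (Some x)))"
    unfolding resolvent_def by (intro nn_integral_mono) (simp add: sp)
  also have "\<dots> = (\<integral>\<^sup>+t\<in>{0..}. ennreal (C * exp (- \<alpha> * t)) \<partial>lborel)"
    using c.emeasure_space_1 by simp
  also have "\<dots> = ennreal (0 - (- C / \<alpha> * exp (- \<alpha> * 0)))"
  proof (rule nn_integral_FTC_atLeast)
    show "((\<lambda>t. - C / \<alpha> * exp (- \<alpha> * t)) has_real_derivative C * exp (- \<alpha> * t)) (at t)" for t
      using \<open>\<alpha> > 0\<close> by (auto intro!: derivative_eq_intros)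
    have "((\<lambda>t. exp (- (\<alpha> * t))) \<longlongrightarrow> 0) at_top"
      using \<open>\<alpha> > 0\<close>
      by (intro filterlim_compose[OF exp_at_bot])
        (simp add: filterlim_uminus_at_bot filterlim_tendsto_pos_mult_at_top[OF tendsto_const _ filterlim_ident])
    from tendsto_mult_right_zero[OF this, of "- C / \<alpha>"]
    show "((\<lambda>t. - C / \<alpha> * exp (- \<alpha> * t)) \<longlongrightarrow> 0) at_top" by simp
  qed (use \<open>C \<ge> 0\<close> in auto)
  finally show ?thesis
    by (simp add: order_le_less_trans)
qed

end

section \<open>Quartic variation of a path\<close>

text \<open>Separate the left limit from the value by a rational level \<open>a\<close>, and choose
  a rational \<open>p\<close> such that \<open>u\<close> stays below \<open>a\<close> between
  \<open>p\<close> and \<open>r\<close>. The pair determines \<open>r\<close>: of two such times the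
  earlier one would lie in the interval of the later one, yet its value exceeds
  \<open>a\<close>.\<close>

lemma countable_left_jumps_up:
  fixes u :: "real \<Rightarrow> real"
  shows "countable {r. \<exists>l. (u \<longlongrightarrow> l) (at_left r) \<and> l < u r}"
proof -
  define Q where "Q a p = {r. p < r \<and> (\<forall>s. p < s \<and> s < r \<longrightarrow> u s < a) \<and> a < u r}" for a p :: real
  have "countable (Q a p)" for a p
  proof -
    have "r = r'" if "r \<in> Q a p" "r' \<in> Q a p" for r r'
      using that by (cases r r' rule: linorder_cases) (force simp: Q_def)+
    then have "Q a p \<subseteq> {SOME r. r \<in> Q a p}"
      by (metis singletonI someI subsetI)
    then show ?thesis
      using countable_subset by blast
  qed
  moreover have "{r. \<exists>l. (u \<longlongrightarrow> l) (at_left r) \<and> l < u r} \<subseteq> (\<Union>a\<in>\<rat>. \<Union>p\<in>\<rat>. Q a p)"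
  proof safe
    fix r l assume l: "(u \<longlongrightarrow> l) (at_left r)" "l < u r"
    obtain a where a: "a \<in> \<rat>" "l < a" "a < u r"
      using Rats_dense_in_real[OF l(2)] by blast
    have "eventually (\<lambda>s. u s < a) (at_left r)"
      using order_tendstoD(2)[OF l(1) a(2)] .
    then obtain b where b: "b < r" "\<And>s. b < s \<Longrightarrow> s < r \<Longrightarrow> u s < a"
      using eventually_at_left[of "r - 1" r] by auto
    obtain p where "p \<in> \<rat>" "b < p" "p < r"
      using Rats_dense_in_real[OF b(1)] by blast
    then show "r \<in> (\<Union>a\<in>\<rat>. \<Union>p\<in>\<rat>. Q a p)"
      using a b by (intro UN_I[of a] UN_I[of p]) (auto simp: Q_def)
  qed
  ultimately show ?thesis
    by (meson countable_UN countable_rat countable_subset)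
qed

lemma countable_left_jumps:
  fixes u :: "real \<Rightarrow> real"
  shows "countable {r. \<exists>l. (u \<longlongrightarrow> l) (at_left r) \<and> l \<noteq> u r}"
proof -
  have "{r. \<exists>l. (u \<longlongrightarrow> l) (at_left r) \<and> l \<noteq> u r} \<subseteq>
      {r. \<exists>l. (u \<longlongrightarrow> l) (at_left r) \<and> l < u r} \<union>
      {r. \<exists>l. ((\<lambda>s. - u s) \<longlongrightarrow> l) (at_left r) \<and> l < - u r}"
    using tendsto_minus by (force simp: neq_iff)
  then show ?thesis
    using countable_left_jumps_up[of u] countable_left_jumps_up[of "\<lambda>s. - u s"]
    by (meson countable_Un countable_subset)
qed

text \<open>The sequence may hit \<open>s\<close> itself, a point about which the filter
  \<open>at_right s\<close> says nothing.\<close>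

lemma tendsto_from_right:
  fixes u :: "real \<Rightarrow> 'a::metric_space"
  assumes u: "(u \<longlongrightarrow> u s) (at_right s)" and x: "x \<longlonglongrightarrow> s" "\<And>n. x n \<ge> s"
  shows "(\<lambda>n. u (x n)) \<longlonglongrightarrow> u s"
proof (rule tendstoI)
  fix e :: real assume "e > 0"
  then have "eventually (\<lambda>y. dist (u y) (u s) < e) (at_right s)"
    using u tendstoD by blast
  then obtain b where b: "b > s" "\<And>y. s < y \<Longrightarrow> y < b \<Longrightarrow> dist (u y) (u s) < e"
    using eventually_at_right[of s "s + 1"] by auto
  have "eventually (\<lambda>n. x n < b) sequentially"
    using order_tendstoD(2)[OF x(1) b(1)] .
  then show "eventually (\<lambda>n. dist (u (x n)) (u s) < e) sequentially"
  proof eventually_elim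
    case (elim n)
    then show ?case
      using x(2)[of n] b(2)[of "x n"] \<open>e > 0\<close> by (cases "x n = s") auto
  qed
qed

lemma tendsto_from_left:
  fixes u :: "real \<Rightarrow> 'a::metric_space"
  assumes u: "(u \<longlongrightarrow> u s) (at_left s)" and x: "x \<longlonglongrightarrow> s" "\<And>n. x n \<le> s"
  shows "(\<lambda>n. u (x n)) \<longlonglongrightarrow> u s"
proof -
  have "((\<lambda>y. u (- y)) \<longlongrightarrow> u (- (- s))) (at_right (- s))"
    using u filterlim_at_left_to_right[of u "nhds (u s)" s] by simp
  from tendsto_from_right[of "\<lambda>y. u (- y)" "- s", OF this, of "\<lambda>n. - x n"]
  show ?thesis using x tendsto_minus[OF x(1)] by simp
qed

definition grid :: "real \<Rightarrow> real \<Rightarrow> nat \<Rightarrow> nat \<Rightarrow> real" where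
  "grid q T m i = q + real i * ((T - q) / real m)"

text \<open>The half-open intervals are disjoint, so at most one summand survives; its index is the
  number of whole steps between \<open>q\<close> and \<open>r\<close>.\<close>

lemma step_sum:
  fixes c :: "nat \<Rightarrow> real"
  assumes \<delta>: "\<delta> > 0"
  shows "(\<Sum>i<m. indicator {q + real i * \<delta>..<q + real (Suc i) * \<delta>} r * c i) =
    (if q \<le> r \<and> r < q + real m * \<delta> then c (nat \<lfloor>(r - q) / \<delta>\<rfloor>) else 0)"
proof (induction m)
  case 0
  then show ?case by simp
next
  case (Suc m)
  have \<open>q \<le> q + real m * \<delta>\<close> \<open>q + real m * \<delta> < q + real (Suc m) * \<delta>\<close>
    using \<delta> by auto
  moreover have "nat \<lfloor>(r - q) / \<delta>\<rfloor> = m" if "q + real m * \<delta> \<le> r" "r < q + real (Suc m) * \<delta>"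
  proof -
    have "\<lfloor>(r - q) / \<delta>\<rfloor> = int m"
      using that \<delta> by (intro floor_unique) (auto simp: field_simps)
    then show ?thesis by simp
  qed
  ultimately show ?case
    using Suc by (auto simp: indicator_def)
qed

text \<open>Open on the left, unlike in \<open>step_sum\<close>: the left grid point has to lie
  strictly before \<open>s\<close> in order to see the left limit there.\<close>

lemma grid_interval:
  assumes "q < s" "s \<le> q + real m * \<delta>"
  shows "\<exists>i<m. q + real i * \<delta> < s \<and> s \<le> q + real (Suc i) * \<delta>"
  using assms
proof (induction m)
  case (Suc m)
  then show ?case
    by (cases "s \<le> q + real m * \<delta>") (auto simp: less_Suc_eq)
qed simp

section \<open>Occupation of a set of times\<close>

text \<open>The times up to which \<open>B\<close> has measure 0 form an initial segment. Below its
  supremum they are covered by the rational times \<open>R\<close> in it, up to each of which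
  \<open>B\<close> is null; what remains is at most one point, \<open>L\<close>. Thus, as long as
  \<open>B\<close> has taken no time, almost every time lies outside \<open>B\<close>, and the
  cancellation is available there.\<close>

lemma last_null_time_null:
  fixes B :: "real set"
  assumes B: "B \<in> sets borel"
  shows "AE r in lborel. r \<in> B \<longrightarrow> q \<le> r \<longrightarrow> emeasure lborel (B \<inter> {q..r}) \<noteq> 0"
proof -
  define null where "null r \<longleftrightarrow> emeasure lborel (B \<inter> {q..r}) = 0" for r
  have null_mono: "null r" if "null r'" "r \<le> r'" for r r'
  proof -
    have "emeasure lborel (B \<inter> {q..r}) \<le> emeasure lborel (B \<inter> {q..r'})"
      using that(2) B by (intro emeasure_mono) auto
    then show ?thesis using that(1) by (simp add: null_def)
  qed
  define R where "R = {c \<in> \<rat>. null c}"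
  define L where "L = {r. null r \<and> (\<forall>c\<in>R. c \<le> r)}"
  have "r = r'" if "r \<in> L" "r' \<in> L" for r r'
  proof (rule ccontr)
    assume "r \<noteq> r'"
    then have "min r r' < max r r'" by auto
    then obtain c where c: "c \<in> \<rat>" "min r r' < c" "c < max r r'"
      using Rats_dense_in_real by blast
    have "null (max r r')" using that by (auto simp: L_def max_def)
    then have "null c" using c by (intro null_mono[of "max r r'" c]) auto
    then have "c \<in> R" using c by (simp add: R_def)
    then have "c \<le> r \<and> c \<le> r'" using that by (simp add: L_def)
    then show False using c by linarith
  qed
  then have "L \<subseteq> {SOME r. r \<in> L}"
    by (metis singletonI someI subsetI)
  then have "countable L"
    using countable_subset by blast
  have "countable R"
    unfolding R_def by (rule countable_subset[OF _ countable_rat]) auto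
  then have "(\<Union>c\<in>R. B \<inter> {q..c}) \<in> null_sets lborel"
    using B by (intro null_sets_UN') (auto simp: R_def null_def null_setsI)
  moreover have "L \<in> null_sets lborel"
    by (rule countable_imp_null_set_lborel[OF \<open>countable L\<close>])
  ultimately have "(\<Union>c\<in>R. B \<inter> {q..c}) \<union> L \<in> null_sets lborel"
    by (rule null_sets.Un)
  then show ?thesis
  proof (rule AE_I')
    show "{r \<in> space lborel. \<not> (r \<in> B \<longrightarrow> q \<le> r \<longrightarrow> emeasure lborel (B \<inter> {q..r}) \<noteq> 0)}
        \<subseteq> (\<Union>c\<in>R. B \<inter> {q..c}) \<union> L"
    proof
      fix r assume "r \<in> {r \<in> space lborel. \<not> (r \<in> B \<longrightarrow> q \<le> r \<longrightarrow> emeasure lborel (B \<inter> {q..r}) \<noteq> 0)}"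
      then have r: "r \<in> B" "q \<le> r" "null r" by (auto simp: null_def)
      show "r \<in> (\<Union>c\<in>R. B \<inter> {q..c}) \<union> L"
      proof (cases "r \<in> L")
        case False
        then obtain c where "c \<in> R" "r < c"
          using r by (auto simp: L_def not_le)
        then show ?thesis
          using r by (intro UnI1 UN_I[of c]) auto
      qed simp
    qed
  qed
qed

text \<open>Continuity of the measure from below, up to the single point \<open>r\<close>. It says
  that the indicator of having spent no time in \<open>B\<close> is left continuous where it is
  0.\<close>

lemma positive_measure_before:
  fixes B :: "real set"
  assumes B: "B \<in> sets borel" and pos: "emeasure lborel (B \<inter> {q..r}) \<noteq> 0"
  shows "\<exists>r'<r. emeasure lborel (B \<inter> {q..r'}) \<noteq> 0"
proof (rule ccontr)
  assume *: "\<not> (\<exists>r'<r. emeasure lborel (B \<inter> {q..r'}) \<noteq> 0)"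
  have "(\<Union>n. B \<inter> {q..r - inverse (real (Suc n))}) \<in> null_sets lborel"
    using B * by (intro null_sets_UN) (auto simp: null_setsI)
  moreover have "{r} \<in> null_sets lborel"
    by (rule countable_imp_null_set_lborel) simp
  ultimately have N: "(\<Union>n. B \<inter> {q..r - inverse (real (Suc n))}) \<union> {r} \<in> null_sets lborel"
    by (rule null_sets.Un)
  have "B \<inter> {q..r} \<subseteq> (\<Union>n. B \<inter> {q..r - inverse (real (Suc n))}) \<union> {r}"
  proof
    fix s assume s: "s \<in> B \<inter> {q..r}"
    show "s \<in> (\<Union>n. B \<inter> {q..r - inverse (real (Suc n))}) \<union> {r}"
    proof (cases "s = r")
      case False
      then obtain n where "inverse (real (Suc n)) < r - s"
        using s reals_Archimedean[of "r - s"] by auto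
      then show ?thesis using s by (intro UnI1 UN_I[of n]) auto
    qed simp
  qed
  then have "emeasure lborel (B \<inter> {q..r}) \<le> emeasure lborel ((\<Union>n. B \<inter> {q..r - inverse (real (Suc n))}) \<union> {r})"
    using N by (intro emeasure_mono) auto
  then show False
    using pos N by auto
qed

text \<open>The fourth power of an increment, expanded in the powers of \<open>f\<close>: \<open>\<gamma> k\<close> plays the role of
  \<open>L (f ^ k)\<close> along a path, and the constant terms cancel.\<close>

definition quartic :: "(nat \<Rightarrow> real) \<Rightarrow> real \<Rightarrow> real" where
  "quartic \<gamma> c = \<gamma> 4 - 4 * c * \<gamma> 3 + 6 * c\<^sup>2 * \<gamma> 2 - 4 * c ^ 3 * \<gamma> 1"

lemma abs_quartic_le:
  assumes "\<bar>c\<bar> \<le> b"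
  shows "\<bar>quartic \<gamma> c\<bar> \<le> (1 + 4 * b + 6 * b\<^sup>2 + 4 * b ^ 3) * (\<Sum>k=1..4. \<bar>\<gamma> k\<bar>)"
proof -
  have b: "b \<ge> 0" using assms by simp
  have le: "\<bar>\<gamma> k\<bar> \<le> (\<Sum>k=1..4. \<bar>\<gamma> k\<bar>)" if "k \<in> {1..4}" for k
    using that by (intro member_le_sum) auto
  have c2: "c\<^sup>2 \<le> b\<^sup>2" "\<bar>c ^ 3\<bar> \<le> b ^ 3"
    using assms b power_mono[OF assms, of 2] power_mono[OF assms, of 3] by (auto simp: power_abs)
  have "\<bar>quartic \<gamma> c\<bar> \<le> \<bar>\<gamma> 4\<bar> + 4 * \<bar>c * \<gamma> 3\<bar> + 6 * \<bar>c\<^sup>2 * \<gamma> 2\<bar> + 4 * \<bar>c ^ 3 * \<gamma> 1\<bar>"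
    unfolding quartic_def by linarith
  moreover have "\<bar>c * \<gamma> 3\<bar> \<le> b * (\<Sum>k=1..4. \<bar>\<gamma> k\<bar>)"
    unfolding abs_mult using assms b by (intro mult_mono le) auto
  moreover have "\<bar>c\<^sup>2 * \<gamma> 2\<bar> \<le> b\<^sup>2 * (\<Sum>k=1..4. \<bar>\<gamma> k\<bar>)"
    unfolding abs_mult using c2 b by (intro mult_mono le) auto
  moreover have "\<bar>c ^ 3 * \<gamma> 1\<bar> \<le> b ^ 3 * (\<Sum>k=1..4. \<bar>\<gamma> k\<bar>)"
    unfolding abs_mult using c2 b by (intro mult_mono le) auto
  moreover have "\<bar>\<gamma> 4\<bar> \<le> (\<Sum>k=1..4. \<bar>\<gamma> k\<bar>)"
    by (rule le) simp
  ultimately show ?thesis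
    by (simp add: distrib_right)
qed

text \<open>The subtracted constants add up to - (1 - 4 + 6 - 4) c^4 = c^4, the term of the binomial
  formula that \<open>quartic\<close> lacks.\<close>

lemma quartic_increment: "(x - c) ^ 4 = quartic (\<lambda>k. x ^ k - c ^ k) (c :: real)"
  by (simp add: quartic_def power2_eq_square power3_eq_cube power4_eq_xxxx algebra_simps)

section \<open>Limit of the quartic sums along one path\<close>

text \<open>The grid sum is the integral of one function of \<open>r\<close>, in which
  \<open>u\<close> and the weight are read off at the last grid point up to \<open>r\<close>. Almost
  everywhere this integrand tends to 0: either the weight is 0 from some grid on, or
  \<open>u\<close> converges at a point where \<open>quartic\<close> cancels. The second claim
  provides a bound independent of the grid, for the later limit under the expectation.\<close>

lemma path_limit:
  fixes u :: "real \<Rightarrow> real" and \<gamma> :: "nat \<Rightarrow> real \<Rightarrow> real"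
  assumes qT: "q < T" and u: "\<And>r. \<bar>u r\<bar> \<le> b"
    and \<gamma>m: "\<And>k. k \<in> {1..4} \<Longrightarrow> \<gamma> k \<in> borel_measurable borel"
    and \<gamma>: "\<And>k. k \<in> {1..4} \<Longrightarrow> set_integrable lborel {q..T} (\<gamma> k)"
    and left: "AE r in lborel. q < r \<longrightarrow> r < T \<longrightarrow> (u \<longlongrightarrow> u r) (at_left r)"
    and B: "B \<in> sets borel"
    and cancel: "\<And>r. q \<le> r \<Longrightarrow> r \<le> T \<Longrightarrow> r \<notin> B \<Longrightarrow> quartic (\<lambda>k. \<gamma> k r) (u r) = 0"
  defines "a \<equiv> \<lambda>s. if emeasure lborel (B \<inter> {q..s}) = 0 then 1 else (0::real)"
  defines "R \<equiv> \<lambda>m. \<Sum>i<m. a (grid q T m i) *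
    quartic (\<lambda>k. LINT r:{grid q T m i..<grid q T m (Suc i)}|lborel. \<gamma> k r) (u (grid q T m i))"
  shows "(\<lambda>n. R (Suc n)) \<longlonglongrightarrow> 0"
    and "\<bar>R (Suc n)\<bar> \<le> (1 + 4 * b + 6 * b\<^sup>2 + 4 * b ^ 3) * (LINT r:{q..T}|lborel. \<Sum>k=1..4. \<bar>\<gamma> k r\<bar>)"
proof -
  define c where "c = 1 + 4 * b + 6 * b\<^sup>2 + 4 * b ^ 3"
  have b: "b \<ge> 0" using u[of 0] by simp
  have c: "c \<ge> 0" using b by (simp add: c_def)
  define F where "F m r = (\<Sum>i<m. indicator {grid q T m i..<grid q T m (Suc i)} r *
      (a (grid q T m i) * quartic (\<lambda>k. \<gamma> k r) (u (grid q T m i))))" for m r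
  define w where "w r = indicator {q..T} r * (c * (\<Sum>k=1..4. \<bar>\<gamma> k r\<bar>))" for r
  have a01: "a s = 0 \<or> a s = 1" for s by (simp add: a_def)
  define \<delta> where "\<delta> m = (T - q) / real m" for m
  \<comment> \<open>The last grid point that does not exceed \<open>r\<close>.\<close>
  define \<tau> where "\<tau> m r = q + real (nat \<lfloor>(r - q) / \<delta> m\<rfloor>) * \<delta> m" for m r
  have \<delta>: "\<delta> (Suc n) > 0" for n using qT by (simp add: \<delta>_def)
  have F: "F (Suc n) r = (if q \<le> r \<and> r < T
      then a (\<tau> (Suc n) r) * quartic (\<lambda>k. \<gamma> k r) (u (\<tau> (Suc n) r)) else 0)" for n r
  proof -
    have "q + real (Suc n) * \<delta> (Suc n) = T" by (simp add: \<delta>_def)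
    moreover have "F (Suc n) r = (if q \<le> r \<and> r < q + real (Suc n) * \<delta> (Suc n)
        then a (\<tau> (Suc n) r) * quartic (\<lambda>k. \<gamma> k r) (u (\<tau> (Suc n) r)) else 0)"
      unfolding F_def grid_def \<tau>_def \<delta>_def[symmetric] by (rule step_sum[OF \<delta>])
    ultimately show ?thesis by simp
  qed
  have [measurable]: "\<gamma> 1 \<in> borel_measurable borel" "\<gamma> 2 \<in> borel_measurable borel"
    "\<gamma> 3 \<in> borel_measurable borel" "\<gamma> 4 \<in> borel_measurable borel"
    by (simp_all add: \<gamma>m)
  have qmeas: "(\<lambda>r. quartic (\<lambda>k. \<gamma> k r) d) \<in> borel_measurable lborel" for d
    unfolding quartic_def by measurable
  have Fmeas: "F m \<in> borel_measurable lborel" for m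
    unfolding F_def[abs_def] using qmeas by measurable
  have wint: "integrable lborel w"
  proof -
    have "set_integrable lborel {q..T} (\<lambda>r. \<bar>\<gamma> k r\<bar>)" if "k \<in> {1..4}" for k
      using \<gamma>[OF that] by (rule set_integrable_abs)
    then have "integrable lborel (\<lambda>r. \<Sum>k=1..4. c * (indicator {q..T} r * \<bar>\<gamma> k r\<bar>))"
      unfolding set_integrable_def by (intro Bochner_Integration.integrable_sum integrable_mult_right) simp
    then show ?thesis
      unfolding w_def[abs_def] by (simp add: sum_distrib_left mult_ac)
  qed
  have Fw: "\<bar>F (Suc n) r\<bar> \<le> w r" for n r
  proof (cases "q \<le> r \<and> r < T")
    case True
    have "\<bar>F (Suc n) r\<bar> \<le> 1 * \<bar>quartic (\<lambda>k. \<gamma> k r) (u (\<tau> (Suc n) r))\<bar>"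
      unfolding F abs_mult using True a01[of "\<tau> (Suc n) r"] by (auto simp: abs_mult)
    also have "\<dots> \<le> c * (\<Sum>k=1..4. \<bar>\<gamma> k r\<bar>)"
      using abs_quartic_le[OF u, of "\<lambda>k. \<gamma> k r"] by (simp add: c_def)
    finally show ?thesis using True by (simp add: w_def)
  next
    case False
    then show ?thesis unfolding F w_def using c by (auto simp: sum_nonneg)
  qed
  have Fint: "integrable lborel (F (Suc n))" for n
    by (rule Bochner_Integration.integrable_bound[OF wint Fmeas])
      (use Fw in \<open>auto intro: order_trans[OF _ abs_ge_self]\<close>)
  have R: "R (Suc n) = (LINT r|lborel. F (Suc n) r)" for n
  proof -
    let ?g = "grid q T (Suc n)"
    have sub: "{?g i..<?g (Suc i)} \<subseteq> {q..T}" if "i < Suc n" for i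
    proof -
      have "real (Suc i) * ((T - q) / real (Suc n)) \<le> real (Suc n) * ((T - q) / real (Suc n))"
        using that qT by (intro mult_right_mono) auto
      also have "\<dots> = T - q" by simp
      finally have "?g (Suc i) \<le> T" by (simp add: grid_def)
      moreover have "q \<le> ?g i" using qT by (simp add: grid_def)
      ultimately show ?thesis by auto
    qed
    have int: "integrable lborel (\<lambda>r. indicator {?g i..<?g (Suc i)} r * \<gamma> k r)"
      if "i < Suc n" "k \<in> {1..4}" for i k
      using set_integrable_subset[OF \<gamma>[OF that(2)] _ sub[OF that(1)]] by (simp add: set_integrable_def)
    have "(LINT r|lborel. F (Suc n) r) = (\<Sum>i<Suc n. LINT r|lborel. a (?g i) *
        quartic (\<lambda>k. indicator {?g i..<?g (Suc i)} r * \<gamma> k r) (u (?g i)))"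
      unfolding F_def
    proof (subst Bochner_Integration.integral_sum)
      fix i assume "i \<in> {..<Suc n}"
      then have "integrable lborel (\<lambda>r. a (?g i) * quartic (\<lambda>k. indicator {?g i..<?g (Suc i)} r * \<gamma> k r) (u (?g i)))"
        unfolding quartic_def using int[of i]
        by (intro integrable_mult_right Bochner_Integration.integrable_add Bochner_Integration.integrable_diff) auto
      then show "integrable lborel (\<lambda>r. indicator {?g i..<?g (Suc i)} r * (a (?g i) * quartic (\<lambda>k. \<gamma> k r) (u (?g i))))"
        by (rule Bochner_Integration.integrable_cong[THEN iffD1, rotated -1]) (auto simp: indicator_def quartic_def)
    qed (intro sum.cong Bochner_Integration.integral_cong refl, auto simp: indicator_def quartic_def)
    also have "\<dots> = R (Suc n)"
      unfolding R_def
    proof (intro sum.cong refl)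
      fix i assume "i \<in> {..<Suc n}"
      then have i: "i < Suc n" by simp
      note I = int[OF i]
      show "(LINT r|lborel. a (?g i) * quartic (\<lambda>k. indicator {?g i..<?g (Suc i)} r * \<gamma> k r) (u (?g i))) =
          a (?g i) * quartic (\<lambda>k. LINT r:{?g i..<?g (Suc i)}|lborel. \<gamma> k r) (u (?g i))"
        unfolding quartic_def set_lebesgue_integral_def using I
        by (simp add: Bochner_Integration.integral_add Bochner_Integration.integral_diff)
    qed
    finally show ?thesis by simp
  qed
  have \<tau>: "\<tau> (Suc n) r \<le> r" "r - \<tau> (Suc n) r < \<delta> (Suc n)" if "q \<le> r" for n r
  proof -
    have "real (nat \<lfloor>(r - q) / \<delta> (Suc n)\<rfloor>) = of_int \<lfloor>(r - q) / \<delta> (Suc n)\<rfloor>"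
      using that \<delta>[of n] by simp
    moreover define z :: real where "z = of_int \<lfloor>(r - q) / \<delta> (Suc n)\<rfloor>"
    have "z \<le> (r - q) / \<delta> (Suc n)" "(r - q) / \<delta> (Suc n) < z + 1"
      unfolding z_def by linarith+
    then have "z * \<delta> (Suc n) \<le> r - q" "r - q < (z + 1) * \<delta> (Suc n)"
      using \<delta>[of n] by (simp_all add: pos_le_divide_eq pos_divide_less_eq)
    ultimately show "\<tau> (Suc n) r \<le> r" "r - \<tau> (Suc n) r < \<delta> (Suc n)"
      unfolding \<tau>_def by (simp_all add: z_def distrib_right)
  qed
  have \<delta>0: "(\<lambda>n. \<delta> (Suc n)) \<longlonglongrightarrow> 0"
    unfolding \<delta>_def by (rule LIMSEQ_Suc[OF lim_const_over_n])
  have \<tau>lim: "(\<lambda>n. \<tau> (Suc n) r) \<longlonglongrightarrow> r" if "q \<le> r" for r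
  proof -
    have "(\<lambda>n. \<tau> (Suc n) r - r) \<longlonglongrightarrow> 0"
      by (rule Lim_null_comparison[OF _ \<delta>0]) (use \<tau>[OF that] in \<open>auto intro!: always_eventually less_imp_le\<close>)
    then show ?thesis by (rule Lim_null[THEN iffD2])
  qed
  have ae: "AE r in lborel. (\<lambda>n. F (Suc n) r) \<longlonglongrightarrow> 0"
    using left last_null_time_null[OF B, of q] AE_lborel_singleton[of q]
  proof eventually_elim
    case (elim r)
    show ?case
    proof (cases "q < r \<and> r < T")
      case False
      then have "F (Suc n) r = 0" for n
        unfolding F using elim(3) by auto
      then show ?thesis by simp
    next
      case True
      then have qr: "q \<le> r" by simp
      show ?thesis
      proof (cases "emeasure lborel (B \<inter> {q..r}) = 0")
        case False
        \<comment> \<open>The path has exhausted its credit strictly before \<open>r\<close>, hence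
          also at all grid points close to \<open>r\<close>.\<close>
        then obtain r' where r': "r' < r" "emeasure lborel (B \<inter> {q..r'}) \<noteq> 0"
          using positive_measure_before[OF B] by blast
        have "eventually (\<lambda>n. r' < \<tau> (Suc n) r) sequentially"
          using order_tendstoD(1)[OF \<tau>lim[OF qr] r'(1)] .
        then have "eventually (\<lambda>n. F (Suc n) r = 0) sequentially"
        proof eventually_elim
          case (elim n)
          have "emeasure lborel (B \<inter> {q..r'}) \<le> emeasure lborel (B \<inter> {q..\<tau> (Suc n) r})"
            using elim B by (intro emeasure_mono) auto
          then have "a (\<tau> (Suc n) r) = 0"
            using r'(2) by (auto simp: a_def)
          then show ?case by (simp add: F)
        qed
        then show ?thesis by (rule tendsto_eventually)
      next
        case null: True
        \<comment> \<open>The weight may be 1 up to \<open>r\<close>; almost surely in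
          \<open>r\<close> this happens only outside \<open>B\<close>, where the limit of the
          integrand is 0.\<close>
        then have "r \<notin> B" using elim(2) qr by blast
        then have "quartic (\<lambda>k. \<gamma> k r) (u r) = 0"
          using cancel True by auto
        moreover have "(\<lambda>n. u (\<tau> (Suc n) r)) \<longlonglongrightarrow> u r"
          using elim(1) True \<tau>(1)[OF qr] by (intro tendsto_from_left[OF _ \<tau>lim[OF qr]]) auto
        then have "(\<lambda>n. quartic (\<lambda>k. \<gamma> k r) (u (\<tau> (Suc n) r))) \<longlonglongrightarrow> quartic (\<lambda>k. \<gamma> k r) (u r)"
          unfolding quartic_def by (intro tendsto_intros)
        ultimately have "(\<lambda>n. \<bar>quartic (\<lambda>k. \<gamma> k r) (u (\<tau> (Suc n) r))\<bar>) \<longlonglongrightarrow> 0"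
          by (simp add: tendsto_rabs_zero)
        then show ?thesis
        proof (rule Lim_null_comparison[rotated])
          have "\<bar>F (Suc n) r\<bar> \<le> \<bar>quartic (\<lambda>k. \<gamma> k r) (u (\<tau> (Suc n) r))\<bar>" for n
            unfolding F using a01[of "\<tau> (Suc n) r"] by auto
          then show "eventually (\<lambda>n. norm (F (Suc n) r) \<le> \<bar>quartic (\<lambda>k. \<gamma> k r) (u (\<tau> (Suc n) r))\<bar>) sequentially"
            by simp
        qed
      qed
    qed
  qed
  have "(\<lambda>n. LINT r|lborel. F (Suc n) r) \<longlonglongrightarrow> (LINT r::real|lborel. 0)"
    by (rule integral_dominated_convergence[where s = "\<lambda>n. F (Suc n)" and w = w])
      (use Fw Fmeas wint ae in auto)
  then show "(\<lambda>n. R (Suc n)) \<longlonglongrightarrow> 0"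
    by (simp add: R)
  have "\<bar>R (Suc n)\<bar> \<le> (LINT r|lborel. w r)"
    unfolding R
    by (intro order_trans[OF integral_abs_bound] integral_mono integrable_abs Fint wint Fw)
  also have "\<dots> = c * (LINT r:{q..T}|lborel. \<Sum>k=1..4. \<bar>\<gamma> k r\<bar>)"
    unfolding w_def set_lebesgue_integral_def
    by (subst integral_mult_right_zero[symmetric]) (simp add: mult.left_commute)
  finally show "\<bar>R (Suc n)\<bar> \<le> (1 + 4 * b + 6 * b\<^sup>2 + 4 * b ^ 3) * (LINT r:{q..T}|lborel. \<Sum>k=1..4. \<bar>\<gamma> k r\<bar>)"
    by (simp add: c_def)
qed

text \<open>In every grid one step straddles \<open>s\<close>. Its ends tend to \<open>s\<close>,
  the left one strictly from below, so its term tends to (u s - l)^4; the terms being nonnegative,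
  it is dominated by the whole sum.\<close>

lemma no_jump_if_quartic_variation_vanishes:
  fixes u :: "real \<Rightarrow> real"
  assumes s: "q < s" "s \<le> T"
    and l: "(u \<longlongrightarrow> l) (at_left s)" and r: "(u \<longlongrightarrow> u s) (at_right s)"
    and a: "\<And>x. a x \<ge> 0" "\<And>x. q \<le> x \<Longrightarrow> x \<le> s \<Longrightarrow> a x = 1"
    and zero: "liminf (\<lambda>n. ennreal (\<Sum>i<Suc n. a (grid q T (Suc n) i) *
      (u (grid q T (Suc n) (Suc i)) - u (grid q T (Suc n) i)) ^ 4)) = 0"
  shows "l = u s"
proof -
  have "\<exists>i<Suc n. grid q T (Suc n) i < s \<and> s \<le> grid q T (Suc n) (Suc i)" for n
    unfolding grid_def using s by (intro grid_interval) auto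
  then obtain i where i: "\<And>n. i n < Suc n" "\<And>n. grid q T (Suc n) (i n) < s"
    "\<And>n. s \<le> grid q T (Suc n) (Suc (i n))"
    by metis
  let ?x = "\<lambda>n. grid q T (Suc n) (i n)" and ?y = "\<lambda>n. grid q T (Suc n) (Suc (i n))"
  have xy: "?y n = ?x n + (T - q) / real (Suc n)" for n
    by (simp add: grid_def distrib_right add_divide_distrib)
  have \<delta>0: "(\<lambda>n. (T - q) / real (Suc n)) \<longlonglongrightarrow> 0"
    by (rule LIMSEQ_Suc[OF lim_const_over_n])
  have "(\<lambda>n. ?x n - s) \<longlonglongrightarrow> 0"
    by (rule Lim_null_comparison[OF _ \<delta>0])
      (use i(2) i(3)[unfolded xy] in \<open>auto intro!: always_eventually simp: abs_if algebra_simps less_imp_le\<close>)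
  then have xlim: "?x \<longlonglongrightarrow> s" by (rule Lim_null[THEN iffD2])
  have "(\<lambda>n. ?x n + (T - q) / real (Suc n)) \<longlonglongrightarrow> s + 0"
    by (intro tendsto_add xlim \<delta>0)
  then have ylim: "?y \<longlonglongrightarrow> s" by (simp add: xy)
  have "(\<lambda>n. u (?x n)) \<longlonglongrightarrow> l"
    by (rule filterlim_compose[OF l])
      (use xlim i(2) in \<open>auto simp: filterlim_at intro!: always_eventually less_imp_neq\<close>)
  moreover have "(\<lambda>n. u (?y n)) \<longlonglongrightarrow> u s"
    by (rule tendsto_from_right[OF r ylim]) (rule i(3))
  ultimately have "(\<lambda>n. (u (?y n) - u (?x n)) ^ 4) \<longlonglongrightarrow> (u s - l) ^ 4"
    by (intro tendsto_intros)
  then have "(\<lambda>n. ennreal ((u (?y n) - u (?x n)) ^ 4)) \<longlonglongrightarrow> ennreal ((u s - l) ^ 4)"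
    by (rule tendsto_ennrealI)
  then have "liminf (\<lambda>n. ennreal ((u (?y n) - u (?x n)) ^ 4)) = ennreal ((u s - l) ^ 4)"
    by (rule lim_imp_Liminf[rotated]) simp
  moreover have "liminf (\<lambda>n. ennreal ((u (?y n) - u (?x n)) ^ 4)) \<le> 0"
    unfolding zero[symmetric]
  proof (intro Liminf_mono always_eventually allI ennreal_leI)
    fix n
    have "q \<le> ?x n" using s by (simp add: grid_def)
    then have "(u (?y n) - u (?x n)) ^ 4 = a (?x n) * (u (?y n) - u (?x n)) ^ 4"
      using a(2)[of "?x n"] i(2)[of n] by simp
    also have "\<dots> \<le> (\<Sum>i<Suc n. a (grid q T (Suc n) i) *
      (u (grid q T (Suc n) (Suc i)) - u (grid q T (Suc n) i)) ^ 4)"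
      using i(1)[of n] a(1)
      by (intro member_le_sum[of "i n" _ "\<lambda>i. a (grid q T (Suc n) i) *
        (u (grid q T (Suc n) (Suc i)) - u (grid q T (Suc n) i)) ^ 4"]) auto
    finally show "(u (?y n) - u (?x n)) ^ 4 \<le> (\<Sum>i<Suc n. a (grid q T (Suc n) i) *
      (u (grid q T (Suc n) (Suc i)) - u (grid q T (Suc n) i)) ^ 4)" .
  qed
  ultimately have "(u s - l) ^ 4 \<le> 0"
    by (simp add: ennreal_eq_0_iff)
  then have "(u s - l) ^ 4 = 0"
    by (metis antisym zero_le_even_power even_numeral)
  then show ?thesis by simp
qed

section \<open>Increments of the process\<close>

text \<open>Replacing an open set by a continuous function makes membership accessible through
  limits along right approximations of the path.\<close>

lemma open_positivity_function:
  fixes U :: "'s::metric_space set"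
  assumes "open U"
  shows "\<exists>h :: 's \<Rightarrow> real. continuous_on UNIV h \<and> (\<forall>y. 0 \<le> h y) \<and> (\<forall>y. h y = 0 \<longleftrightarrow> y \<notin> U)"
proof (cases "U = UNIV")
  \<comment> \<open>By convention \<open>infdist\<close> to the empty set is 0, so the whole space
    needs another function.\<close>
  case True
  then show ?thesis by (intro exI[of _ "\<lambda>_. 1"]) auto
next
  case False
  have "infdist y (- U) = 0 \<longleftrightarrow> y \<notin> U" for y
    using in_closed_iff_infdist_zero[of "- U" y] assms False by auto
  then show ?thesis
    by (intro exI[of _ "\<lambda>y. infdist y (- U)"]) (auto intro!: continuous_on_infdist continuous_on_id infdist_nonneg)
qed

text \<open>An approximation from the right of \<open>r\<close>, clipped to \<open>[0, s]\<close>. It takes countably many values, all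
  in \<open>[0, s]\<close>, so that a path observed along it is jointly measurable for the filtration at \<open>s\<close>.\<close>

definition rgrid :: "nat \<Rightarrow> real \<Rightarrow> real \<Rightarrow> real" where
  "rgrid n r s = max 0 (min ((of_int \<lfloor>real (Suc n) * r\<rfloor> + 1) / real (Suc n)) s)"

lemma rgrid_ge: "max 0 (min r s) \<le> rgrid n r s"
proof -
  have "real (Suc n) * r < of_int \<lfloor>real (Suc n) * r\<rfloor> + 1" by linarith
  then have "r \<le> (of_int \<lfloor>real (Suc n) * r\<rfloor> + 1) / real (Suc n)"
    by (simp add: pos_le_divide_eq mult.commute)
  then show ?thesis by (auto simp: rgrid_def)
qed

lemma rgrid_tendsto: "(\<lambda>n. rgrid n r s) \<longlonglongrightarrow> max 0 (min r s)"
proof -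
  have "(\<lambda>n. (of_int \<lfloor>real (Suc n) * r\<rfloor> + 1) / real (Suc n) - r) \<longlonglongrightarrow> 0"
  proof (rule Lim_null_comparison[OF always_eventually LIMSEQ_inverse_real_of_nat], rule allI)
    fix n
    define z :: real where "z = of_int \<lfloor>real (Suc n) * r\<rfloor>"
    have z: "z \<le> real (Suc n) * r" "real (Suc n) * r < z + 1"
      unfolding z_def by linarith+
    have "(z + 1) / real (Suc n) - r = (z + 1 - real (Suc n) * r) / real (Suc n)"
      by (simp add: diff_divide_distrib)
    moreover have "\<bar>z + 1 - real (Suc n) * r\<bar> / real (Suc n) \<le> 1 / real (Suc n)"
      using z by (intro divide_right_mono) auto
    ultimately show "norm ((z + 1) / real (Suc n) - r) \<le> inverse (real (Suc n))"
      by (simp add: abs_divide inverse_eq_divide)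
  qed
  then have "(\<lambda>n. (of_int \<lfloor>real (Suc n) * r\<rfloor> + 1) / real (Suc n)) \<longlonglongrightarrow> r"
    by (rule Lim_null[THEN iffD2])
  then show ?thesis
    unfolding rgrid_def by (intro tendsto_intros)
qed

lemma set_integral_increment:
  fixes h :: "real \<Rightarrow> real"
  assumes h: "set_integrable lborel {0..T} h" and st: "0 \<le> s" "s \<le> t" "t \<le> T"
  shows "(LINT r:{0..t}|lborel. h r) - (LINT r:{0..s}|lborel. h r) = (LINT r:{s..<t}|lborel. h r)"
proof -
  have i: "set_integrable lborel {0..t} h" "set_integrable lborel {0..s} h" "set_integrable lborel {s..<t} h"
    using st by (auto intro!: set_integrable_subset[OF h])
  have "(LINT r:{0..t}|lborel. h r) - (LINT r:{0..s}|lborel. h r) =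
      (LINT r|lborel. indicator {0..t} r * h r - indicator {0..s} r * h r)"
    using i unfolding set_integrable_def set_lebesgue_integral_def
    by (simp add: Bochner_Integration.integral_diff)
  also have "\<dots> = (LINT r|lborel. indicator {s..<t} r * h r)"
  proof (rule integral_cong_AE)
    show "(\<lambda>r. indicator {0..t} r * h r - indicator {0..s} r * h r) \<in> borel_measurable lborel"
      using i unfolding set_integrable_def by auto
    show "(\<lambda>r. indicator {s..<t} r * h r) \<in> borel_measurable lborel"
      using i unfolding set_integrable_def by auto
    show "AE r in lborel. indicator {0..t} r * h r - indicator {0..s} r * h r = indicator {s..<t} r * h r"
      using AE_lborel_singleton[of s] AE_lborel_singleton[of t]
    proof eventually_elim
      case (elim r)
      then show ?case using st by (auto simp: indicator_def)
    qed
  qed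
  finally show ?thesis by (simp add: set_lebesgue_integral_def)
qed

abbreviation left_limit where
  "left_limit Z \<omega> t l \<equiv> ((\<lambda>s. the (pos Z s \<omega>)) \<longlongrightarrow> l) (at_left t)"

abbreviation has_left_limits where
  "has_left_limits S Z \<omega> \<equiv> \<forall>t>0. ereal t < lifetime Z \<omega> \<longrightarrow> (\<exists>l\<in>S. left_limit Z \<omega> t l)"

text \<open>The closed interval contains \<open>t\<close>: a jump at the moment of leaving
  \<open>G\<close> is not excluded, in accordance with the open intervals of
  \<open>times_in\<close>.\<close>

abbreviation no_jump_in where
  "no_jump_in S Z G f q T \<omega> \<equiv> \<forall>t l. q < t \<longrightarrow> t < T \<longrightarrow> ereal t < lifetime Z \<omega> \<longrightarrow>
     (\<forall>s\<in>{q..t}. pos Z s \<omega> \<in> Some ` G) \<longrightarrow> l \<in> S \<longrightarrow> left_limit Z \<omega> t l \<longrightarrow>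
     f l = f (the (pos Z t \<omega>))"

section \<open>Martingale increments with weights\<close>

context markov
begin

text \<open>From the lifetime on the path rests at the cemetery, where all extended functions are 0.
  Stopping at the lifetime therefore changes neither the position nor the integral.\<close>

lemma stopped_eq:
  fixes g :: "'s \<Rightarrow> real"
  assumes \<omega>: "\<omega> \<in> paths Z" and t: "t \<ge> 0"
  defines "\<tau> \<equiv> real_of_ereal (min (ereal t) (lifetime Z \<omega>))"
  shows "pos Z \<tau> \<omega> = pos Z t \<omega>"
    and "(LINT r:{0..\<tau>}|lborel. ext0 g (pos Z r \<omega>)) = (LINT r:{0..t}|lborel. ext0 g (pos Z r \<omega>))"
proof -
  have eq: "pos Z \<tau> \<omega> = pos Z t \<omega> \<and> (\<forall>r. indicat_real {0..\<tau>} r * ext0 g (pos Z r \<omega>) = indicat_real {0..t} r * ext0 g (pos Z r \<omega>))"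
  proof (cases "ereal t < lifetime Z \<omega>")
    case True
    then have "\<tau> = t" by (simp add: \<tau>_def min_def less_imp_le)
    then show ?thesis by simp
  next
    case False
    then have le: "lifetime Z \<omega> \<le> ereal t" by simp
    then obtain z where z: "lifetime Z \<omega> = ereal z" "z \<ge> 0"
      using lifetime_nonneg[of \<omega>] by (cases "lifetime Z \<omega>") auto
    then have \<tau>: "\<tau> = z" "z \<le> t" using le by (auto simp: \<tau>_def min_def)
    have dead: "pos Z r \<omega> = None" if "z \<le> r" for r
      using pos_dead[OF \<omega>, of r] z that by auto
    show ?thesis
      using dead \<tau> by (auto simp: indicator_def ext0_def)
  qed
  then show "pos Z \<tau> \<omega> = pos Z t \<omega>" ..
  show "(LINT r:{0..\<tau>}|lborel. ext0 g (pos Z r \<omega>)) = (LINT r:{0..t}|lborel. ext0 g (pos Z r \<omega>))"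
    using eq by (simp only: set_lebesgue_integral_def real_scaleR_def)
qed

text \<open>The martingale is \<open>U - J\<close>, and its increment from \<open>s\<close> to
  \<open>t\<close> is orthogonal to the bounded weight \<open>W\<close> known at time
  \<open>s\<close>. Integrability of the weighted increment of \<open>J\<close> follows from that of
  the martingale and from the bound on \<open>U\<close>.\<close>

lemma weighted_increment:
  fixes f g :: "'s \<Rightarrow> real" and x :: 's
  defines "P \<equiv> completion (law Z (Some x))"
  defines "U \<equiv> \<lambda>t \<omega>. ext0 f (pos Z t \<omega>)"
    and "J \<equiv> \<lambda>t \<omega>. LINT r:{0..t}|lborel. ext0 g (pos Z r \<omega>)"
  assumes x: "x \<in> S" and f: "f \<in> borel_measurable (restrict_space borel S)" "\<And>y. y \<in> S \<Longrightarrow> \<bar>f y\<bar> \<le> b"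
    and m: "martingale P (augmented S Z)
      (\<lambda>t \<omega>. let \<tau> = real_of_ereal (min (ereal t) (lifetime Z \<omega>)) in
         ext0 f (pos Z \<tau> \<omega>) - (LINT r:{0..\<tau>}|lborel. ext0 g (pos Z r \<omega>)))"
    and W: "W \<in> borel_measurable (natural S Z {0..s})" "\<And>\<omega>. \<omega> \<in> paths Z \<Longrightarrow> \<bar>W \<omega>\<bar> \<le> c"
    and st: "0 \<le> s" "s \<le> t"
  shows "integrable P (\<lambda>\<omega>. W \<omega> * (U t \<omega> - U s \<omega>))" "integrable P (\<lambda>\<omega>. W \<omega> * (J t \<omega> - J s \<omega>))"
    and "(\<integral>\<omega>. W \<omega> * (U t \<omega> - U s \<omega>) \<partial>P) = (\<integral>\<omega>. W \<omega> * (J t \<omega> - J s \<omega>) \<partial>P)"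
proof -
  have xx: "Some x \<in> insert None (Some ` S)" using x by simp
  note L = law_props[OF xx]
  interpret L: prob_space "law Z (Some x)" by (rule L(1))
  interpret P: prob_space P unfolding P_def by (rule L.prob_space_completion)
  have sp: "space P = paths Z" by (simp add: P_def L(3))
  note aug = augmented_subalgebra[OF xx, folded P_def]
  interpret C: finite_measure_subalgebra P "augmented S Z s"
    by unfold_locales (rule aug(1))
  define Y where "Y t \<omega> = (let \<tau> = real_of_ereal (min (ereal t) (lifetime Z \<omega>)) in
         ext0 f (pos Z \<tau> \<omega>) - (LINT r:{0..\<tau>}|lborel. ext0 g (pos Z r \<omega>)))" for t \<omega>
  have Y: "Y t \<omega> = U t \<omega> - J t \<omega>" if "t \<ge> 0" "\<omega> \<in> paths Z" for t \<omega>
    using stopped_eq[OF that(2,1)] by (simp add: Y_def U_def J_def Let_def)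
  have m: "integrable P (Y t)" "integrable P (Y s)" "AE \<omega> in P. real_cond_exp P (augmented S Z s) (Y t) \<omega> = Y s \<omega>"
    using m st unfolding martingale_def Y_def[abs_def] by auto
  have natP: "h \<in> borel_measurable P" if "h \<in> borel_measurable (natural S Z {0..r})" for h :: "'w \<Rightarrow> real" and r
  proof -
    have "sets (natural S Z {0..r}) \<subseteq> sets P"
      using augmented_subalgebra(1,2)[OF xx, of r, folded P_def] by (auto simp: subalgebra_def)
    then show ?thesis
      using that by (intro measurable_from_subalg[of P "natural S Z {0..r}"]) (auto simp: subalgebra_def sp space_natural)
  qed
  have Waug: "W \<in> borel_measurable (augmented S Z s)"
    using W(1) aug(2)[of s] aug(3)
    by (intro measurable_from_subalg[of "augmented S Z s" "natural S Z {0..s}"]) (auto simp: subalgebra_def space_natural)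
  note WP = natP[OF W(1)]
  have Um: "U r \<in> borel_measurable P" if "r \<ge> 0" for r
    unfolding U_def
    by (rule natP, rule measurable_compose[OF measurable_pos measurable_ext0[OF f(1)]]) (use that in auto)
  have Ub: "\<bar>U r \<omega>\<bar> \<le> b" if "r \<ge> 0" "\<omega> \<in> paths Z" for r \<omega>
    using pos_state[OF that(2,1)] f(2)[OF x] f(2) by (auto simp: U_def ext0_def)
  have bdd: "integrable P (\<lambda>\<omega>. W \<omega> * h \<omega>)" if "integrable P h" for h
  proof (rule Bochner_Integration.integrable_bound[OF integrable_mult_right[OF integrable_abs[OF that], of c]])
    show "AE \<omega> in P. norm (W \<omega> * h \<omega>) \<le> norm (c * \<bar>h \<omega>\<bar>)"
    proof (rule AE_I2)
      fix \<omega> assume "\<omega> \<in> space P"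
      then have "\<bar>W \<omega>\<bar> \<le> \<bar>c\<bar>"
        using W(2)[of \<omega>] by (simp add: sp)
      then show "norm (W \<omega> * h \<omega>) \<le> norm (c * \<bar>h \<omega>\<bar>)"
        by (simp add: abs_mult mult_right_mono)
    qed
  qed (use WP that in auto)
  have WU: "integrable P (\<lambda>\<omega>. W \<omega> * U r \<omega>)" if "r \<ge> 0" for r
    by (intro bdd P.integrable_const_bound[of _ b] Um that) (use Ub that in \<open>auto simp: sp\<close>)
  note WY = bdd[OF m(1)] bdd[OF m(2)]
  have t0: "t \<ge> 0" using st by simp
  show "integrable P (\<lambda>\<omega>. W \<omega> * (U t \<omega> - U s \<omega>))"
    using Bochner_Integration.integrable_diff[OF WU[OF t0] WU[OF st(1)]] by (simp add: right_diff_distrib)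
  have JY: "W \<omega> * (J t \<omega> - J s \<omega>) = W \<omega> * (U t \<omega>) - W \<omega> * (U s \<omega>) - (W \<omega> * Y t \<omega> - W \<omega> * Y s \<omega>)"
    if "\<omega> \<in> space P" for \<omega>
  proof -
    have "J t \<omega> = U t \<omega> - Y t \<omega>" "J s \<omega> = U s \<omega> - Y s \<omega>"
      using Y[OF t0, of \<omega>] Y[OF st(1), of \<omega>] that by (simp_all add: sp)
    then show ?thesis by (simp add: right_diff_distrib)
  qed
  show "integrable P (\<lambda>\<omega>. W \<omega> * (J t \<omega> - J s \<omega>))"
  proof (subst Bochner_Integration.integrable_cong[OF refl])
    show "W \<omega> * (J t \<omega> - J s \<omega>) = W \<omega> * U t \<omega> - W \<omega> * U s \<omega> - (W \<omega> * Y t \<omega> - W \<omega> * Y s \<omega>)"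
      if "\<omega> \<in> space P" for \<omega> by (rule JY[OF that])
  qed (intro Bochner_Integration.integrable_diff WU WY t0 st)
  have "(\<integral>\<omega>. W \<omega> * Y t \<omega> \<partial>P) = (\<integral>\<omega>. W \<omega> * real_cond_exp P (augmented S Z s) (Y t) \<omega> \<partial>P)"
    using m(1) by (intro C.real_cond_exp_intg(2)[symmetric] WY Waug) auto
  also have "\<dots> = (\<integral>\<omega>. W \<omega> * Y s \<omega> \<partial>P)"
    using m WP by (intro integral_cong_AE) auto
  finally have EY: "(\<integral>\<omega>. W \<omega> * Y t \<omega> \<partial>P) = (\<integral>\<omega>. W \<omega> * Y s \<omega> \<partial>P)" .
  have "(\<integral>\<omega>. W \<omega> * (J t \<omega> - J s \<omega>) \<partial>P) =
      (\<integral>\<omega>. W \<omega> * U t \<omega> - W \<omega> * U s \<omega> - (W \<omega> * Y t \<omega> - W \<omega> * Y s \<omega>) \<partial>P)"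
    by (rule Bochner_Integration.integral_cong[OF refl JY])
  then show "(\<integral>\<omega>. W \<omega> * (U t \<omega> - U s \<omega>) \<partial>P) = (\<integral>\<omega>. W \<omega> * (J t \<omega> - J s \<omega>) \<partial>P)"
    using WU[OF t0] WU[OF st(1)] WY EY by (simp add: Bochner_Integration.integral_diff right_diff_distrib)
qed

text \<open>Right continuity is assumed before the lifetime, and from then on the path is constant;
  so the extended function is right continuous along the path at every time.\<close>

lemma tendsto_pos_right:
  fixes h :: "'s \<Rightarrow> real"
  assumes \<omega>: "\<omega> \<in> paths Z" "right_continuous_path Z \<omega>" and t: "t \<ge> 0" and h: "continuous_on S h"
  shows "((\<lambda>s. ext0 h (pos Z s \<omega>)) \<longlongrightarrow> ext0 h (pos Z t \<omega>)) (at_right t)"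
proof (cases "ereal t < lifetime Z \<omega>")
  case True
  obtain b where b: "t < b" "ereal b \<le> lifetime Z \<omega>"
  proof (cases "lifetime Z \<omega>")
    case (real r)
    then show ?thesis using True that[of r] by auto
  next
    case PInf
    then show ?thesis using that[of "t + 1"] by auto
  qed (use True in auto)
  have alive: "\<exists>y\<in>S. pos Z s \<omega> = Some y" if "t \<le> s" "s < b" for s
    using that t b by (intro pos_alive \<omega>) (auto intro: less_le_trans[of "ereal s" "ereal b"])
  have ev: "eventually (\<lambda>s. t \<le> s \<and> s < b) (at_right t)"
    using eventually_at_right_less[of t] eventually_at_right_field b(1) by (auto elim!: eventually_mono simp: eventually_at_right[OF b(1)])
  have "((\<lambda>s. the (pos Z s \<omega>)) \<longlongrightarrow> the (pos Z t \<omega>)) (at_right t)"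
    using \<omega>(2) t True by (simp add: right_continuous_path_def continuous_within)
  then have "((\<lambda>s. h (the (pos Z s \<omega>))) \<longlongrightarrow> h (the (pos Z t \<omega>))) (at_right t)"
    by (rule continuous_on_tendsto_compose[OF h])
      (use alive[of t] b ev alive in \<open>force elim!: eventually_mono\<close>)+
  moreover have "eventually (\<lambda>s. h (the (pos Z s \<omega>)) = ext0 h (pos Z s \<omega>)) (at_right t)"
    using ev by eventually_elim (use alive in \<open>force simp: ext0_def\<close>)
  moreover have "h (the (pos Z t \<omega>)) = ext0 h (pos Z t \<omega>)"
    using alive[of t] b by (force simp: ext0_def)
  ultimately show ?thesis
    using Lim_transform_eventually by fastforce
next
  case False
  have "pos Z s \<omega> = None" if "t \<le> s" for s
    using False that t by (intro pos_dead \<omega>) (auto intro: order_trans[of _ "ereal t"])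
  then show ?thesis
    by (intro tendsto_eventually) (auto simp: eventually_at_filter ext0_def)
qed

lemma tendsto_pos_left:
  fixes h :: "'s \<Rightarrow> real"
  assumes \<omega>: "\<omega> \<in> paths Z" and t: "t > 0" "ereal t < lifetime Z \<omega>" and h: "continuous_on S h"
    and l: "l \<in> S" "left_limit Z \<omega> t l"
  shows "((\<lambda>s. ext0 h (pos Z s \<omega>)) \<longlongrightarrow> h l) (at_left t)"
proof -
  have alive: "\<exists>y\<in>S. pos Z s \<omega> = Some y" if "0 < s" "s < t" for s
    using that t by (intro pos_alive \<omega>) (auto intro: less_trans[of "ereal s" "ereal t"])
  have ev: "eventually (\<lambda>s. 0 < s \<and> s < t) (at_left t)"
    using t(1) by (auto simp: eventually_at_left[OF t(1)])
  have "((\<lambda>s. h (the (pos Z s \<omega>))) \<longlongrightarrow> h l) (at_left t)"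
    by (rule continuous_on_tendsto_compose[OF h l(2,1)])
      (use ev alive in \<open>force elim!: eventually_mono\<close>)
  moreover have "eventually (\<lambda>s. h (the (pos Z s \<omega>)) = ext0 h (pos Z s \<omega>)) (at_left t)"
    using ev by eventually_elim (use alive in \<open>force simp: ext0_def\<close>)
  ultimately show ?thesis
    by (rule Lim_transform_eventually)
qed

lemma rgrid_pos_tendsto:
  fixes h :: "'s \<Rightarrow> real"
  assumes \<omega>: "\<omega> \<in> paths Z" "right_continuous_path Z \<omega>" and h: "continuous_on S h"
  shows "(\<lambda>n. ext0 h (pos Z (rgrid n r s) \<omega>)) \<longlonglongrightarrow> ext0 h (pos Z (max 0 (min r s)) \<omega>)"
  by (rule tendsto_from_right[where u = "\<lambda>s. ext0 h (pos Z s \<omega>)", OF tendsto_pos_right[OF \<omega> _ h] rgrid_tendsto rgrid_ge])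
    simp

lemma continuous_imp_measurable_ext0:
  fixes h :: "'s \<Rightarrow> real"
  shows "continuous_on S h \<Longrightarrow> ext0 h \<in> borel_measurable (state_space S)"
  by (intro measurable_ext0 borel_measurable_continuous_on_restrict)

lemma measurable_rgrid_pos:
  fixes h :: "'s \<Rightarrow> real"
  assumes s: "s \<ge> 0" and h: "ext0 h \<in> borel_measurable (state_space S)"
  shows "(\<lambda>(\<omega>, r). ext0 h (pos Z (rgrid n r s) \<omega>)) \<in> borel_measurable (natural S Z {0..s} \<Otimes>\<^sub>M lborel)"
proof -
  define F where "F i p = ext0 h (pos Z (max 0 (min ((of_int i + 1) / real (Suc n)) s)) (fst p))"
    for i :: int and p :: "'w \<times> real"
  have "F i \<in> borel_measurable (natural S Z {0..s} \<Otimes>\<^sub>M lborel)" for i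
    unfolding F_def[abs_def] using s
    by (intro measurable_compose[OF measurable_fst measurable_compose[OF measurable_pos h]]) auto
  moreover have "(\<lambda>p. \<lfloor>real (Suc n) * snd p\<rfloor>) \<in> measurable (natural S Z {0..s} \<Otimes>\<^sub>M lborel) (count_space UNIV)"
    by measurable
  ultimately have "(\<lambda>p. F \<lfloor>real (Suc n) * snd p\<rfloor> p) \<in> borel_measurable (natural S Z {0..s} \<Otimes>\<^sub>M lborel)"
    by (rule measurable_compose_countable)
  then show ?thesis
    by (simp add: F_def rgrid_def split_beta')
qed

text \<open>Up to null sets, the event that the path spends almost no time of \<open>[q, s]\<close> in \<open>d = 0\<close> or at the
  cemetery. The limes inferior makes it measurable for the natural filtration, not just for its
  augmentation under one law.\<close>

definition good_until :: "('s \<Rightarrow> real) \<Rightarrow> real \<Rightarrow> real \<Rightarrow> 'w set" where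
  "good_until d q s = {\<omega> \<in> paths Z. (\<integral>\<^sup>+r. indicator {q..s} r *
     indicator {0} (liminf (\<lambda>n. ennreal (ext0 d (pos Z (rgrid n r s) \<omega>)))) \<partial>lborel) = 0}"

lemma good_until_measurable:
  assumes s: "s \<ge> 0" and d: "continuous_on S d"
  shows "good_until d q s \<in> sets (natural S Z {0..s})"
proof -
  note [measurable] = measurable_rgrid_pos[OF s continuous_imp_measurable_ext0[OF d]]
  have "(\<lambda>(\<omega>, r). indicator {q..s} r *
     indicator {0} (liminf (\<lambda>n. ennreal (ext0 d (pos Z (rgrid n r s) \<omega>)))) :: ennreal)
     \<in> borel_measurable (natural S Z {0..s} \<Otimes>\<^sub>M lborel)"
    by measurable
  from lborel.borel_measurable_nn_integral[OF this]
  have "{\<omega> \<in> space (natural S Z {0..s}). (\<integral>\<^sup>+r. indicator {q..s} r *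
     indicator {0} (liminf (\<lambda>n. ennreal (ext0 d (pos Z (rgrid n r s) \<omega>)))) \<partial>lborel) = 0}
     \<in> sets (natural S Z {0..s})"
    by measurable
  then show ?thesis by (simp add: good_until_def space_natural)
qed

text \<open>Along a right continuous path the limes inferior is a limit, namely the value of
  \<open>d\<close> at the current position.\<close>

lemma good_until_iff:
  assumes \<omega>: "\<omega> \<in> paths Z" "right_continuous_path Z \<omega>" and d: "continuous_on S d" "\<And>y. y \<in> S \<Longrightarrow> d y \<ge> 0"
    and q: "0 \<le> q" "s \<le> T" and B: "{r. ext0 d (pos Z (max 0 (min r T)) \<omega>) = 0} \<in> sets borel"
  shows "\<omega> \<in> good_until d q s \<longleftrightarrow> emeasure lborel ({r. ext0 d (pos Z (max 0 (min r T)) \<omega>) = 0} \<inter> {q..s}) = 0"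
proof -
  let ?B = "{r. ext0 d (pos Z (max 0 (min r T)) \<omega>) = 0}"
  have "indicator {q..s} r * indicator {0} (liminf (\<lambda>n. ennreal (ext0 d (pos Z (rgrid n r s) \<omega>)))) =
      (indicator (?B \<inter> {q..s}) r :: ennreal)" for r
  proof (cases "r \<in> {q..s}")
    case True
    then have r: "max 0 (min r s) = r" "max 0 (min r T) = r" "r \<ge> 0" using q by auto
    have "liminf (\<lambda>n. ennreal (ext0 d (pos Z (rgrid n r s) \<omega>))) = ennreal (ext0 d (pos Z r \<omega>))"
      using tendsto_ennrealI[OF rgrid_pos_tendsto[OF \<omega> d(1), of r s]]
      by (intro lim_imp_Liminf) (auto simp: r)
    moreover have "ext0 d (pos Z r \<omega>) \<ge> 0"
      using pos_state[OF \<omega>(1) r(3)] d(2) by (auto simp: ext0_def)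
    ultimately show ?thesis
      using True by (auto simp: indicator_def r ennreal_eq_0_iff)
  qed simp
  moreover have "?B \<inter> {q..s} \<in> sets lborel" using B by simp
  ultimately show ?thesis
    using \<omega>(1) by (simp add: good_until_def)
qed

end

section \<open>Absence of jumps\<close>

context markov
begin

text \<open>Every open set is the set where some continuous function is not 0, and open sets
  generate the Borel sets. Continuous functions thus suffice as tests, and only for these are limits
  along the path at hand.\<close>

lemma measurable_into_state_space:
  assumes X: "\<And>p. p \<in> space N \<Longrightarrow> X p \<in> insert None (Some ` S)"
    and h: "\<And>h :: 's \<Rightarrow> real. continuous_on UNIV h \<Longrightarrow> (\<lambda>p. ext0 h (X p)) \<in> borel_measurable N"
  shows "X \<in> measurable N (state_space S)"
proof -
  have Some_sets: "X -` (Some ` (S \<inter> B)) \<inter> space N \<in> sets N" if "B \<in> sigma_sets UNIV {U. open U}" for B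
    using that
  proof induction
    case (Basic U)
    then obtain h :: "'s \<Rightarrow> real" where h': "continuous_on UNIV h" "\<forall>y. h y = 0 \<longleftrightarrow> y \<notin> U"
      using open_positivity_function[of U] by auto
    have "X -` (Some ` (S \<inter> U)) \<inter> space N = {p \<in> space N. ext0 h (X p) \<noteq> 0}"
      using X h'(2) by (force simp: ext0_def split: option.splits)
    moreover have "{p \<in> space N. ext0 h (X p) \<noteq> 0} \<in> sets N"
      using h[OF h'(1)] by measurable
    ultimately show ?case by simp
  next
    case Empty
    then show ?case by simp
  next
    \<comment> \<open>The constant function 1 tells living states from the cemetery, which a
      complement within \<open>S\<close> has to leave out.\<close>
    case (Compl B)
    have "X -` (Some ` (S \<inter> UNIV)) \<inter> space N = {p \<in> space N. ext0 (\<lambda>_. 1 :: real) (X p) \<noteq> 0}"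
      using X by (force simp: ext0_def split: option.splits)
    moreover have "{p \<in> space N. ext0 (\<lambda>_. 1 :: real) (X p) \<noteq> 0} \<in> sets N"
      using h[of "\<lambda>_. 1"] by measurable
    moreover have "X -` (Some ` (S \<inter> (UNIV - B))) \<inter> space N =
        (X -` (Some ` (S \<inter> UNIV)) \<inter> space N) - (X -` (Some ` (S \<inter> B)) \<inter> space N)"
      by auto
    ultimately show ?case using Compl.IH by auto
  next
    case (Union B)
    have eq: "X -` (Some ` (S \<inter> (\<Union>i. B i))) \<inter> space N = (\<Union>i. X -` (Some ` (S \<inter> B i)) \<inter> space N)"
      by auto
    show ?case
      unfolding eq by (rule sets.countable_nat_UN) (use Union.IH in auto)
  qed
  show ?thesis
    unfolding state_space_def
  proof (rule measurable_measure_of[OF state_space_generator])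
    show "X \<in> space N \<rightarrow> insert None (Some ` S)" using X by auto
    fix A assume "A \<in> insert {None} ((`) Some ` sets (restrict_space borel S))"
    then consider "A = {None}" | B where "B \<in> sets borel" "A = Some ` (S \<inter> B)"
      by (auto simp: sets_restrict_space)
    then show "X -` A \<inter> space N \<in> sets N"
    proof cases
      case 1
      have "UNIV \<in> sigma_sets UNIV {U :: 's set. open U}" by (rule sigma_sets_top)
      moreover have "X -` {None} \<inter> space N = space N - X -` (Some ` (S \<inter> UNIV)) \<inter> space N"
        using X by auto
      ultimately show ?thesis using Some_sets[of UNIV] 1 by auto
    next
      case 2
      then have "B \<in> sigma_sets UNIV {U. open U}"
        by (simp add: borel_def)
      then show ?thesis using Some_sets 2 by simp
    qed
  qed
qed

text \<open>A right continuous path is the limit of its samples along \<open>rgrid\<close>. Paths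
  outside \<open>\<Omega>\<close> are sent to the cemetery, because right continuity is known only
  almost surely.\<close>

lemma jointly_measurable:
  assumes x: "x \<in> S" and T: "T \<ge> 0"
    and \<Omega>: "\<Omega> \<in> sets (law Z (Some x))" "\<And>\<omega>. \<omega> \<in> \<Omega> \<Longrightarrow> right_continuous_path Z \<omega>"
  shows "(\<lambda>(\<omega>, r). if \<omega> \<in> \<Omega> then pos Z (max 0 (min r T)) \<omega> else None)
    \<in> measurable (law Z (Some x) \<Otimes>\<^sub>M lborel) (state_space S)"
proof (rule measurable_into_state_space)
  have xx: "Some x \<in> insert None (Some ` S)" using x by simp
  note L = law_props[OF xx]
  let ?N = "law Z (Some x) \<Otimes>\<^sub>M lborel"
  have spN: "fst p \<in> paths Z" if "p \<in> space ?N" for p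
    using that by (auto simp: space_pair_measure L(3))
  show "(case p of (\<omega>, r) \<Rightarrow> if \<omega> \<in> \<Omega> then pos Z (max 0 (min r T)) \<omega> else None) \<in> insert None (Some ` S)"
    if "p \<in> space ?N" for p
    using spN[OF that] pos_state by (auto simp: split_beta)
  fix h :: "'s \<Rightarrow> real" assume "continuous_on UNIV h"
  then have h: "continuous_on S h" using continuous_on_subset by blast
  have sub: "subalgebra (law Z (Some x)) (natural S Z {0..T})"
    using sets_natural_mono[of "{0..T}" "{0..}" S Z] by (simp add: subalgebra_def L space_natural)
  have m: "(\<lambda>(\<omega>, r). ext0 h (pos Z (rgrid n r T) \<omega>)) \<in> borel_measurable ?N" for n
  proof -
    have "(\<lambda>\<omega>. \<omega>) \<in> measurable (law Z (Some x)) (natural S Z {0..T})"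
      using sub by (intro measurableI) (auto simp: subalgebra_def)
    then have "(\<lambda>(\<omega>, r). (\<omega>, r)) \<in> measurable ?N (natural S Z {0..T} \<Otimes>\<^sub>M lborel)"
      unfolding split_beta'
      by (intro measurable_Pair measurable_snd measurable_compose[OF measurable_fst])
    then show ?thesis
      using measurable_compose[OF _ measurable_rgrid_pos[OF T continuous_imp_measurable_ext0[OF h]]]
      by (simp add: split_beta')
  qed
  have ind: "(\<lambda>p. indicator \<Omega> (fst p) :: real) \<in> borel_measurable ?N"
    using \<Omega>(1) by measurable
  show "(\<lambda>p. ext0 h (case p of (\<omega>, r) \<Rightarrow> if \<omega> \<in> \<Omega> then pos Z (max 0 (min r T)) \<omega> else None)) \<in> borel_measurable ?N"
  proof (rule borel_measurable_LIMSEQ_real)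
    show "(\<lambda>p. indicator \<Omega> (fst p) * (case p of (\<omega>, r) \<Rightarrow> ext0 h (pos Z (rgrid n r T) \<omega>))) \<in> borel_measurable ?N" for n
      by (intro borel_measurable_times ind m)
    show "(\<lambda>n. indicator \<Omega> (fst p) * (case p of (\<omega>, r) \<Rightarrow> ext0 h (pos Z (rgrid n r T) \<omega>)))
        \<longlonglongrightarrow> ext0 h (case p of (\<omega>, r) \<Rightarrow> if \<omega> \<in> \<Omega> then pos Z (max 0 (min r T)) \<omega> else None)"
      if "p \<in> space ?N" for p
    proof (cases "fst p \<in> \<Omega>")
      case True
      then show ?thesis
        using rgrid_pos_tendsto[OF spN[OF that] \<Omega>(2)[OF True] h] by (simp add: split_beta)
    next
      case False
      then show ?thesis by (simp add: split_beta ext0_def)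
    qed
  qed
qed

text \<open>Here \<open>g k\<close> stands for the operator applied to \<open>f ^ k\<close>. Of the
  operator there remain the four martingales, the resolvent bounds and the cancellation on
  \<open>G\<close>, so that the argument is purely one about paths and expectations.\<close>

theorem no_jump:
  fixes f :: "'s \<Rightarrow> real" and g :: "nat \<Rightarrow> 's \<Rightarrow> real"
  assumes x: "x \<in> S"
    and cadlag: "AE \<omega> in law Z (Some x). right_continuous_path Z \<omega> \<and>
        has_left_limits S Z \<omega>"
    and f: "continuous_on S f" "\<And>y. y \<in> S \<Longrightarrow> \<bar>f y\<bar> \<le> b"
    and g: "\<And>k. k \<in> {1..4} \<Longrightarrow> g k \<in> borel_measurable (restrict_space borel S)"
    and mart: "\<And>k. k \<in> {1..4} \<Longrightarrow> martingale (completion (law Z (Some x))) (augmented S Z)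
      (\<lambda>t \<omega>. let \<tau> = real_of_ereal (min (ereal t) (lifetime Z \<omega>)) in
         ext0 (\<lambda>y. f y ^ k) (pos Z \<tau> \<omega>) - (LINT r:{0..\<tau>}|lborel. ext0 (g k) (pos Z r \<omega>)))"
    and res: "\<And>k. k \<in> {1..4} \<Longrightarrow> resolvent Z \<alpha> (\<lambda>y. ennreal \<bar>g k y\<bar>) x < \<infinity>"
    and \<alpha>: "\<alpha> > 0"
    and G: "openin (top_of_set S) G"
    and cancel: "\<And>y. y \<in> G \<Longrightarrow> quartic (\<lambda>k. g k y) (f y) = 0"
    and qT: "0 \<le> q" "q < T"
  shows "AE \<omega> in law Z (Some x). no_jump_in S Z G f q T \<omega>"
proof -
  have xx: "Some x \<in> insert None (Some ` S)" using x by simp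
  note L = law_props[OF xx]
  define Lx where "Lx = law Z (Some x)"
  define P where "P = completion Lx"
  interpret Lx: prob_space Lx unfolding Lx_def by (rule L(1))
  interpret P: prob_space P unfolding P_def by (rule Lx.prob_space_completion)
  have spL: "space Lx = paths Z" by (simp add: Lx_def L(3))
  have spP: "space P = paths Z" by (simp add: P_def spL)
  have T: "T \<ge> 0" using qT by auto
  have b: "b \<ge> 0" using f(2)[OF x] by simp
  obtain N where N: "N \<in> null_sets Lx"
    "{\<omega> \<in> space Lx. \<not> (right_continuous_path Z \<omega> \<and>
        has_left_limits S Z \<omega>)} \<subseteq> N"
    using cadlag unfolding Lx_def[symmetric] eventually_ae_filter by blast
  \<comment> \<open>A measurable set of full probability on which all paths are regular, so that
    restricting to it keeps joint measurability.\<close>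
  define \<Omega> where "\<Omega> = space Lx - N"
  have \<Omega>s: "\<Omega> \<in> sets Lx" using N(1) by (auto simp: \<Omega>_def)
  have \<Omega>ae: "AE \<omega> in Lx. \<omega> \<in> \<Omega>"
    using N(1) by (intro AE_I'[of N]) (auto simp: \<Omega>_def)
  have \<Omega>: "\<omega> \<in> paths Z" "right_continuous_path Z \<omega>"
    "\<And>t. t > 0 \<Longrightarrow> ereal t < lifetime Z \<omega> \<Longrightarrow> \<exists>l\<in>S. left_limit Z \<omega> t l"
    if "\<omega> \<in> \<Omega>" for \<omega>
    using that N(2) unfolding \<Omega>_def spL by blast+
  obtain G' where G': "open G'" "G = S \<inter> G'"
    using G by (auto simp: openin_open)
  obtain d :: "'s \<Rightarrow> real" where d: "continuous_on UNIV d" "\<And>y. d y \<ge> 0" "\<And>y. d y = 0 \<longleftrightarrow> y \<notin> G'"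
    using open_positivity_function[OF G'(1)] by blast
  have dS: "continuous_on S d" using d(1) continuous_on_subset by blast
  define X where "X \<omega> r = (if \<omega> \<in> \<Omega> then pos Z (max 0 (min r T)) \<omega> else None)" for \<omega> r
  have X: "X \<omega> r = pos Z r \<omega>" if "\<omega> \<in> \<Omega>" "0 \<le> r" "r \<le> T" for \<omega> r
    using that by (simp add: X_def)
  have "(\<lambda>(\<omega>, r). X \<omega> r) \<in> measurable (Lx \<Otimes>\<^sub>M lborel) (state_space S)"
    unfolding X_def Lx_def by (rule jointly_measurable[OF x T(1) \<Omega>s[unfolded Lx_def] \<Omega>(2)])
  note joint = measurable_compose[OF this]
  define \<gamma> where "\<gamma> \<omega> k r = ext0 (g k) (X \<omega> r)" for \<omega> k r
  have \<gamma>joint: "(\<lambda>(\<omega>, r). \<gamma> \<omega> k r) \<in> borel_measurable (Lx \<Otimes>\<^sub>M lborel)" if "k \<in> {1..4}" for k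
    using joint[OF measurable_ext0[OF g[OF that]]] by (simp add: \<gamma>_def split_beta')
  have \<gamma>m: "\<gamma> \<omega> k \<in> borel_measurable borel" if "k \<in> {1..4}" "\<omega> \<in> \<Omega>" for \<omega> k
    using measurable_Pair2[OF \<gamma>joint[OF that(1)], of \<omega>] \<Omega>(1)[OF that(2)] by (simp add: spL)
  \<comment> \<open>The times spent outside \<open>G\<close> or at the cemetery, where the extension
    of \<open>d\<close> is 0 as well.\<close>
  define B where "B \<omega> = {r. ext0 d (X \<omega> r) = 0}" for \<omega>
  have Bm: "B \<omega> \<in> sets borel" if "\<omega> \<in> \<Omega>" for \<omega>
  proof -
    have "(\<lambda>r. ext0 d (X \<omega> r)) \<in> borel_measurable borel"
      using measurable_Pair2[OF joint[OF continuous_imp_measurable_ext0[OF dS]], of \<omega>] \<Omega>(1)[OF that]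
      by (simp add: spL)
    then have "{r \<in> space borel. ext0 d (X \<omega> r) = 0} \<in> sets borel" by measurable
    then show ?thesis by (simp add: B_def)
  qed
  have good: "\<omega> \<in> good_until d q s \<longleftrightarrow> emeasure lborel (B \<omega> \<inter> {q..s}) = 0" if "\<omega> \<in> \<Omega>" "s \<le> T" for \<omega> s
    using good_until_iff[OF \<Omega>(1,2)[OF that(1)] dS d(2) qT(1) that(2)] Bm[OF that(1)] that(1)
    by (simp add: B_def X_def)
  define N1 where "N1 k \<omega> = (\<integral>\<^sup>+r. indicator {0..T} r * ennreal \<bar>\<gamma> \<omega> k r\<bar> \<partial>lborel)" for k \<omega>
  have N1m: "N1 k \<in> borel_measurable Lx" if "k \<in> {1..4}" for k
  proof -
    note [measurable] = \<gamma>joint[OF that]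
    have "(\<lambda>(\<omega>, r). indicator {0..T} r * ennreal \<bar>\<gamma> \<omega> k r\<bar>) \<in> borel_measurable (Lx \<Otimes>\<^sub>M lborel)"
      by measurable
    from lborel.borel_measurable_nn_integral[OF this] show ?thesis
      by (simp add: N1_def[abs_def])
  qed
  have N1fin: "(\<integral>\<^sup>+\<omega>. N1 k \<omega> \<partial>Lx) < \<infinity>" if k: "k \<in> {1..4}" for k
  proof -
    \<comment> \<open>Up to time \<open>T\<close> the discount factor is at least
      \<open>exp (- \<alpha> * T)\<close>, so the resolvent controls the integral without
      discount.\<close>
    have "ennreal (exp (- \<alpha> * T)) * N1 k \<omega> \<le>
        (\<integral>\<^sup>+t\<in>{0..}. ennreal (exp (- \<alpha> * t)) * ext0 (\<lambda>y. ennreal \<bar>g k y\<bar>) (pos Z t \<omega>) \<partial>lborel)"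
      if \<omega>: "\<omega> \<in> \<Omega>" for \<omega>
    proof -
      have [measurable]: "\<gamma> \<omega> k \<in> borel_measurable borel" by (rule \<gamma>m[OF k \<omega>])
      have "ennreal (exp (- \<alpha> * T)) * N1 k \<omega> =
          (\<integral>\<^sup>+r. ennreal (exp (- \<alpha> * T)) * (indicator {0..T} r * ennreal \<bar>\<gamma> \<omega> k r\<bar>) \<partial>lborel)"
        unfolding N1_def by (rule nn_integral_cmult[symmetric]) measurable
      also have "\<dots> \<le> (\<integral>\<^sup>+t\<in>{0..}. ennreal (exp (- \<alpha> * t)) * ext0 (\<lambda>y. ennreal \<bar>g k y\<bar>) (pos Z t \<omega>) \<partial>lborel)"
      proof (rule nn_integral_mono)
        fix r
        show "ennreal (exp (- \<alpha> * T)) * (indicator {0..T} r * ennreal \<bar>\<gamma> \<omega> k r\<bar>) \<le>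
            ennreal (exp (- \<alpha> * r)) * ext0 (\<lambda>y. ennreal \<bar>g k y\<bar>) (pos Z r \<omega>) * indicator {0..} r"
        proof (cases "r \<in> {0..T}")
          case True
          then have "ennreal \<bar>\<gamma> \<omega> k r\<bar> = ext0 (\<lambda>y. ennreal \<bar>g k y\<bar>) (pos Z r \<omega>)"
            using X[OF \<omega>, of r] by (auto simp: \<gamma>_def ext0_def split: option.split)
          moreover have "exp (- \<alpha> * T) \<le> exp (- \<alpha> * r)"
            using True \<alpha> by simp
          ultimately show ?thesis
            using True by (auto intro!: mult_right_mono ennreal_leI)
        qed simp
      qed
      finally show ?thesis .
    qed
    then have "(\<integral>\<^sup>+\<omega>. ennreal (exp (- \<alpha> * T)) * N1 k \<omega> \<partial>Lx) \<le> resolvent Z \<alpha> (\<lambda>y. ennreal \<bar>g k y\<bar>) x"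
      unfolding resolvent_def Lx_def[symmetric] nn_integral_completion
      by (intro nn_integral_mono_AE) (use \<Omega>ae in \<open>auto elim!: eventually_mono\<close>)
    then have "ennreal (exp (- \<alpha> * T)) * (\<integral>\<^sup>+\<omega>. N1 k \<omega> \<partial>Lx) < \<infinity>"
      using res[OF k] by (simp add: nn_integral_cmult[OF N1m[OF k]])
    then show ?thesis
      by (auto simp: ennreal_mult_less_top)
  qed
  have "AE \<omega> in Lx. N1 k \<omega> \<noteq> \<infinity>" if "k \<in> {1..4}" for k
    using nn_integral_PInf_AE[OF N1m[OF that]] N1fin[OF that] by simp
  then have "AE \<omega> in Lx. \<forall>k\<in>{1..4}. N1 k \<omega> \<noteq> \<infinity>"
    by (intro AE_finite_allI) auto
  then have fin: "AE \<omega> in Lx. \<omega> \<in> \<Omega> \<and> (\<forall>k\<in>{1..4}. N1 k \<omega> \<noteq> \<infinity>)"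
    using \<Omega>ae by (rule AE_conjI[rotated])
  have \<gamma>int: "set_integrable lborel {0..T} (\<gamma> \<omega> k)"
    if "\<omega> \<in> \<Omega>" "k \<in> {1..4}" "N1 k \<omega> \<noteq> \<infinity>" for \<omega> k
    unfolding set_integrable_def
  proof (rule integrableI_bounded)
    have [measurable]: "\<gamma> \<omega> k \<in> borel_measurable borel" by (rule \<gamma>m[OF that(2,1)])
    show "(\<lambda>r. indicator {0..T} r *\<^sub>R \<gamma> \<omega> k r) \<in> borel_measurable lborel" by measurable
    have "(\<integral>\<^sup>+r. ennreal (norm (indicator {0..T} r *\<^sub>R \<gamma> \<omega> k r)) \<partial>lborel) = N1 k \<omega>"
      unfolding N1_def by (intro nn_integral_cong) (auto simp: indicator_def)
    then show "(\<integral>\<^sup>+r. ennreal (norm (indicator {0..T} r *\<^sub>R \<gamma> \<omega> k r)) \<partial>lborel) < \<infinity>"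
      using that(3) by (simp add: less_top)
  qed
  define u where "u \<omega> r = ext0 f (X \<omega> r)" for \<omega> r
  have ub: "\<bar>u \<omega> r\<bar> \<le> b" for \<omega> r
  proof (cases "\<omega> \<in> \<Omega>")
    case True
    have "X \<omega> r \<in> insert None (Some ` S)"
      unfolding X_def using True pos_state[OF \<Omega>(1)[OF True]] by simp
    then show ?thesis using f(2) b by (auto simp: u_def ext0_def)
  qed (use b in \<open>simp add: u_def X_def ext0_def\<close>)
  have uleft: "AE r in lborel. q < r \<longrightarrow> r < T \<longrightarrow> (u \<omega> \<longlongrightarrow> u \<omega> r) (at_left r)" if \<omega>: "\<omega> \<in> \<Omega>" for \<omega>
  proof -
    have "AE r in lborel. r \<notin> {r. \<exists>l. (u \<omega> \<longlongrightarrow> l) (at_left r) \<and> l \<noteq> u \<omega> r}"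
      using countable_imp_null_set_lborel[OF countable_left_jumps] by (rule AE_not_in)
    \<comment> \<open>At the lifetime a left limit need not exist, so this single time is discarded.
      If the lifetime is infinite, \<open>real_of_ereal\<close> yields 0 and a harmless point is
      discarded instead.\<close>
    then show ?thesis
      using AE_lborel_singleton[of "real_of_ereal (lifetime Z \<omega>)"]
    proof eventually_elim
      case (elim r)
      show ?case
      proof (intro impI)
        assume r: "q < r" "r < T"
        then have r0: "r > 0" using qT by simp
        have eq: "eventually (\<lambda>s. ext0 f (pos Z s \<omega>) = u \<omega> s) (at_left r)"
          unfolding eventually_at_left[OF r0] using r X[OF \<omega>] by (intro exI[of _ 0]) (auto simp: u_def r0)
        show "(u \<omega> \<longlongrightarrow> u \<omega> r) (at_left r)"
        proof (cases "ereal r < lifetime Z \<omega>")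
          case True
          then obtain l where "l \<in> S" "left_limit Z \<omega> r l"
            using \<Omega>(3)[OF \<omega> r0] by blast
          then have "((\<lambda>s. ext0 f (pos Z s \<omega>)) \<longlongrightarrow> f l) (at_left r)"
            by (intro tendsto_pos_left \<Omega>(1)[OF \<omega>] r0 True f(1))
          then have "(u \<omega> \<longlongrightarrow> f l) (at_left r)"
            using eq by (rule Lim_transform_eventually)
          then show ?thesis using elim(1) by auto
        next
          case False
          then obtain z where z: "lifetime Z \<omega> = ereal z" "z < r"
            using lifetime_nonneg[of \<omega>] elim(2) by (cases "lifetime Z \<omega>") auto
          have dead: "u \<omega> s = 0" if "z \<le> s" "s \<le> r" for s
            using pos_dead[OF \<Omega>(1)[OF \<omega>], of s] X[OF \<omega>, of s] that z r lifetime_nonneg[of \<omega>]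
            by (simp add: u_def ext0_def)
          have "eventually (\<lambda>s. z < s \<and> s < r) (at_left r)"
            unfolding eventually_at_left[OF z(2)] using z(2) by auto
          then have "eventually (\<lambda>s. u \<omega> s = u \<omega> r) (at_left r)"
            by eventually_elim (use dead z(2) in auto)
          then show ?thesis by (rule tendsto_eventually)
        qed
      qed
    qed
  qed
  have Bcancel: "quartic (\<lambda>k. \<gamma> \<omega> k r) (u \<omega> r) = 0" if "\<omega> \<in> \<Omega>" "q \<le> r" "r \<le> T" "r \<notin> B \<omega>" for \<omega> r
  proof -
    have "ext0 d (pos Z r \<omega>) \<noteq> 0" "X \<omega> r = pos Z r \<omega>"
      using that qT X[of \<omega> r] by (auto simp: B_def)
    moreover have "pos Z r \<omega> \<in> insert None (Some ` S)"
      using pos_state[OF \<Omega>(1)[OF that(1)], of r] that qT by simp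
    ultimately obtain y where "y \<in> S" "d y \<noteq> 0" "X \<omega> r = Some y"
      by (auto simp: ext0_def)
    then have "y \<in> G" "X \<omega> r = Some y" using d(3) G'(2) by auto
    then show ?thesis
      using cancel[of y] by (simp add: \<gamma>_def u_def ext0_def)
  qed
  define a where "a \<omega> s = (if emeasure lborel (B \<omega> \<inter> {q..s}) = 0 then 1 else 0 :: real)" for \<omega> s
  define t where "t n i = grid q T (Suc n) i" for n i
  have t: "q \<le> t n i" "0 \<le> t n i" "t n i \<le> t n (Suc i)" for n i
    using qT by (auto simp: t_def grid_def divide_right_mono mult_right_mono)
  have tT: "t n i \<le> T" if "i \<le> Suc n" for n i
  proof -
    have "real i * ((T - q) / real (Suc n)) \<le> real (Suc n) * ((T - q) / real (Suc n))"
      using that qT by (intro mult_right_mono) auto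
    also have "\<dots> = T - q" by simp
    finally show ?thesis by (simp add: t_def grid_def)
  qed
  define R where "R \<omega> m = (\<Sum>i<m. a \<omega> (grid q T m i) *
    quartic (\<lambda>k. LINT r:{grid q T m i..<grid q T m (Suc i)}|lborel. \<gamma> \<omega> k r) (u \<omega> (grid q T m i)))" for \<omega> m
  define c where "c = 1 + 4 * b + 6 * b\<^sup>2 + 4 * b ^ 3"
  define w where "w \<omega> = c * (\<Sum>k=1..4. enn2real (N1 k \<omega>))" for \<omega>
  have c: "c \<ge> 0" using b by (simp add: c_def)
  have R: "(\<lambda>n. R \<omega> (Suc n)) \<longlonglongrightarrow> 0" "\<bar>R \<omega> (Suc n)\<bar> \<le> w \<omega>"
    if \<omega>: "\<omega> \<in> \<Omega>" "\<forall>k\<in>{1..4}. N1 k \<omega> \<noteq> \<infinity>" for \<omega> n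
  proof -
    have i0: "set_integrable lborel {0..T} (\<gamma> \<omega> k)" if "k \<in> {1..4}" for k
      using \<gamma>int \<omega> that by blast
    have i1: "set_integrable lborel {q..T} (\<gamma> \<omega> k)" if "k \<in> {1..4}" for k
      by (rule set_integrable_subset[OF i0[OF that]]) (use qT in auto)
    note pl = path_limit[where u = "u \<omega>" and \<gamma> = "\<gamma> \<omega>" and B = "B \<omega>", OF qT(2) ub \<gamma>m[OF _ \<omega>(1)] i1 uleft[OF \<omega>(1)] Bm[OF \<omega>(1)]
        Bcancel[OF \<omega>(1)]]
    show "(\<lambda>n. R \<omega> (Suc n)) \<longlonglongrightarrow> 0"
      unfolding R_def a_def by (rule pl(1))
    have "\<bar>R \<omega> (Suc n)\<bar> \<le> c * (LINT r:{q..T}|lborel. \<Sum>k=1..4. \<bar>\<gamma> \<omega> k r\<bar>)"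
      unfolding R_def a_def c_def by (rule pl(2))
    also have "\<dots> \<le> w \<omega>"
      unfolding w_def
    proof (rule mult_left_mono[OF _ c])
      have "(LINT r:{q..T}|lborel. \<Sum>k=1..4. \<bar>\<gamma> \<omega> k r\<bar>) = (\<Sum>k=1..4. LINT r:{q..T}|lborel. \<bar>\<gamma> \<omega> k r\<bar>)"
        using i1[THEN set_integrable_abs]
        unfolding set_lebesgue_integral_def set_integrable_def scaleR_sum_right
        by (intro Bochner_Integration.integral_sum) auto
      also have "\<dots> \<le> (\<Sum>k=1..4. enn2real (N1 k \<omega>))"
      proof (rule sum_mono)
        fix k :: nat assume k: "k \<in> {1..4}"
        have "(LINT r:{q..T}|lborel. \<bar>\<gamma> \<omega> k r\<bar>) \<le> (LINT r:{0..T}|lborel. \<bar>\<gamma> \<omega> k r\<bar>)"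
          using i1[OF k, THEN set_integrable_abs] i0[OF k, THEN set_integrable_abs] qT
          unfolding set_lebesgue_integral_def set_integrable_def
          by (intro integral_mono) (auto simp: indicator_def)
        also have "\<dots> = enn2real (\<integral>\<^sup>+r. ennreal (indicator {0..T} r *\<^sub>R \<bar>\<gamma> \<omega> k r\<bar>) \<partial>lborel)"
          unfolding set_lebesgue_integral_def
          using i0[OF k, THEN set_integrable_abs] unfolding set_integrable_def
          by (intro integral_eq_nn_integral) auto
        also have "\<dots> = enn2real (N1 k \<omega>)"
          unfolding N1_def by (intro arg_cong[where f = enn2real] nn_integral_cong) (auto simp: indicator_def)
        finally show "(LINT r:{q..T}|lborel. \<bar>\<gamma> \<omega> k r\<bar>) \<le> enn2real (N1 k \<omega>)" .
      qed
      finally show "(LINT r:{q..T}|lborel. \<Sum>k=1..4. \<bar>\<gamma> \<omega> k r\<bar>) \<le> (\<Sum>k=1..4. enn2real (N1 k \<omega>))" .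
    qed
    finally show "\<bar>R \<omega> (Suc n)\<bar> \<le> w \<omega>" .
  qed
  define U where "U s \<omega> = ext0 f (pos Z s \<omega>)" for s \<omega>
  define J where "J k s \<omega> = (LINT r:{0..s}|lborel. ext0 (g k) (pos Z r \<omega>))" for k s \<omega>
  \<comment> \<open>The weights \<open>A\<close> and \<open>a\<close> agree on
    \<open>\<Omega>\<close>, but \<open>A\<close> is measurable for the natural filtration at the
    grid time, as a weight in the martingale identity has to be.\<close>
  define A where "A n i \<omega> = (indicator (good_until d q (t n i)) \<omega> :: real)" for n i \<omega>
  \<comment> \<open>\<open>V n\<close> is the weighted quartic variation on the grid.
    \<open>Q n\<close> replaces the increments of the powers by those of their compensators and has
    the same expectation; on good paths it is the sum treated by \<open>path_limit\<close>.\<close>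
  define V where "V n \<omega> = (\<Sum>i<Suc n. A n i \<omega> * (U (t n (Suc i)) \<omega> - U (t n i) \<omega>) ^ 4)" for n \<omega>
  define Q where "Q n \<omega> = (\<Sum>i<Suc n. A n i \<omega> *
      quartic (\<lambda>k. J k (t n (Suc i)) \<omega> - J k (t n i) \<omega>) (U (t n i) \<omega>))" for n \<omega>
  have summand: "integrable P (\<lambda>\<omega>. A n i \<omega> * (U (t n (Suc i)) \<omega> - U (t n i) \<omega>) ^ 4) \<and>
      integrable P (\<lambda>\<omega>. A n i \<omega> * quartic (\<lambda>k. J k (t n (Suc i)) \<omega> - J k (t n i) \<omega>) (U (t n i) \<omega>)) \<and>
      (\<integral>\<omega>. A n i \<omega> * (U (t n (Suc i)) \<omega> - U (t n i) \<omega>) ^ 4 \<partial>P) =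
      (\<integral>\<omega>. A n i \<omega> * quartic (\<lambda>k. J k (t n (Suc i)) \<omega> - J k (t n i) \<omega>) (U (t n i) \<omega>) \<partial>P)" for n i
  proof -
    define s where "s = t n i"
    define s' where "s' = t n (Suc i)"
    have s: "0 \<le> s" "s \<le> s'" using t[of n i] by (auto simp: s_def s'_def)
    have Um: "U s \<in> borel_measurable (natural S Z {0..s})"
      unfolding U_def
      by (rule measurable_compose[OF measurable_pos continuous_imp_measurable_ext0[OF f(1)]]) (use s in auto)
    have Am: "A n i \<in> borel_measurable (natural S Z {0..s})"
      unfolding A_def s_def by (rule borel_measurable_indicator[OF good_until_measurable[OF t(2) dS]])
    have Ub: "\<bar>U s \<omega>\<bar> \<le> b" if "\<omega> \<in> paths Z" for \<omega>
      using pos_state[OF that s(1)] f(2) b by (auto simp: U_def ext0_def)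
    define W where "W j e \<omega> = A n i \<omega> * (e * U s \<omega> ^ j)" for j e \<omega>
    have Wm: "W j e \<in> borel_measurable (natural S Z {0..s})" for j e
      unfolding W_def[abs_def] using Um Am by measurable
    have Wb: "\<bar>W j e \<omega>\<bar> \<le> \<bar>e\<bar> * b ^ j" if "\<omega> \<in> paths Z" for j e \<omega>
      using power_mono[OF Ub[OF that], of j] b
      by (auto simp: W_def abs_mult A_def indicator_def power_abs intro!: mult_left_mono)
    have fk: "(\<lambda>y. f y ^ k) \<in> borel_measurable (restrict_space borel S)" for k
      by (intro borel_measurable_continuous_on_restrict continuous_on_power f(1))
    have fkb: "\<bar>f y ^ k\<bar> \<le> b ^ k" if "y \<in> S" for y k
      unfolding power_abs by (intro power_mono f(2) that) simp
    \<comment> \<open>For a positive exponent both sides are 0 at the cemetery.\<close>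
    have Uk: "ext0 (\<lambda>y. f y ^ k) (pos Z r \<omega>) = U r \<omega> ^ k" if "k \<ge> 1" for k r \<omega>
      using that by (auto simp: U_def ext0_def split: option.split)
    have inc: "integrable P (\<lambda>\<omega>. W j e \<omega> * (U s' \<omega> ^ k - U s \<omega> ^ k))"
        "integrable P (\<lambda>\<omega>. W j e \<omega> * (J k s' \<omega> - J k s \<omega>))"
        "(\<integral>\<omega>. W j e \<omega> * (U s' \<omega> ^ k - U s \<omega> ^ k) \<partial>P) = (\<integral>\<omega>. W j e \<omega> * (J k s' \<omega> - J k s \<omega>) \<partial>P)"
      if k: "k \<in> {1..4}" for j e k
    proof -
      have "k \<ge> 1" using k by simp
      from weighted_increment[OF x fk[of k] fkb mart[OF k] Wm[of j e] Wb s, folded Lx_def, folded P_def,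
          unfolded Uk[OF this], folded J_def]
      show "integrable P (\<lambda>\<omega>. W j e \<omega> * (U s' \<omega> ^ k - U s \<omega> ^ k))"
        "integrable P (\<lambda>\<omega>. W j e \<omega> * (J k s' \<omega> - J k s \<omega>))"
        "(\<integral>\<omega>. W j e \<omega> * (U s' \<omega> ^ k - U s \<omega> ^ k) \<partial>P) = (\<integral>\<omega>. W j e \<omega> * (J k s' \<omega> - J k s \<omega>) \<partial>P)"
        by auto
    qed
    have expand: "A n i \<omega> * quartic z (U s \<omega>) =
        W 0 1 \<omega> * z 4 + W 1 (- 4) \<omega> * z 3 + W 2 6 \<omega> * z 2 + W 3 (- 4) \<omega> * z 1" for z \<omega>
      by (simp add: quartic_def W_def algebra_simps)
    have "A n i \<omega> * (U s' \<omega> - U s \<omega>) ^ 4 = A n i \<omega> * quartic (\<lambda>k. U s' \<omega> ^ k - U s \<omega> ^ k) (U s \<omega>)" for \<omega>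
      by (simp add: quartic_increment)
    then show ?thesis
      unfolding s_def[symmetric] s'_def[symmetric] expand
      using inc[of 4 0 1] inc[of 3 1 "- 4"] inc[of 2 2 6] inc[of 1 3 "- 4"]
      by (simp add: expand)
  qed
  have EVQ: "(\<integral>\<omega>. V n \<omega> \<partial>P) = (\<integral>\<omega>. Q n \<omega> \<partial>P)" "integrable P (V n)" "integrable P (Q n)" for n
    unfolding V_def[abs_def] Q_def[abs_def] using summand
    by (auto intro!: Bochner_Integration.integrable_sum sum.cong simp: Bochner_Integration.integral_sum)
  have QR: "Q n \<omega> = R \<omega> (Suc n)" if \<omega>: "\<omega> \<in> \<Omega>" "\<forall>k\<in>{1..4}. N1 k \<omega> \<noteq> \<infinity>" for n \<omega>
    unfolding Q_def R_def t_def[symmetric]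
  proof (rule sum.cong[OF refl])
    fix i assume "i \<in> {..<Suc n}"
    then have i: "t n i \<le> T" "t n (Suc i) \<le> T" by (auto intro: tT)
    have "A n i \<omega> = a \<omega> (t n i)"
      using good[OF \<omega>(1) i(1)] by (simp add: A_def a_def)
    moreover have "U (t n i) \<omega> = u \<omega> (t n i)"
      using X[OF \<omega>(1) t(2) i(1)] by (simp add: U_def u_def)
    moreover have "J k (t n (Suc i)) \<omega> - J k (t n i) \<omega> = (LINT r:{t n i..<t n (Suc i)}|lborel. \<gamma> \<omega> k r)"
      if k: "k \<in> {1..4}" for k
    proof -
      have "J k s \<omega> = (LINT r:{0..s}|lborel. \<gamma> \<omega> k r)" if "s \<le> T" for s
        unfolding J_def set_lebesgue_integral_def
        using X[OF \<omega>(1)] that by (intro Bochner_Integration.integral_cong) (auto simp: \<gamma>_def indicator_def)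
      then show ?thesis
        using set_integral_increment[OF \<gamma>int[OF \<omega>(1) k] t(2) t(3) i(2)] \<omega>(2) k i by simp
    qed
    ultimately show "A n i \<omega> * quartic (\<lambda>k. J k (t n (Suc i)) \<omega> - J k (t n i) \<omega>) (U (t n i) \<omega>) =
        a \<omega> (t n i) * quartic (\<lambda>k. LINT r:{t n i..<t n (Suc i)}|lborel. \<gamma> \<omega> k r) (u \<omega> (t n i))"
      by (simp add: quartic_def)
  qed
  have finP: "AE \<omega> in P. \<omega> \<in> \<Omega> \<and> (\<forall>k\<in>{1..4}. N1 k \<omega> \<noteq> \<infinity>)"
    unfolding P_def using fin by (rule AE_completion)
  have wint: "integrable P w"
  proof -
    have "integrable Lx (\<lambda>\<omega>. enn2real (N1 k \<omega>))" if k: "k \<in> {1..4}" for k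
    proof (rule integrableI_bounded)
      show "(\<lambda>\<omega>. enn2real (N1 k \<omega>)) \<in> borel_measurable Lx" using N1m[OF k] by measurable
      have "(\<integral>\<^sup>+\<omega>. ennreal (norm (enn2real (N1 k \<omega>))) \<partial>Lx) \<le> (\<integral>\<^sup>+\<omega>. N1 k \<omega> \<partial>Lx)"
        by (intro nn_integral_mono) (auto simp: ennreal_enn2real_if)
      then show "(\<integral>\<^sup>+\<omega>. ennreal (norm (enn2real (N1 k \<omega>))) \<partial>Lx) < \<infinity>"
        using N1fin[OF k] by (rule order_le_less_trans)
    qed
    then have "integrable Lx w"
      unfolding w_def[abs_def] by (intro integrable_mult_right Bochner_Integration.integrable_sum) auto
    then show ?thesis
      unfolding P_def by (subst integrable_completion) auto
  qed
  have "(\<lambda>n. \<integral>\<omega>. Q n \<omega> \<partial>P) \<longlonglongrightarrow> (\<integral>\<omega>. 0 \<partial>P)"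
  proof (rule integral_dominated_convergence[where w = w])
    show "AE \<omega> in P. (\<lambda>n. Q n \<omega>) \<longlonglongrightarrow> 0"
      using finP by eventually_elim (use QR R in auto)
    show "AE \<omega> in P. norm (Q n \<omega>) \<le> w \<omega>" for n
      using finP by eventually_elim (use QR R in auto)
  qed (use EVQ wint in auto)
  then have "(\<lambda>n. \<integral>\<omega>. V n \<omega> \<partial>P) \<longlonglongrightarrow> 0"
    by (simp add: EVQ)
  then have lim0: "(\<lambda>n. ennreal (\<integral>\<omega>. V n \<omega> \<partial>P)) \<longlonglongrightarrow> ennreal 0"
    by (rule tendsto_ennrealI)
  \<comment> \<open>Nonnegativity, from the even exponent, is what Fatou's lemma requires.\<close>
  have Vpos: "V n \<omega> \<ge> 0" for n \<omega>
    unfolding V_def A_def by (intro sum_nonneg mult_nonneg_nonneg) auto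
  have Vm: "(\<lambda>\<omega>. ennreal (V n \<omega>)) \<in> borel_measurable P" for n
    using EVQ(2)[of n] by measurable
  have "(\<integral>\<^sup>+\<omega>. liminf (\<lambda>n. ennreal (V n \<omega>)) \<partial>P) \<le> liminf (\<lambda>n. \<integral>\<^sup>+\<omega>. ennreal (V n \<omega>) \<partial>P)"
    by (rule nn_integral_liminf[OF Vm])
  also have "\<dots> = liminf (\<lambda>n. ennreal (\<integral>\<omega>. V n \<omega> \<partial>P))"
    using EVQ(2) Vpos by (simp add: nn_integral_eq_integral)
  also have "\<dots> = 0"
    using lim_imp_Liminf[OF _ lim0] by simp
  finally have "(\<integral>\<^sup>+\<omega>. liminf (\<lambda>n. ennreal (V n \<omega>)) \<partial>P) = 0" by simp
  moreover have "(\<lambda>\<omega>. liminf (\<lambda>n. ennreal (V n \<omega>))) \<in> borel_measurable P"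
    using Vm by measurable
  ultimately have "AE \<omega> in P. liminf (\<lambda>n. ennreal (V n \<omega>)) = 0"
    by (simp add: nn_integral_0_iff_AE)
  then have "AE \<omega> in P. no_jump_in S Z G f q T \<omega>"
    using finP
  proof eventually_elim
    case (elim \<omega>)
    then have \<omega>: "\<omega> \<in> \<Omega>" by simp
    show ?case
    proof (intro allI impI)
      fix s l assume s: "q < s" "s < T" "ereal s < lifetime Z \<omega>" and inG: "\<forall>r\<in>{q..s}. pos Z r \<omega> \<in> Some ` G"
        and l: "l \<in> S" "left_limit Z \<omega> s l"
      have s0: "s > 0" using s qT by simp
      have "f l = U s \<omega>"
      proof (rule no_jump_if_quartic_variation_vanishes[where q = q and T = T and s = s and a = "a \<omega>" and u = "\<lambda>s. U s \<omega>"])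
        show "((\<lambda>s. U s \<omega>) \<longlongrightarrow> f l) (at_left s)"
          unfolding U_def by (intro tendsto_pos_left \<Omega>(1)[OF \<omega>] s0 s f(1) l)
        show "((\<lambda>s. U s \<omega>) \<longlongrightarrow> U s \<omega>) (at_right s)"
          unfolding U_def using s0 by (intro tendsto_pos_right \<Omega>(1,2)[OF \<omega>] f(1)) simp
        show "a \<omega> r = 1" if "q \<le> r" "r \<le> s" for r
        proof -
          have "ext0 d (X \<omega> v) \<noteq> 0" if "v \<in> {q..r}" for v
          proof -
            have "v \<in> {q..s}" "0 \<le> v" "v \<le> T" using that \<open>r \<le> s\<close> s qT by auto
            then show ?thesis
              using inG X[OF \<omega>, of v] d(3) G'(2) by (force simp: ext0_def)
          qed
          then have "B \<omega> \<inter> {q..r} = {}" by (auto simp: B_def)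
          then show ?thesis by (simp add: a_def)
        qed
        have "V n \<omega> = (\<Sum>i<Suc n. a \<omega> (grid q T (Suc n) i) *
            (U (grid q T (Suc n) (Suc i)) \<omega> - U (grid q T (Suc n) i) \<omega>) ^ 4)" for n
          unfolding V_def t_def[symmetric]
        proof (rule sum.cong[OF refl])
          fix i assume "i \<in> {..<Suc n}"
          then have "t n i \<le> T" by (auto intro: tT)
          then have "A n i \<omega> = a \<omega> (t n i)"
            using good[OF \<omega>] by (simp add: A_def a_def)
          then show "A n i \<omega> * (U (t n (Suc i)) \<omega> - U (t n i) \<omega>) ^ 4 =
              a \<omega> (t n i) * (U (t n (Suc i)) \<omega> - U (t n i) \<omega>) ^ 4" by simp
        qed
        then show "liminf (\<lambda>n. ennreal (\<Sum>i<Suc n. a \<omega> (grid q T (Suc n) i) *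
            (U (grid q T (Suc n) (Suc i)) \<omega> - U (grid q T (Suc n) i) \<omega>) ^ 4)) = 0"
          using elim by simp
      qed (use s in \<open>auto simp: a_def\<close>)
      moreover have "pos Z s \<omega> \<in> Some ` G" using inG s by auto
      ultimately show "f l = f (the (pos Z s \<omega>))" by (auto simp: U_def ext0_def)
    qed
  qed
  then show ?thesis
    unfolding P_def AE_completion_iff Lx_def .
qed

end

section \<open>Time intervals spent in the open set\<close>

context markov
begin

lemma hitting_nonneg: "hitting Z A \<omega> \<ge> 0"
  unfolding hitting_def by (rule Inf_greatest) auto

lemma entry_time_nonneg: "entry_time S Z G g k \<omega> \<ge> 0"
  by (induction k) (auto simp: hitting_nonneg hitting_after_def)

text \<open>Between an entry time \<open>e\<close> and the following exit the path avoids
  \<open>S - G\<close>. At \<open>e\<close> itself it may still be outside, as entry times are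
  infima and hitting times look at strictly positive times only. So the interval starts at some
  \<open>q\<close> strictly after \<open>e\<close>, chosen rational for the sake of
  countability.\<close>

lemma times_in_G:
  assumes \<omega>: "\<omega> \<in> paths Z" and t: "t \<in> times_in S Z G Gs \<omega>" "ereal t < lifetime Z \<omega>"
  shows "\<exists>q :: rat. 0 \<le> real_of_rat q \<and> real_of_rat q < t \<and> (\<forall>s\<in>{real_of_rat q..t}. pos Z s \<omega> \<in> Some ` G)"
proof -
  obtain n k where entry: "entry_time S Z G (Gs n) k \<omega> < ereal t"
    and exit: "ereal t < exit_time S Z G (Gs n) k \<omega>"
    using t(1) unfolding times_in_def by blast
  obtain e where e: "entry_time S Z G (Gs n) k \<omega> = ereal e" "e \<ge> 0" "e < t"
    using entry entry_time_nonneg[of G "Gs n" k \<omega>] by (cases "entry_time S Z G (Gs n) k \<omega>") auto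
  have out: "ereal t < ereal e + hitting Z (S - G) (shift Z e \<omega>)"
    using exit by (simp add: exit_time_def hitting_after_def e)
  obtain q where q: "e < real_of_rat q" "real_of_rat q < t"
    using of_rat_dense[OF e(3)] by blast
  have "pos Z s \<omega> \<in> Some ` G" if s: "s \<in> {real_of_rat q..t}" for s
  proof -
    have s': "e < s" "s \<le> t" using s q by auto
    have "ereal s < lifetime Z \<omega>"
      using s' t(2) by (auto intro: le_less_trans[of "ereal s" "ereal t"])
    then obtain y where y: "y \<in> S" "pos Z s \<omega> = Some y"
      using pos_alive[OF \<omega>, of s] s' e by auto
    have "y \<in> G"
    proof (rule ccontr)
      assume "y \<notin> G"
      have "pos Z (s - e) (shift Z e \<omega>) = pos Z s \<omega>"
        using pos_shift[OF \<omega> e(2), of "s - e"] s' by simp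
      then have "pos Z (s - e) (shift Z e \<omega>) \<in> Some ` (S - G)"
        using y \<open>y \<notin> G\<close> by simp
      then have "hitting Z (S - G) (shift Z e \<omega>) \<le> ereal (s - e)"
        unfolding hitting_def using s'(1) by (intro Inf_lower) auto
      then have "ereal e + hitting Z (S - G) (shift Z e \<omega>) \<le> ereal e + ereal (s - e)"
        by (rule add_left_mono)
      from less_le_trans[OF out this] show False using s' by simp
    qed
    then show ?thesis using y by simp
  qed
  moreover have "0 \<le> real_of_rat q" using e(2) q(1) by linarith
  ultimately show ?thesis using q(2) by blast
qed

end

text \<open>Jumps visible to one bump, between one rational starting time and one horizon, are
  excluded almost surely. Countability yields a common null set, and since the bumps separate
  points, left limit and value coincide at every time in question.\<close>

theorem corollary4p2:
  fixes K :: "('h::{real_inner, polish_space}) coefficients"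
    and I :: "real set" and M :: "'h set"
    and Z :: "('w, real \<times> 'h) process"
  assumes coefs: "admissible K"
    and I: "is_interval I" "interior I \<noteq> {}" "I \<subseteq> {0..}"
    and M: "M \<in> sets borel" "M \<subseteq> bdom K"
    and X: "right_process (I \<times> M) Z" "cadlag_process (I \<times> M) Z"
    and mp: "solves_martingale_problem (I \<times> M) Z (parabolic_op K I) (test_functions K I)"
  shows "((\<exists>\<alpha>>0. \<forall>f\<in>test_functions K I. \<forall>x\<in>I \<times> M.
             resolvent Z \<alpha> (\<lambda>p. ennreal \<bar>parabolic_op K I f p\<bar>) x < \<infinity>)
           \<longrightarrow> diffusion_in (I \<times> M) Z
                 ((top_of_set (I \<times> M)) interior_of (no_jump_set K \<inter> (I \<times> M))))
       \<and> (bounded_coefficients K (I \<times> M)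
           \<longrightarrow> (\<exists>\<alpha>>0. \<forall>f\<in>test_functions K I. \<forall>x\<in>I \<times> M.
             resolvent Z \<alpha> (\<lambda>p. ennreal \<bar>parabolic_op K I f p\<bar>) x < \<infinity>))"
proof (intro conjI impI)
  let ?S = "I \<times> M"
  interpret markov ?S Z
    using X(1) by unfold_locales (simp add: right_process_def)
  show "\<exists>\<alpha>>0. \<forall>f\<in>test_functions K I. \<forall>x\<in>?S.
      resolvent Z \<alpha> (\<lambda>p. ennreal \<bar>parabolic_op K I f p\<bar>) x < \<infinity>" if bdd: "bounded_coefficients K ?S"
  proof (intro exI[of _ 1] conjI ballI)
    fix f x assume f: "f \<in> test_functions K I" and x: "x \<in> ?S"
    obtain C where "C \<ge> 0" "\<forall>p\<in>?S. \<bar>parabolic_op K I f p\<bar> \<le> C"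
      using parabolic_op_bounded[OF coefs I f bdd] by blast
    then show "resolvent Z 1 (\<lambda>p. ennreal \<bar>parabolic_op K I f p\<bar>) x < \<infinity>"
      by (intro finite_resolvent_of_bounded[OF x, of _ C]) (auto intro: ennreal_leI)
  qed simp
  assume "\<exists>\<alpha>>0. \<forall>f\<in>test_functions K I. \<forall>x\<in>?S.
      resolvent Z \<alpha> (\<lambda>p. ennreal \<bar>parabolic_op K I f p\<bar>) x < \<infinity>"
  then obtain \<alpha> where \<alpha>: "\<alpha> > 0"
    and res: "\<And>f x. f \<in> test_functions K I \<Longrightarrow> x \<in> ?S \<Longrightarrow>
      resolvent Z \<alpha> (\<lambda>p. ennreal \<bar>parabolic_op K I f p\<bar>) x < \<infinity>"
    by blast
  define G where "G = (top_of_set ?S) interior_of (no_jump_set K \<inter> ?S)"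
  have G: "openin (top_of_set ?S) G" "G \<subseteq> no_jump_set K \<inter> ?S"
    unfolding G_def by (rule openin_interior_of, rule interior_of_subset)
  have total: "closure (span (range (test K))) = UNIV"
    using coefs unfolding admissible_def by (elim conjE)
  show "diffusion_in ?S Z ((top_of_set ?S) interior_of (no_jump_set K \<inter> ?S))"
    unfolding G_def[symmetric] diffusion_in_def
  proof (intro allI impI ballI)
    fix Gs x assume x: "x \<in> ?S"
    have cadlag: "AE \<omega> in law Z (Some x). right_continuous_path Z \<omega> \<and>
        has_left_limits ?S Z \<omega>"
      using X(2) x unfolding cadlag_process_def by blast
    have "AE \<omega> in law Z (Some x). no_jump_in ?S Z G f q T \<omega>"
      if f: "f \<in> test_functions K I" and q: "0 \<le> q" "q < T" for f q T
    proof -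
      obtain b where b: "\<forall>t\<in>I. \<forall>x. \<bar>f (t, x)\<bar> \<le> b"
        using test_functions_bounded[OF f] by blast
      have pow: "(\<lambda>p. f p ^ k) \<in> test_functions K I" if "k \<in> {1..4}" for k
        using test_functions_power[OF f] that by simp
      show ?thesis
      proof (rule no_jump[OF x cadlag _ _ _ _ _ \<alpha> G(1) _ q])
        show "continuous_on ?S f"
          by (rule continuous_on_subset[OF test_functions_continuous[OF f]]) auto
        show "\<bar>f y\<bar> \<le> b" if "y \<in> ?S" for y
          using b that by auto
        show "parabolic_op K I (\<lambda>p. f p ^ k) \<in> borel_measurable (restrict_space borel ?S)"
          if "k \<in> {1..4}" for k
          using mp pow[OF that] unfolding solves_martingale_problem_def by blast
        show "martingale (completion (law Z (Some x))) (augmented ?S Z)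
            (\<lambda>t \<omega>. let \<tau> = real_of_ereal (min (ereal t) (lifetime Z \<omega>)) in
               ext0 (\<lambda>y. f y ^ k) (pos Z \<tau> \<omega>) -
               (LINT r:{0..\<tau>}|lborel. ext0 (parabolic_op K I (\<lambda>p. f p ^ k)) (pos Z r \<omega>)))"
          if "k \<in> {1..4}" for k
          using mp pow[OF that] x unfolding solves_martingale_problem_def by blast
        show "resolvent Z \<alpha> (\<lambda>y. ennreal \<bar>parabolic_op K I (\<lambda>p. f p ^ k) y\<bar>) x < \<infinity>"
          if "k \<in> {1..4}" for k
          by (rule res[OF pow[OF that] x])
        show "quartic (\<lambda>k. parabolic_op K I (\<lambda>p. f p ^ k) y) (f y) = 0" if y: "y \<in> G" for y
        proof -
          obtain t z where "y = (t, z)" "t \<in> I" "(t, z) \<in> no_jump_set K"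
            using y G(2) by (cases y) auto
          then show ?thesis
            using parabolic_op_powers_cancel[OF coefs I f, of t z] by (simp add: quartic_def)
        qed
      qed
    qed
    \<comment> \<open>The horizons \<open>q + n + 1\<close> exceed any given time for large
      \<open>n\<close>, and there are only countably many of them.\<close>
    then have "AE \<omega> in law Z (Some x). \<forall>c q n. rational_bump K c \<in> test_functions K I \<longrightarrow>
        0 \<le> real_of_rat q \<longrightarrow> no_jump_in ?S Z G (rational_bump K c) (real_of_rat q) (real_of_rat q + real (Suc n)) \<omega>"
      unfolding AE_all_countable by auto
    then show "AE \<omega> in law Z (Some x). continuous_on
        (times_in ?S Z G Gs \<omega> \<inter> {t. 0 \<le> t \<and> ereal t < lifetime Z \<omega>}) (\<lambda>t. the (pos Z t \<omega>))"
      using cadlag AE_space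
    proof eventually_elim
      case (elim \<omega>)
      have \<omega>: "\<omega> \<in> paths Z"
        using elim(3) law_props(3)[of "Some x"] x by simp
      show ?case
        unfolding continuous_on_def
      proof (intro ballI)
        fix t assume t: "t \<in> times_in ?S Z G Gs \<omega> \<inter> {t. 0 \<le> t \<and> ereal t < lifetime Z \<omega>}"
        then have alive: "ereal t < lifetime Z \<omega>" and "0 \<le> t" by auto
        obtain q where q: "0 \<le> real_of_rat q" "real_of_rat q < t"
          and inG: "\<forall>s\<in>{real_of_rat q..t}. pos Z s \<omega> \<in> Some ` G"
          using times_in_G[OF \<omega>, of t G Gs] t by blast
        have "0 < t" using q by linarith
        then obtain l where l: "l \<in> ?S" "left_limit Z \<omega> t l"
          using elim(2) alive by blast
        obtain n where "t < real n"
          using reals_Archimedean2 by blast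
        then have T: "t < real_of_rat q + real (Suc n)"
          using q(1) unfolding of_nat_Suc by linarith
        have same: "rational_bump K c l = rational_bump K c (the (pos Z t \<omega>))"
          if "rational_bump K c \<in> test_functions K I" for c
          using elim(1)[rule_format, OF that q(1) q(2) T alive _ l] inG by blast
        \<comment> \<open>The left limit lies in the state space, so its time belongs to
          \<open>I\<close>, as the separation lemma demands of its first point.\<close>
        have "l = the (pos Z t \<omega>)"
        proof (rule ccontr)
          assume ne: "l \<noteq> the (pos Z t \<omega>)"
          obtain t1 x1 t2 x2 where tx: "l = (t1, x1)" "the (pos Z t \<omega>) = (t2, x2)"
            by force
          then have "t1 \<in> I" using l(1) by simp
          from rational_bumps_separate[OF I(1) total this, of x1 t2 x2] ne same show False
            unfolding tx by blast
        qed
        then have "left_limit Z \<omega> t (the (pos Z t \<omega>))"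
          using l(2) by simp
        moreover have "((\<lambda>s. the (pos Z s \<omega>)) \<longlongrightarrow> the (pos Z t \<omega>)) (at_right t)"
          using elim(2) \<open>0 \<le> t\<close> alive by (simp add: right_continuous_path_def continuous_within)
        \<comment> \<open>Two-sided continuity at \<open>t\<close> is obtained, which implies
          continuity relative to any set of times.\<close>
        ultimately have "((\<lambda>s. the (pos Z s \<omega>)) \<longlongrightarrow> the (pos Z t \<omega>)) (at t)"
          by (simp add: filterlim_at_split)
        then show "((\<lambda>s. the (pos Z s \<omega>)) \<longlongrightarrow> the (pos Z t \<omega>))
            (at t within times_in ?S Z G Gs \<omega> \<inter> {t. 0 \<le> t \<and> ereal t < lifetime Z \<omega>})"
          by (rule tendsto_within_subset) simp
      qed
    qed
  qed
qed

end
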